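(* Let $L$ be a countable signature, let $t$ be a Polish topology on $\mathrm{Mod}(L)$ consisting of Borel subsets of the standard (product) topology, and let $1\le\alpha<\omega_1$. There exists a fragment $F$ of $L_{\omega_1\omega}(L)$ such that $A^*\in\boldsymbol{\Pi}^0_\alpha(t_F)$ and $A^{*\bar a,1/k}\in\boldsymbol{\Pi}^0_\alpha(t_F)$ for every $A\in\boldsymbol{\Pi}^0_\alpha(t)$, every $\bar a\in\mathbb N^{<\mathbb N}$ and every integer $k>0$.
   Context: Continuous logic setting. A signature $L$ is a countable set of predicate symbols $P_0=d,P_1,\dots$ with arities, moduli of continuity and compact bounds; metric structures are complete metric spaces interpreting them accordingly; $d(\bar a,\bar b)=\max\{d(a_i,b_i):i<\min\}$ for tuples/sequences. Formulas of $L_{\omega_1\omega}(L)$: from atomic ones via $\phi+\psi$, $r\phi$ ($r\in\mathbb Q$), $\max$, constant $1$, $\sup_x,\inf_x$, countable suprema/infima of formulas with common finite free variables, modulus and bound. A fragment is a countable set of formulas containing the atomic ones, closed under finitary connectives, quantifiers, subformulas and term substitution. $\mathrm{Mod}(L)$ is the Polish space of separable complete metric $L$-structures $M$ with a distinguished tail-dense sequence, coded by the predicate values on it (product topology); $\mathbb N^{<\mathbb N}$ denotes tuples of distinguished elements. $t_F$ is the topology generated by $\{M:\phi^M(\bar a)<r\}$, $\phi\in F$, $\bar a\in\mathbb N^{<\mathbb N}$, $r\in\mathbb Q$. For $M\in\mathrm{Mod}(L)$, $D(M)\subseteq M^{\mathbb N}$ is the Polish space of tail-dense sequences in $M$, and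 $\pi(y)\in\mathrm{Mod}(L)$ is the code of $M$ with distinguished sequence $y$. For $A\subseteq\mathrm{Mod}(L)$: $M\in A^{*\bar a,u}$ iff for comeager many $y\in\{y\in D(M):d(y,\bar a)<u\}$, $\pi(y)\in A$; $M\in A^*$ iff for comeager many $y\in D(M)$, $\pi(y)\in A$. *)

theory Defs
  imports "HOL-Analysis.Analysis" "HOL-Library.Countable_Set_Type"
begin

section \<open>Countable ordinals and the Borel hierarchy\<close>

text \<open>The elements of the well-order \<^term>\<open>cardSuc natLeq\<close>, the successor cardinal of
  \<open>\<aleph>\<^sub>0\<close>, are exactly the ordinals below \<open>\<omega>\<^sub>1\<close>.\<close>

lemma cardSuc_natLeq_props:
  "Card_order (cardSuc natLeq)" "Well_order (cardSuc natLeq)"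
  "Cinfinite (cardSuc natLeq)"
proof -
  show *: "Card_order (cardSuc natLeq)"
    by (simp add: cardSuc_Card_order natLeq_Card_order)
  then show "Well_order (cardSuc natLeq)"
    by (simp add: card_order_on_well_order_on)
  show "Cinfinite (cardSuc natLeq)"
    by (simp add: Cinfinite_cardSuc natLeq_Cinfinite)
qed

lemma infinite_Field_cardSuc_natLeq: "infinite (Field (cardSuc natLeq))"
  using cardSuc_natLeq_props(3) by (simp add: cinfinite_def)

typedef omega1 = "Field (cardSuc natLeq)"
  using infinite_Field_cardSuc_natLeq by (auto simp: ex_in_conv)

instantiation omega1 :: wellorder
begin

definition less_eq_omega1 :: "omega1 \<Rightarrow> omega1 \<Rightarrow> bool" where
  "x \<le> y \<longleftrightarrow> (Rep_omega1 x, Rep_omega1 y) \<in> cardSuc natLeq"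

definition less_omega1 :: "omega1 \<Rightarrow> omega1 \<Rightarrow> bool" where
  "x < y \<longleftrightarrow> x \<le> y \<and> x \<noteq> (y :: omega1)"

instance
proof
  have W: "wo_rel (cardSuc natLeq)"
    using cardSuc_natLeq_props(2) by (simp add: wo_rel_def)
  have refl: "x \<le> x" for x :: omega1
    unfolding less_eq_omega1_def by (rule refl_onD[OF wo_rel.REFL[OF W] Rep_omega1])
  have antisym: "x = y" if "x \<le> y" "y \<le> x" for x y :: omega1
    using antisymD[OF wo_rel.ANTISYM[OF W] that[unfolded less_eq_omega1_def]]
    by (simp add: Rep_omega1_inject)
  have trans: "x \<le> z" if "x \<le> y" "y \<le> z" for x y z :: omega1
    using transD[OF wo_rel.TRANS[OF W] that[unfolded less_eq_omega1_def]]
    by (simp add: less_eq_omega1_def)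
  fix x y z :: omega1
  show "x \<le> x" by (rule refl)
  show "x \<le> y \<Longrightarrow> y \<le> x \<Longrightarrow> x = y" by (rule antisym)
  show "x \<le> y \<Longrightarrow> y \<le> z \<Longrightarrow> x \<le> z" by (rule trans)
  show "(x < y) = (x \<le> y \<and> \<not> y \<le> x)"
    unfolding less_omega1_def using antisym[of x y] refl[of x] by auto
  show "x \<le> y \<or> y \<le> x"
    unfolding less_eq_omega1_def
    by (rule wo_rel.TOTALS[OF W, rule_format, OF Rep_omega1 Rep_omega1])
next
  fix P :: "omega1 \<Rightarrow> bool" and a :: omega1
  assume step: "\<And>x. (\<And>y. y < x \<Longrightarrow> P y) \<Longrightarrow> P x"
  have W: "wo_rel (cardSuc natLeq)"
    using cardSuc_natLeq_props(2) by (simp add: wo_rel_def)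
  have wf: "wf (cardSuc natLeq - Id)"
    by (rule wo_rel.WF[OF W])
  have "wf (inv_image (cardSuc natLeq - Id) Rep_omega1)"
    using wf by (rule wf_inv_image)
  then show "P a"
  proof (induction a rule: wf_induct_rule)
    case (less x)
    show ?case
      by (rule step, rule less)
        (auto simp: less_omega1_def less_eq_omega1_def in_inv_image Rep_omega1_inject)
  qed
qed

end

instantiation omega1 :: zero_neq_one
begin

definition zero_omega1 :: omega1 where "(0::omega1) = (LEAST x. True)"
definition one_omega1 :: omega1 where "(1::omega1) = (LEAST x. x \<noteq> 0)"

instance
proof
  have "infinite (UNIV :: omega1 set)"
    using infinite_Field_cardSuc_natLeq
      type_definition.Rep_range[OF type_definition_omega1] finite_imageI[of UNIV Rep_omega1]
    by auto
  then have "(UNIV :: omega1 set) \<noteq> {0}"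
    using finite.intros by metis
  then have "\<exists>x. x \<noteq> (0::omega1)"
    by blast
  then have "(1::omega1) \<noteq> 0"
    unfolding one_omega1_def by (rule LeastI_ex)
  then show "(0::omega1) \<noteq> 1" by simp
qed

end

lemma countable_below_omega1:
  includes cardinal_syntax
  shows "countable {..<\<alpha>::omega1}"
proof -
  have "|underS (cardSuc natLeq) (Rep_omega1 \<alpha>)| <o cardSuc natLeq"
    by (rule card_of_underS[OF cardSuc_natLeq_props(1) Rep_omega1])
  then have "|underS (cardSuc natLeq) (Rep_omega1 \<alpha>)| \<le>o natLeq"
    using cardSuc_ordLeq_ordLess[OF natLeq_Card_order card_of_Card_order] by blast
  then have "countable (underS (cardSuc natLeq) (Rep_omega1 \<alpha>))"
    by (simp add: countable_card_le_natLeq)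
  moreover have "Rep_omega1 ` {..<\<alpha>} \<subseteq> underS (cardSuc natLeq) (Rep_omega1 \<alpha>)"
    by (auto simp: underS_def less_omega1_def less_eq_omega1_def Rep_omega1_inject)
  ultimately have "countable (Rep_omega1 ` {..<\<alpha>})"
    by (rule countable_subset[rotated])
  then show ?thesis
    by (rule countable_image_inj_on) (auto simp: inj_on_def Rep_omega1_inject)
qed

lemma uncountable_omega1:
  includes cardinal_syntax
  shows "uncountable (UNIV :: omega1 set)"
proof
  assume "countable (UNIV :: omega1 set)"
  then have "countable (Field (cardSuc natLeq))"
    using type_definition.Rep_range[OF type_definition_omega1]
      countable_image[of UNIV Rep_omega1] by simp
  then have "|Field (cardSuc natLeq)| \<le>o natLeq"
    by (simp add: countable_card_le_natLeq)
  then have "cardSuc natLeq \<le>o natLeq"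
    using card_of_Field_ordIso[OF cardSuc_natLeq_props(1)] ordIso_ordLeq_trans ordIso_symmetric
    by blast
  then show False
    using cardSuc_greater[OF natLeq_Card_order] not_ordLess_ordLeq by blast
qed

inductive Sigma0 :: "'a topology \<Rightarrow> omega1 \<Rightarrow> 'a set \<Rightarrow> bool"
  and Pi0 :: "'a topology \<Rightarrow> omega1 \<Rightarrow> 'a set \<Rightarrow> bool"
  for X :: "'a topology"
where
  Sigma0_one: "openin X A \<Longrightarrow> Sigma0 X 1 A"
| Sigma0_step: "1 < \<alpha> \<Longrightarrow> (\<And>n::nat. 1 \<le> \<beta> n \<and> \<beta> n < \<alpha> \<and> Pi0 X (\<beta> n) (B n))
    \<Longrightarrow> Sigma0 X \<alpha> (\<Union>n. B n)"
| Pi0: "Sigma0 X \<alpha> A \<Longrightarrow> Pi0 X \<alpha> (topspace X - A)"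

definition polish_topology :: "'a topology \<Rightarrow> bool" where
  "polish_topology X \<longleftrightarrow> completely_metrizable_space X \<and> separable_space X"

definition borel_sets_of :: "'a topology \<Rightarrow> 'a set set" where
  "borel_sets_of X = sigma_sets (topspace X) {U. openin X U}"

definition nowhere_dense_in :: "'a topology \<Rightarrow> 'a set \<Rightarrow> bool" where
  "nowhere_dense_in X S \<longleftrightarrow> S \<subseteq> topspace X \<and> X interior_of (X closure_of S) = {}"

definition meager_in :: "'a topology \<Rightarrow> 'a set \<Rightarrow> bool" where
  "meager_in X S \<longleftrightarrow> (\<exists>N :: nat \<Rightarrow> 'a set. (\<forall>n. nowhere_dense_in X (N n)) \<and> S \<subseteq> (\<Union>n. N n))"

definition comeager_in :: "'a topology \<Rightarrow> 'a set \<Rightarrow> bool" where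
  "comeager_in X S \<longleftrightarrow> meager_in X (topspace X - S)"


section \<open>Signatures and metric structures\<close>

text \<open>A modulus of continuity in the variables indexed by \<open>V\<close> is a continuous, nondecreasing,
  subadditive function \<open>[0,\<infinity>)\<^sup>V \<rightarrow> [0,\<infinity>)\<close> that vanishes at the origin.  It is represented as a
  function on \<^typ>\<open>nat \<Rightarrow> real\<close>; monotonicity along \<open>V\<close> forces it to depend on the coordinates
  in \<open>V\<close> only, and so continuity in the product topology is continuity on \<open>[0,\<infinity>)\<^sup>V\<close>.\<close>

definition is_modulus :: "nat set \<Rightarrow> ((nat \<Rightarrow> real) \<Rightarrow> real) \<Rightarrow> bool" where
  "is_modulus V \<Delta> \<longleftrightarrow> finite V
    \<and> \<Delta> (\<lambda>_. 0) = 0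
    \<and> (\<forall>\<delta> \<epsilon>. (\<forall>i\<in>V. 0 \<le> \<delta> i \<and> \<delta> i \<le> \<epsilon> i) \<longrightarrow> \<Delta> \<delta> \<le> \<Delta> \<epsilon>)
    \<and> (\<forall>\<delta> \<epsilon>. (\<forall>i\<in>V. 0 \<le> \<delta> i \<and> 0 \<le> \<epsilon> i) \<longrightarrow> \<Delta> (\<lambda>i. \<delta> i + \<epsilon> i) \<le> \<Delta> \<delta> + \<Delta> \<epsilon>)
    \<and> continuous_on {\<delta>. \<forall>i\<in>V. 0 \<le> \<delta> i} \<Delta>"

text \<open>The predicate symbols are \<open>P\<^sub>i\<close> for \<open>i \<in> syms L\<close>, and \<open>P\<^sub>0\<close> is the metric symbol.\<close>

record signature =
  syms :: "nat set"
  arity :: "nat \<Rightarrow> nat"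
  modulus :: "nat \<Rightarrow> (nat \<Rightarrow> real) \<Rightarrow> real"
  bound :: "nat \<Rightarrow> real set"

definition is_signature :: "signature \<Rightarrow> bool" where
  "is_signature L \<longleftrightarrow> 0 \<in> syms L \<and> arity L 0 = 2
    \<and> (\<forall>P\<in>syms L. is_modulus {..<arity L P} (modulus L P) \<and> compact (bound L P))"

record 'm mstruct =
  universe :: "'m set"
  interp :: "nat \<Rightarrow> 'm list \<Rightarrow> real"

text \<open>The library's metric spaces are carrier sets, but ask for nonnegativity and symmetry on
  the whole type; hence the truncation outside the universe.\<close>

definition mdst :: "'m mstruct \<Rightarrow> 'm \<Rightarrow> 'm \<Rightarrow> real" where
  "mdst S x y = (if x \<in> universe S \<and> y \<in> universe S then interp S 0 [x, y] else 0)"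

abbreviation mtop :: "'m mstruct \<Rightarrow> 'm topology" where
  "mtop S \<equiv> Metric_space.mtopology (universe S) (mdst S)"

definition is_structure :: "signature \<Rightarrow> 'm mstruct \<Rightarrow> bool" where
  "is_structure L S \<longleftrightarrow>
      Metric_space (universe S) (mdst S)
    \<and> Metric_space.mcomplete (universe S) (mdst S)
    \<and> (\<forall>P\<in>syms L. \<forall>xs. length xs = arity L P \<and> set xs \<subseteq> universe S
         \<longrightarrow> interp S P xs \<in> bound L P)
    \<and> (\<forall>P\<in>syms L. \<forall>xs ys. length xs = arity L P \<and> set xs \<subseteq> universe S
           \<and> length ys = arity L P \<and> set ys \<subseteq> universe S
         \<longrightarrow> \<bar>interp S P xs - interp S P ys\<bar> \<le> modulus L P (\<lambda>i. mdst S (xs ! i) (ys ! i)))"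

definition tail_dense :: "'m mstruct \<Rightarrow> (nat \<Rightarrow> 'm) set" where
  "tail_dense S = {y. range y \<subseteq> universe S
    \<and> (\<forall>n. mtop S closure_of (y ` {n..}) = universe S)}"

definition tail_dense_topology :: "'m mstruct \<Rightarrow> (nat \<Rightarrow> 'm) topology" where
  "tail_dense_topology S = subtopology (product_topology (\<lambda>_. mtop S) UNIV) (tail_dense S)"

text \<open>The distance between a sequence and a tuple; the maximum over no coordinates is \<open>0\<close>.\<close>

definition seq_dist :: "'m mstruct \<Rightarrow> (nat \<Rightarrow> 'm) \<Rightarrow> 'm list \<Rightarrow> real" where
  "seq_dist S y a = Max (insert 0 ((\<lambda>i. mdst S (y i) (a ! i)) ` {..<length a}))"


section \<open>The space of codes\<close>

text \<open>A code records the value of every predicate symbol at every tuple of indices into the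
  distinguished sequence.\<close>

type_synonym code = "nat \<times> nat list \<Rightarrow> real"

definition code_index :: "signature \<Rightarrow> (nat \<times> nat list) set" where
  "code_index L = {(P, js). P \<in> syms L \<and> length js = arity L P}"

definition code_of :: "signature \<Rightarrow> 'm mstruct \<Rightarrow> (nat \<Rightarrow> 'm) \<Rightarrow> code" where
  "code_of L S y = (\<lambda>(P, js) \<in> code_index L. interp S P (map y js))"

text \<open>Structures with a dense sequence \<open>y\<close> may be taken to live in the type
  \<^typ>\<open>nat \<Rightarrow> real\<close>: the map \<open>p \<mapsto> (\<lambda>j. d(p, y\<^sub>j))\<close> is injective.\<close>

type_synonym point = "nat \<Rightarrow> real"

definition pointed_structures :: "signature \<Rightarrow> (point mstruct \<times> (nat \<Rightarrow> point)) set" where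
  "pointed_structures L = {(S, y). is_structure L S \<and> y \<in> tail_dense S}"

definition Mod :: "signature \<Rightarrow> code set" where
  "Mod L = {code_of L S y | S y. (S, y) \<in> pointed_structures L}"

definition Mod_topology :: "signature \<Rightarrow> code topology" where
  "Mod_topology L = subtopology (product_topology (\<lambda>_. euclideanreal) (code_index L)) (Mod L)"


section \<open>Infinitary continuous logic\<close>

text \<open>Variables are de Bruijn indices: \<open>SupQ\<close> and \<open>InfQ\<close> bind the variable \<open>0\<close> of their
  argument.\<close>

datatype fm =
    Pred nat "nat list"
  | One
  | Add fm fm
  | Scale rat fm
  | MaxF fm fm
  | SupQ fm
  | InfQ fm
  | CSup "nat \<Rightarrow> fm"
  | CInf "nat \<Rightarrow> fm"

primrec fv :: "fm \<Rightarrow> nat set" where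
  "fv (Pred P xs) = set xs"
| "fv One = {}"
| "fv (Add \<phi> \<psi>) = fv \<phi> \<union> fv \<psi>"
| "fv (Scale r \<phi>) = fv \<phi>"
| "fv (MaxF \<phi> \<psi>) = fv \<phi> \<union> fv \<psi>"
| "fv (SupQ \<phi>) = {n. Suc n \<in> fv \<phi>}"
| "fv (InfQ \<phi>) = {n. Suc n \<in> fv \<phi>}"
| "fv (CSup f) = (\<Union>n. fv (f n))"
| "fv (CInf f) = (\<Union>n. fv (f n))"

primrec subst :: "(nat \<Rightarrow> nat) \<Rightarrow> fm \<Rightarrow> fm" where
  "subst \<sigma> (Pred P xs) = Pred P (map \<sigma> xs)"
| "subst \<sigma> One = One"
| "subst \<sigma> (Add \<phi> \<psi>) = Add (subst \<sigma> \<phi>) (subst \<sigma> \<psi>)"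
| "subst \<sigma> (Scale r \<phi>) = Scale r (subst \<sigma> \<phi>)"
| "subst \<sigma> (MaxF \<phi> \<psi>) = MaxF (subst \<sigma> \<phi>) (subst \<sigma> \<psi>)"
| "subst \<sigma> (SupQ \<phi>) = SupQ (subst (case_nat 0 (Suc \<circ> \<sigma>)) \<phi>)"
| "subst \<sigma> (InfQ \<phi>) = InfQ (subst (case_nat 0 (Suc \<circ> \<sigma>)) \<phi>)"
| "subst \<sigma> (CSup f) = CSup (\<lambda>n. subst \<sigma> (f n))"
| "subst \<sigma> (CInf f) = CInf (\<lambda>n. subst \<sigma> (f n))"

primrec subformulas :: "fm \<Rightarrow> fm set" where
  "subformulas (Pred P xs) = {Pred P xs}"
| "subformulas One = {One}"
| "subformulas (Add \<phi> \<psi>) = insert (Add \<phi> \<psi>) (subformulas \<phi> \<union> subformulas \<psi>)"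
| "subformulas (Scale r \<phi>) = insert (Scale r \<phi>) (subformulas \<phi>)"
| "subformulas (MaxF \<phi> \<psi>) = insert (MaxF \<phi> \<psi>) (subformulas \<phi> \<union> subformulas \<psi>)"
| "subformulas (SupQ \<phi>) = insert (SupQ \<phi>) (subformulas \<phi>)"
| "subformulas (InfQ \<phi>) = insert (InfQ \<phi>) (subformulas \<phi>)"
| "subformulas (CSup f) = insert (CSup f) (\<Union>n. subformulas (f n))"
| "subformulas (CInf f) = insert (CInf f) (\<Union>n. subformulas (f n))"

primrec eval :: "'m mstruct \<Rightarrow> fm \<Rightarrow> (nat \<Rightarrow> 'm) \<Rightarrow> real" where
  "eval S (Pred P xs) e = interp S P (map e xs)"
| "eval S One e = 1"
| "eval S (Add \<phi> \<psi>) e = eval S \<phi> e + eval S \<psi> e"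
| "eval S (Scale r \<phi>) e = of_rat r * eval S \<phi> e"
| "eval S (MaxF \<phi> \<psi>) e = max (eval S \<phi> e) (eval S \<psi> e)"
| "eval S (SupQ \<phi>) e = (SUP x\<in>universe S. eval S \<phi> (case_nat x e))"
| "eval S (InfQ \<phi>) e = (INF x\<in>universe S. eval S \<phi> (case_nat x e))"
| "eval S (CSup f) e = (SUP n. eval S (f n) e)"
| "eval S (CInf f) e = (INF n. eval S (f n) e)"

text \<open>\<open>formula L \<phi> \<Delta> K\<close>: \<open>\<phi>\<close> is a formula that respects the modulus \<open>\<Delta>\<close> (in its variables)
  and the bound \<open>K\<close>, both being computed along the construction of \<open>\<phi>\<close>.  By \<open>weaken\<close> a formula
  also respects larger moduli and bounds, so that the common modulus and bound required for
  countable suprema and infima are just common upper bounds.\<close>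

inductive formula :: "signature \<Rightarrow> fm \<Rightarrow> ((nat \<Rightarrow> real) \<Rightarrow> real) \<Rightarrow> real set \<Rightarrow> bool"
  for L :: signature
where
  atomic: "P \<in> syms L \<Longrightarrow> length xs = arity L P
    \<Longrightarrow> formula L (Pred P xs) (\<lambda>\<delta>. modulus L P (\<lambda>i. \<delta> (xs ! i))) (bound L P)"
| one: "formula L One (\<lambda>_. 0) {1}"
| add: "formula L \<phi> \<Delta> K \<Longrightarrow> formula L \<psi> \<Delta>' K'
    \<Longrightarrow> formula L (Add \<phi> \<psi>) (\<lambda>\<delta>. \<Delta> \<delta> + \<Delta>' \<delta>) {x + y | x y. x \<in> K \<and> y \<in> K'}"
| scale: "formula L \<phi> \<Delta> K
    \<Longrightarrow> formula L (Scale r \<phi>) (\<lambda>\<delta>. \<bar>of_rat r\<bar> * \<Delta> \<delta>) ((\<lambda>x. of_rat r * x) ` K)"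
| maxf: "formula L \<phi> \<Delta> K \<Longrightarrow> formula L \<psi> \<Delta>' K'
    \<Longrightarrow> formula L (MaxF \<phi> \<psi>) (\<lambda>\<delta>. max (\<Delta> \<delta>) (\<Delta>' \<delta>)) {max x y | x y. x \<in> K \<and> y \<in> K'}"
| supq: "formula L \<phi> \<Delta> K \<Longrightarrow> formula L (SupQ \<phi>) (\<lambda>\<delta>. \<Delta> (case_nat 0 \<delta>)) K"
| infq: "formula L \<phi> \<Delta> K \<Longrightarrow> formula L (InfQ \<phi>) (\<lambda>\<delta>. \<Delta> (case_nat 0 \<delta>)) K"
| csup: "(\<And>n. formula L (f n) \<Delta> K) \<Longrightarrow> finite V \<Longrightarrow> (\<And>n. fv (f n) \<subseteq> V)
    \<Longrightarrow> formula L (CSup f) \<Delta> K"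
| cinf: "(\<And>n. formula L (f n) \<Delta> K) \<Longrightarrow> finite V \<Longrightarrow> (\<And>n. fv (f n) \<subseteq> V)
    \<Longrightarrow> formula L (CInf f) \<Delta> K"
| weaken: "formula L \<phi> \<Delta> K \<Longrightarrow> is_modulus V \<Delta>'
    \<Longrightarrow> (\<And>\<delta>. (\<And>i. 0 \<le> \<delta> i) \<Longrightarrow> \<Delta> \<delta> \<le> \<Delta>' \<delta>)
    \<Longrightarrow> K \<subseteq> K' \<Longrightarrow> compact K' \<Longrightarrow> formula L \<phi> \<Delta>' K'"

definition formulas :: "signature \<Rightarrow> fm set" where
  "formulas L = {\<phi>. \<exists>\<Delta> K. formula L \<phi> \<Delta> K}"

definition fragment :: "signature \<Rightarrow> fm set \<Rightarrow> bool" where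
  "fragment L F \<longleftrightarrow> F \<subseteq> formulas L \<and> countable F
    \<and> (\<forall>P\<in>syms L. \<forall>xs. length xs = arity L P \<longrightarrow> Pred P xs \<in> F)
    \<and> One \<in> F
    \<and> (\<forall>\<phi>\<in>F. \<forall>\<psi>\<in>F. Add \<phi> \<psi> \<in> F \<and> MaxF \<phi> \<psi> \<in> F)
    \<and> (\<forall>\<phi>\<in>F. \<forall>r. Scale r \<phi> \<in> F)
    \<and> (\<forall>\<phi>\<in>F. SupQ \<phi> \<in> F \<and> InfQ \<phi> \<in> F)
    \<and> (\<forall>\<phi>\<in>F. subformulas \<phi> \<subseteq> F)
    \<and> (\<forall>\<phi>\<in>F. \<forall>\<sigma>. subst \<sigma> \<phi> \<in> F)"

definition fragment_topology :: "signature \<Rightarrow> fm set \<Rightarrow> code topology" where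
  "fragment_topology L F = topology_generated_by
     {{code_of L S y | S y. (S, y) \<in> pointed_structures L
         \<and> eval S \<phi> (\<lambda>i. y (a ! i)) < of_rat r}
      | \<phi> a r. \<phi> \<in> F \<and> fv \<phi> \<subseteq> {..<length a}}"


section \<open>Vaught transforms\<close>

text \<open>The conditions below depend on the pointed structure only through its code, so it does not
  matter which pointed structure with a given code is used.\<close>

definition vaught :: "signature \<Rightarrow> code set \<Rightarrow> code set" where
  "vaught L A = {code_of L S z | S z. (S, z) \<in> pointed_structures L
     \<and> comeager_in (tail_dense_topology S) {y \<in> tail_dense S. code_of L S y \<in> A}}"

definition vaught_at :: "signature \<Rightarrow> code set \<Rightarrow> nat list \<Rightarrow> real \<Rightarrow> code set" where
  "vaught_at L A a u = {code_of L S z | S z. (S, z) \<in> pointed_structures L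
     \<and> (let U = {y \<in> tail_dense S. seq_dist S y (map z a) < u}
        in comeager_in (subtopology (tail_dense_topology S) U) {y \<in> U. code_of L S y \<in> A})}"

end

theory Submission
  imports Defs
begin

text \<open>For Borel \<open>A\<close> the function \<open>a \<mapsto> inf {u. A is nonmeager in the ball of radius u around a}\<close>
  is, up to truncation at \<open>1\<close>, the value of a formula: countable unions become countable infima, and
  the complement of \<open>A\<close> is nonmeager in a ball iff, by the Baire property, the ball contains a smaller
  one, around some \<open>b\<close>, in which \<open>A\<close> is meager, that is, at whose centre the value for \<open>A\<close> is positive.
  Let \<open>F\<close> contain these formulas for all sets \<open>A\<close> of a countable base of \<open>t\<close>. For \<open>A\<close> open in \<open>t\<close>,
  being nonmeager in the ball around \<open>a\<close> of radius \<open>1/k\<close> is then an open condition in \<open>t\<^sub>F\<close>.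
  Further up in the hierarchy, \<open>\<Union>n. B n\<close> is nonmeager in a ball iff some \<open>B n\<close> is comeager in
  a smaller ball around a tuple of distinguished elements, and there are only countably many of
  those; containment of the balls is a closed condition, which does not raise the level.\<close>

section \<open>Baire category\<close>

text \<open>The obstacle is formal: a countable infimum is a formula only if its members share a
  modulus of continuity and a compact bound, and both are computed along the construction. An
  induction over the Borel sets must therefore produce formulas whose modulus and bound are fixed
  before the set is known. The infimum of radii moves by at most the distance that the tuple moves,
  so a modulus derived from the metric symbol alone is the natural candidate;
  \<open>controlled\<close> makes it the invariant, with bound \<open>{0..c}\<close>.
  Complementation preserves it because the condition \<open>g > 0\<close>, for which no uniform
  positive lower bound on \<open>g\<close> is available, concerns bound variables only. Truncation
  costs nothing, since only radii \<open>1/k \<le> 1\<close> occur in the end. Above the base, only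
  the Baire property of the sets is used, which they have as Borel sets of the standard topology;
  hence the fragment depends neither on the set nor on \<alpha>. Intersecting with a closed set
  keeps the level because open sets of the fragment topology are F_sigma, negation being available
  in the fragment.\<close>

lemma meager_in_empty: "meager_in X {}"
  unfolding meager_in_def nowhere_dense_in_def by (rule exI[of _ "\<lambda>_. {}"]) simp

lemma meager_in_subset: "meager_in X T" if "meager_in X S" "T \<subseteq> S"
  using that unfolding meager_in_def by (meson order_trans)

lemma meager_in_UN:
  assumes "\<And>n::nat. meager_in X (S n)"
  shows "meager_in X (\<Union>n. S n)"
proof -
  have "\<forall>n. \<exists>N :: nat \<Rightarrow> _. (\<forall>k. nowhere_dense_in X (N k)) \<and> S n \<subseteq> (\<Union>k. N k)"
    using assms unfolding meager_in_def by blast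
  then obtain N :: "nat \<Rightarrow> nat \<Rightarrow> _"
    where N: "\<And>n k. nowhere_dense_in X (N n k)" "\<And>n. S n \<subseteq> (\<Union>k. N n k)"
    by metis
  define N' where "N' i = (case prod_decode i of (n, k) \<Rightarrow> N n k)" for i
  have "(\<Union>n. S n) \<subseteq> (\<Union>i. N' i)"
  proof
    fix x assume "x \<in> (\<Union>n. S n)"
    then obtain n k where "x \<in> N n k" using N(2) by blast
    then have "x \<in> N' (prod_encode (n, k))" by (simp add: N'_def)
    then show "x \<in> (\<Union>i. N' i)" by blast
  qed
  moreover have "nowhere_dense_in X (N' i)" for i
    using N(1) by (simp add: N'_def split: prod.split)
  ultimately show ?thesis unfolding meager_in_def by blast
qed

lemma meager_in_Un: "meager_in X (S \<union> T)" if "meager_in X S" "meager_in X T"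
proof -
  have "meager_in X (\<Union>n::nat. if n = 0 then S else T)"
    using that by (intro meager_in_UN) simp
  then show ?thesis by (rule meager_in_subset) (auto split: if_splits intro: exI[of _ 1])
qed

lemma nowhere_dense_imp_meager: "meager_in X S" if "nowhere_dense_in X S"
  using that unfolding meager_in_def by (intro exI[of _ "\<lambda>_. S"]) simp

lemma nowhere_dense_in_iff:
  "nowhere_dense_in X S \<longleftrightarrow> S \<subseteq> topspace X \<and>
     (\<forall>W. openin X W \<longrightarrow> W \<subseteq> X closure_of S \<longrightarrow> W = {})"
  unfolding nowhere_dense_in_def interior_of_def by auto

lemma nowhere_dense_in_open_subtopology:
  assumes U: "openin X U"
  shows "nowhere_dense_in (subtopology X U) S \<Longrightarrow> nowhere_dense_in X S"
    and "nowhere_dense_in X S \<Longrightarrow> nowhere_dense_in (subtopology X U) (S \<inter> U)"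
proof -
  have sub: "U \<subseteq> topspace X" using U by (rule openin_subset)
  {
    assume S: "nowhere_dense_in (subtopology X U) S"
    then have SU: "S \<subseteq> U" by (auto simp: nowhere_dense_in_def)
    have "W = {}" if W: "openin X W" "W \<subseteq> X closure_of S" for W
    proof (rule ccontr)
      assume "W \<noteq> {}"
      then obtain x where "x \<in> W" by blast
      then have "W \<inter> S \<noteq> {}" using W in_closure_of[of x X S] by blast
      then have "W \<inter> U \<noteq> {}" using SU by blast
      moreover have "openin (subtopology X U) (W \<inter> U)"
        using W(1) by (rule openin_subtopology_Int)
      moreover have "W \<inter> U \<subseteq> subtopology X U closure_of S"
        using W SU by (auto simp: closure_of_subtopology Int_absorb1)
      ultimately show False using S unfolding nowhere_dense_in_iff by blast
    qed
    then show "nowhere_dense_in X S" using SU sub by (auto simp: nowhere_dense_in_iff)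
  next
    assume S: "nowhere_dense_in X S"
    have "W = {}" if W: "openin (subtopology X U) W" "W \<subseteq> subtopology X U closure_of (S \<inter> U)" for W
    proof -
      have "openin X W" using W(1) U openin_trans_full by blast
      moreover have "W \<subseteq> X closure_of S"
        using W(2) closure_of_mono[of "S \<inter> U" S X] by (auto simp: closure_of_subtopology Int_absorb1)
      ultimately show ?thesis using S unfolding nowhere_dense_in_iff by blast
    qed
    then show "nowhere_dense_in (subtopology X U) (S \<inter> U)"
      using sub by (auto simp: nowhere_dense_in_iff)
  }
qed

text \<open>The balls in \<open>vaught_at\<close> are open, so relative comeagerness can be traded
  for ambient category, and all transforms are compared inside one space.\<close>

lemma meager_in_open_subtopology:
  assumes U: "openin X U" and S: "S \<subseteq> U"
  shows "meager_in (subtopology X U) S \<longleftrightarrow> meager_in X S"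
proof
  assume "meager_in (subtopology X U) S"
  then show "meager_in X S"
    unfolding meager_in_def using nowhere_dense_in_open_subtopology(1)[OF U] by blast
next
  assume "meager_in X S"
  then obtain N :: "nat \<Rightarrow> _" where N: "\<And>n. nowhere_dense_in X (N n)" "S \<subseteq> (\<Union>n. N n)"
    unfolding meager_in_def by blast
  show "meager_in (subtopology X U) S"
    unfolding meager_in_def
  proof (intro exI[of _ "\<lambda>n. N n \<inter> U"] conjI allI)
    show "nowhere_dense_in (subtopology X U) (N n \<inter> U)" for n
      by (rule nowhere_dense_in_open_subtopology(2)[OF U N(1)])
    show "S \<subseteq> (\<Union>n. N n \<inter> U)" using N(2) S by blast
  qed
qed

text \<open>The nowhere dense sets are replaced by their closures, to which the Baire category
  theorem for closed sets applies.\<close>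

lemma not_meager_in_open:
  assumes X: "completely_metrizable_space X" and W: "openin X W" "W \<noteq> {}"
  shows "\<not> meager_in X W"
proof
  assume "meager_in X W"
  then obtain N :: "nat \<Rightarrow> _" where N: "\<And>n. nowhere_dense_in X (N n)" "W \<subseteq> (\<Union>n. N n)"
    unfolding meager_in_def by blast
  have "X interior_of \<Union>(range (\<lambda>n. X closure_of N n)) = {}"
    using N(1) X by (intro Baire_category_alt) (auto simp: nowhere_dense_in_def)
  moreover have "W \<subseteq> \<Union>(range (\<lambda>n. X closure_of N n))"
  proof -
    have "N n \<subseteq> X closure_of N n" for n
      using N(1)[of n] by (simp add: closure_of_subset nowhere_dense_in_def)
    then have "(\<Union>n. N n) \<subseteq> (\<Union>n. X closure_of N n)" by (intro UN_mono) auto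
    then show ?thesis using N(2) by simp
  qed
  ultimately show False using W interior_of_maximal[of W "\<Union>(range (\<lambda>n. X closure_of N n))" X] by simp
qed

section \<open>Sets with the Baire property\<close>

definition baire_property :: "'a topology \<Rightarrow> 'a set \<Rightarrow> bool" where
  "baire_property X A \<longleftrightarrow> (\<exists>U. openin X U \<and> meager_in X (A - U) \<and> meager_in X (U - A))"

lemma baire_property_open: "openin X U \<Longrightarrow> baire_property X U"
  unfolding baire_property_def by (rule exI[of _ U]) (simp add: meager_in_empty)

lemma baire_property_UN:
  assumes "\<And>n::nat. baire_property X (A n)"
  shows "baire_property X (\<Union>n. A n)"
proof -
  obtain U where U: "\<And>n. openin X (U n)" "\<And>n. meager_in X (A n - U n)" "\<And>n. meager_in X (U n - A n)"
    using assms unfolding baire_property_def by metis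
  have "meager_in X ((\<Union>n. A n) - (\<Union>n. U n))"
    by (rule meager_in_subset[OF meager_in_UN[of X "\<lambda>n. A n - U n"]]) (use U in auto)
  moreover have "meager_in X ((\<Union>n. U n) - (\<Union>n. A n))"
    by (rule meager_in_subset[OF meager_in_UN[of X "\<lambda>n. U n - A n"]]) (use U in auto)
  moreover have "openin X (\<Union>n. U n)" using U by blast
  ultimately show ?thesis unfolding baire_property_def by blast
qed

text \<open>The complement of the approximating \<open>U\<close> is closed, so it exceeds its
  interior only by a nowhere dense set; that interior approximates the complement of
  \<open>A\<close>.\<close>

lemma baire_property_Diff:
  assumes "baire_property X A"
  shows "baire_property X (topspace X - A)"
proof -
  obtain U where U: "openin X U" "meager_in X (A - U)" "meager_in X (U - A)"
    using assms unfolding baire_property_def by blast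
  let ?C = "topspace X - U"
  let ?I = "X interior_of ?C"
  have cl: "closedin X ?C" using U(1) by blast
  have "W = {}" if "openin X W" "W \<subseteq> X closure_of (?C - ?I)" for W
  proof -
    have "X closure_of (?C - ?I) \<subseteq> ?C"
      using cl by (intro closure_of_minimal) auto
    then have "W \<subseteq> ?I" using that interior_of_maximal[of W ?C X] by blast
    moreover have "closedin X (?C - ?I)"
      using cl openin_interior_of by blast
    then have "X closure_of (?C - ?I) = ?C - ?I" by (rule closure_of_closedin)
    ultimately show "W = {}" using that by blast
  qed
  then have "nowhere_dense_in X (?C - ?I)" unfolding nowhere_dense_in_iff by blast
  then have "meager_in X ((U - A) \<union> (?C - ?I))"
    using U nowhere_dense_imp_meager meager_in_Un by blast
  then have "meager_in X (topspace X - A - ?I)"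
    by (rule meager_in_subset) blast
  moreover have "meager_in X (?I - (topspace X - A))"
    by (rule meager_in_subset[OF U(2)]) (use interior_of_subset[of X ?C] in auto)
  ultimately show ?thesis unfolding baire_property_def
    by (intro exI[of _ ?I] conjI openin_interior_of)
qed

text \<open>If \<open>U\<close> approximates \<open>A\<close>, then \<open>U \<inter> V\<close>
  serves as \<open>W\<close>: were it empty, \<open>A \<inter> V\<close> would lie in the meager set
  \<open>A - U\<close>. This passage from nonmeager to comeager drives both the complement step for
  formulas and the union step in the hierarchy.\<close>

lemma baire_property_nonmeager:
  assumes A: "baire_property X A" and V: "openin X V" and "\<not> meager_in X (A \<inter> V)"
  obtains W where "openin X W" "W \<noteq> {}" "W \<subseteq> V" "meager_in X (W - A)"
proof -
  obtain U where U: "openin X U" "meager_in X (A - U)" "meager_in X (U - A)"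
    using A unfolding baire_property_def by blast
  have "U \<inter> V \<noteq> {}"
  proof
    assume "U \<inter> V = {}"
    then have "meager_in X (A \<inter> V)" by (intro meager_in_subset[OF U(2)]) blast
    then show False using assms by blast
  qed
  moreover have "meager_in X (U \<inter> V - A)" by (rule meager_in_subset[OF U(3)]) blast
  ultimately show ?thesis using that[of "U \<inter> V"] U(1) V by blast
qed

section \<open>Second countability and the Borel hierarchy\<close>

lemma polish_topology_second_countable:
  assumes "polish_topology X"
  shows "second_countable X"
proof -
  obtain M d where M: "Metric_space M d" and X: "X = Metric_space.mtopology M d"
    using assms unfolding polish_topology_def completely_metrizable_space_def by blast
  interpret Metric_space M d by (rule M)
  obtain C where C: "countable C" "C \<subseteq> M" "mtopology closure_of C = M"
    using assms unfolding polish_topology_def separable_space_def X by auto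
  let ?B = "(\<lambda>(c, n). mball c (1 / real (Suc n))) ` (C \<times> UNIV)"
  have "\<exists>V\<in>?B. x \<in> V \<and> V \<subseteq> U" if U: "openin mtopology U" "x \<in> U" for U x
  proof -
    obtain r where r: "r > 0" "mball x r \<subseteq> U" "x \<in> M" using U by (metis openin_mtopology subsetD)
    obtain n where n: "1 / real (Suc n) < r / 2" using r(1) nat_approx_posE half_gt_zero by metis
    have "openin mtopology (mball x (1 / real (Suc n)))" by simp
    moreover have "x \<in> mball x (1 / real (Suc n))" using r by simp
    ultimately obtain c where c: "c \<in> C" "c \<in> mball x (1 / real (Suc n))"
      using C(3) r(3) in_closure_of[of x mtopology C] by blast
    have "mball c (1 / real (Suc n)) \<subseteq> mball x r"
      using c n r by (intro mball_subset) (auto simp: commute)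
    then show ?thesis using c r by (intro bexI[of _ "mball c (1 / real (Suc n))"]) (auto simp: commute)
  qed
  moreover have "countable ?B" using C(1) by simp
  moreover have "\<forall>V\<in>?B. openin mtopology V" by auto
  ultimately show ?thesis unfolding X second_countable_def by (intro exI[of _ ?B]) blast
qed

lemma second_countable_union_basis:
  assumes "\<And>U x. openin X U \<Longrightarrow> x \<in> U \<Longrightarrow> \<exists>V\<in>\<B>. x \<in> V \<and> V \<subseteq> U" "openin X U"
  shows "U = \<Union>{V\<in>\<B>. V \<subseteq> U}"
  using assms by blast

section \<open>The Borel hierarchy when open sets are F_sigma\<close>

lemma Sigma0_subset: "Sigma0 X \<alpha> A \<Longrightarrow> A \<subseteq> topspace X"
  and Pi0_subset: "Pi0 X \<alpha> A \<Longrightarrow> A \<subseteq> topspace X"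
proof (induction rule: Sigma0_Pi0.inducts)
  case (Sigma0_step \<alpha> \<beta> B)
  then show ?case by blast
qed (auto dest: openin_subset)

lemma Pi0_one_closedin: "Pi0 X 1 C" if "closedin X C"
proof -
  have "Pi0 X 1 (topspace X - (topspace X - C))"
    using that by (intro Sigma0_Pi0.intros) blast
  then show ?thesis using closedin_subset[OF that] by (simp add: double_diff)
qed

text \<open>That open sets are F_sigma is a hypothesis, to be verified for the fragment topology
  without a metric. Above level 1 the closed pieces of \<open>U\<close> join the union as members of
  level 1, interleaved with those of \<open>A\<close>; the requirement \<open>1 < \<alpha>\<close>
  of \<open>Sigma0_step\<close> leaves room for them.\<close>

lemma Sigma0_Un_fsigma:
  assumes F: "\<And>U. openin X U \<Longrightarrow> \<exists>C :: nat \<Rightarrow> _. (\<forall>n. closedin X (C n)) \<and> U = (\<Union>n. C n)"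
    and "Sigma0 X \<alpha> A" and U: "openin X U"
  shows "Sigma0 X \<alpha> (A \<union> U)"
  using assms(2)
proof cases
  case Sigma0_one
  then show ?thesis using U by (auto intro: Sigma0_Pi0.intros)
next
  case (Sigma0_step \<beta> B)
  obtain C :: "nat \<Rightarrow> _" where C: "\<And>n. closedin X (C n)" "U = (\<Union>n. C n)" using F[OF U] by blast
  define B' where "B' n = (if even n then B (n div 2) else C (n div 2))" for n
  define \<beta>' where "\<beta>' n = (if even n then \<beta> (n div 2) else 1)" for n
  have "1 \<le> \<beta>' n \<and> \<beta>' n < \<alpha> \<and> Pi0 X (\<beta>' n) (B' n)" for n
    using Sigma0_step(2,3) Pi0_one_closedin[OF C(1)] by (simp add: B'_def \<beta>'_def)
  then have "Sigma0 X \<alpha> (\<Union>n. B' n)" by (rule Sigma0_Pi0.Sigma0_step[OF Sigma0_step(2)])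
  moreover have "(\<Union>n. B' n) = A \<union> U"
  proof (intro equalityI subsetI)
    fix x assume "x \<in> A \<union> U"
    then consider n where "x \<in> B n" | n where "x \<in> C n" using Sigma0_step(1) C by blast
    then show "x \<in> (\<Union>n. B' n)"
    proof cases
      case 1
      then have "x \<in> B' (2 * n)" by (simp add: B'_def)
      then show ?thesis by blast
    next
      case 2
      then have "x \<in> B' (Suc (2 * n))" by (simp add: B'_def)
      then show ?thesis by blast
    qed
  qed (auto simp: B'_def Sigma0_step(1) C(2) split: if_splits)
  ultimately show ?thesis by simp
qed

lemma Pi0_Int_closedin:
  assumes F: "\<And>U. openin X U \<Longrightarrow> \<exists>C :: nat \<Rightarrow> _. (\<forall>n. closedin X (C n)) \<and> U = (\<Union>n. C n)"
    and "Pi0 X \<alpha> A" and C: "closedin X C"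
  shows "Pi0 X \<alpha> (A \<inter> C)"
  using assms(2)
proof cases
  case (Pi0 B)
  have "Sigma0 X \<alpha> (B \<union> (topspace X - C))"
    using Sigma0_Un_fsigma[OF F Pi0(2)] C by blast
  then have "Pi0 X \<alpha> (topspace X - (B \<union> (topspace X - C)))" by (rule Sigma0_Pi0.Pi0)
  moreover have "topspace X - (B \<union> (topspace X - C)) = A \<inter> C"
    using Pi0(1) closedin_subset[OF C] by blast
  ultimately show ?thesis by simp
qed

lemma Sigma0_borel: "Sigma0 X \<alpha> A \<Longrightarrow> A \<in> borel_sets_of X"
  and Pi0_borel: "Pi0 X \<alpha> A \<Longrightarrow> A \<in> borel_sets_of X"
proof (induction rule: Sigma0_Pi0.inducts)
  case (Sigma0_step \<alpha> \<beta> B)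
  then show ?case unfolding borel_sets_of_def by (intro sigma_sets.Union) blast
qed (auto simp: borel_sets_of_def intro: sigma_sets.Basic sigma_sets.Compl)

text \<open>A countable subbase yields a countable base of finite intersections, and F_sigma sets
  are closed under finite intersections and countable unions.\<close>

lemma topology_generated_by_fsigma:
  assumes S: "countable \<S>"
    and gen: "\<And>V. V \<in> \<S> \<Longrightarrow> \<exists>C :: nat \<Rightarrow> _. (\<forall>n. closedin (topology_generated_by \<S>) (C n)) \<and> V = (\<Union>n. C n)"
    and U: "openin (topology_generated_by \<S>) U"
  shows "\<exists>C :: nat \<Rightarrow> _. (\<forall>n. closedin (topology_generated_by \<S>) (C n)) \<and> U = (\<Union>n. C n)"
proof -
  let ?X = "topology_generated_by \<S>"
  have fs: "fsigma_in ?X V" if V: "V \<in> \<S>" for V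
  proof -
    obtain C :: "nat \<Rightarrow> _" where C: "\<And>n. closedin ?X (C n)" "V = (\<Union>n. C n)" using gen[OF V] by blast
    then have "fsigma_in ?X (\<Union>(range C))"
      by (intro fsigma_in_Union) (auto intro: closed_imp_fsigma_in)
    then show ?thesis using C(2) by simp
  qed
  \<comment> \<open>The empty family is excluded because its intersection is \<open>UNIV\<close> and
    not the underlying space. Nothing is lost: every point of an open set lies in some member of
    \<open>\<S>\<close>.\<close>
  define \<B> where "\<B> = {\<Inter>T | T. finite T \<and> T \<noteq> {} \<and> T \<subseteq> \<S>}"
  have "countable \<B>"
    unfolding \<B>_def using countable_Collect_finite_subset[OF S]
    by (rule countable_subset[OF _ countable_image, rotated]) blast
  have fsB: "fsigma_in ?X V" if V: "V \<in> \<B>" for V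
  proof -
    obtain T where T: "V = \<Inter>T" "finite T" "T \<noteq> {}" "T \<subseteq> \<S>" using V unfolding \<B>_def by blast
    have "fsigma_in ?X (\<Inter>T)" using T(2-4)
    proof (induction rule: finite_ne_induct)
      case (insert V F)
      then show ?case using fsigma_in_Int[OF fs[of V]] by simp
    qed (use fs in auto)
    then show ?thesis using T by simp
  qed
  have "\<exists>V\<in>\<B>. x \<in> V \<and> V \<subseteq> W" if "generate_topology_on \<S> W" "x \<in> W" for W x
    using that
  proof (induction arbitrary: x rule: generate_topology_on.induct)
    case (Int a b)
    obtain V1 V2 where V: "V1 \<in> \<B>" "x \<in> V1" "V1 \<subseteq> a" "V2 \<in> \<B>" "x \<in> V2" "V2 \<subseteq> b"
      using Int.IH Int.prems by (meson IntE)
    then obtain T1 T2 where "V1 = \<Inter>T1" "finite T1" "T1 \<noteq> {}" "T1 \<subseteq> \<S>"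
      "V2 = \<Inter>T2" "finite T2" "T2 \<noteq> {}" "T2 \<subseteq> \<S>"
      unfolding \<B>_def by blast
    then have "V1 \<inter> V2 \<in> \<B>" unfolding \<B>_def by (intro CollectI exI[of _ "T1 \<union> T2"]) auto
    moreover have "x \<in> V1 \<inter> V2" "V1 \<inter> V2 \<subseteq> a \<inter> b" using V by (simp_all add: le_infI1 le_infI2)
    ultimately show ?case by (intro bexI[of _ "V1 \<inter> V2"] conjI)
  next
    case (Basis s)
    then have "s \<in> \<B>" unfolding \<B>_def by (intro CollectI exI[of _ "{s}"]) auto
    then show ?case using Basis.prems by (intro bexI[of _ s]) simp_all
  next
    case (UN K)
    obtain k where k: "k \<in> K" "x \<in> k" using UN.prems by blast
    obtain V where "V \<in> \<B>" "x \<in> V" "V \<subseteq> k" using UN.IH[OF k] by blast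
    moreover have "k \<subseteq> \<Union>K" using k by blast
    ultimately show ?case by (intro bexI[of _ V]) auto
  qed simp
  then have "x \<in> \<Union>{V\<in>\<B>. V \<subseteq> U}" if "x \<in> U" for x
    using that openin_topology_generated_by[OF U] by (metis (mono_tags, lifting) UnionI mem_Collect_eq)
  then have eq: "U = \<Union>{V\<in>\<B>. V \<subseteq> U}" by auto
  have "fsigma_in ?X (\<Union>{V\<in>\<B>. V \<subseteq> U})"
  proof (rule fsigma_in_Union)
    show "countable {V\<in>\<B>. V \<subseteq> U}"
      by (rule countable_subset[OF _ \<open>countable \<B>\<close>]) blast
  qed (rule fsB, blast)
  then have "fsigma_in ?X U" using eq by simp
  then show ?thesis unfolding fsigma_in_ascending by auto
qed

section \<open>Formulas and their values\<close>

lemma is_modulusD: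
  assumes "is_modulus V \<Delta>"
  shows is_modulus_finite: "finite V"
    and is_modulus_mono: "\<And>\<delta> \<epsilon>. (\<And>i. i \<in> V \<Longrightarrow> 0 \<le> \<delta> i \<and> \<delta> i \<le> \<epsilon> i) \<Longrightarrow> \<Delta> \<delta> \<le> \<Delta> \<epsilon>"
    and is_modulus_subadd: "\<And>\<delta> \<epsilon>. (\<And>i. i \<in> V \<Longrightarrow> 0 \<le> \<delta> i \<and> 0 \<le> \<epsilon> i)
      \<Longrightarrow> \<Delta> (\<lambda>i. \<delta> i + \<epsilon> i) \<le> \<Delta> \<delta> + \<Delta> \<epsilon>"
    and is_modulus_continuous: "continuous_on {\<delta>. \<forall>i\<in>V. 0 \<le> \<delta> i} \<Delta>"
  using assms unfolding is_modulus_def by blast+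

lemma is_modulusI:
  assumes "finite V" "\<Delta> (\<lambda>_. 0) = 0"
    and "\<And>\<delta> \<epsilon>. (\<And>i. i \<in> V \<Longrightarrow> 0 \<le> \<delta> i \<and> \<delta> i \<le> \<epsilon> i) \<Longrightarrow> \<Delta> \<delta> \<le> \<Delta> \<epsilon>"
    and "\<And>\<delta> \<epsilon>. (\<And>i. i \<in> V \<Longrightarrow> 0 \<le> \<delta> i \<and> 0 \<le> \<epsilon> i) \<Longrightarrow> \<Delta> (\<lambda>i. \<delta> i + \<epsilon> i) \<le> \<Delta> \<delta> + \<Delta> \<epsilon>"
    and "continuous_on {\<delta>. \<forall>i\<in>V. 0 \<le> \<delta> i} \<Delta>"
  shows "is_modulus V \<Delta>"
  using assms unfolding is_modulus_def by blast

lemma is_modulus_cong: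
  assumes \<Delta>: "is_modulus V \<Delta>" and eq: "\<And>i. i \<in> V \<Longrightarrow> 0 \<le> \<delta> i \<and> \<delta> i = \<epsilon> i"
  shows "\<Delta> \<delta> = \<Delta> \<epsilon>"
proof (rule order_antisym)
  show "\<Delta> \<delta> \<le> \<Delta> \<epsilon>" "\<Delta> \<epsilon> \<le> \<Delta> \<delta>"
    by (rule is_modulus_mono[OF \<Delta>], metis eq order_refl)+
qed

lemma is_modulus_zero:
  assumes "is_modulus V \<Delta>" "\<And>i. i \<in> V \<Longrightarrow> \<delta> i = 0"
  shows "\<Delta> \<delta> = 0"
proof -
  have "\<Delta> \<delta> = \<Delta> (\<lambda>_. 0)" using assms by (intro is_modulus_cong) auto
  then show ?thesis using assms(1) by (simp add: is_modulus_def)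
qed

lemma is_modulus_nonneg:
  assumes "is_modulus V \<Delta>" "\<And>i. i \<in> V \<Longrightarrow> 0 \<le> \<delta> i"
  shows "0 \<le> \<Delta> \<delta>"
  using is_modulus_mono[OF assms(1), of "\<lambda>_. 0" \<delta>] is_modulus_zero[OF assms(1), of "\<lambda>_. 0"] assms(2)
  by simp

lemma is_modulus_superset:
  assumes \<Delta>: "is_modulus V \<Delta>" and V': "V \<subseteq> V'" "finite V'"
  shows "is_modulus V' \<Delta>"
proof (rule is_modulusI)
  show "continuous_on {\<delta>. \<forall>i\<in>V'. 0 \<le> \<delta> i} \<Delta>"
    by (rule continuous_on_subset[OF is_modulus_continuous[OF \<Delta>]]) (use V' in blast)
qed (use V' in \<open>auto intro: is_modulus_zero[OF \<Delta>] is_modulus_mono[OF \<Delta>] is_modulus_subadd[OF \<Delta>]\<close>)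

lemma is_modulus_const_0: "finite V \<Longrightarrow> is_modulus V (\<lambda>_. 0)"
  by (simp add: is_modulus_def)

lemma is_modulus_add:
  assumes \<Delta>: "is_modulus V \<Delta>" and \<Delta>': "is_modulus V \<Delta>'"
  shows "is_modulus V (\<lambda>\<delta>. \<Delta> \<delta> + \<Delta>' \<delta>)"
proof (rule is_modulusI)
  fix \<delta> \<epsilon> :: "nat \<Rightarrow> real"
  assume "\<And>i. i \<in> V \<Longrightarrow> 0 \<le> \<delta> i \<and> 0 \<le> \<epsilon> i"
  then have "\<Delta> (\<lambda>i. \<delta> i + \<epsilon> i) \<le> \<Delta> \<delta> + \<Delta> \<epsilon>" "\<Delta>' (\<lambda>i. \<delta> i + \<epsilon> i) \<le> \<Delta>' \<delta> + \<Delta>' \<epsilon>"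
    by (auto intro: is_modulus_subadd[OF \<Delta>] is_modulus_subadd[OF \<Delta>'])
  then show "\<Delta> (\<lambda>i. \<delta> i + \<epsilon> i) + \<Delta>' (\<lambda>i. \<delta> i + \<epsilon> i) \<le> \<Delta> \<delta> + \<Delta>' \<delta> + (\<Delta> \<epsilon> + \<Delta>' \<epsilon>)"
    by simp
next
  show "continuous_on {\<delta>. \<forall>i\<in>V. 0 \<le> \<delta> i} (\<lambda>\<delta>. \<Delta> \<delta> + \<Delta>' \<delta>)"
    by (intro continuous_intros is_modulus_continuous \<Delta> \<Delta>')
qed (use is_modulus_zero[OF \<Delta>] is_modulus_zero[OF \<Delta>'] is_modulus_finite[OF \<Delta>] in
  \<open>auto intro!: add_mono is_modulus_mono[OF \<Delta>] is_modulus_mono[OF \<Delta>']\<close>)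

lemma is_modulus_scale:
  assumes \<Delta>: "is_modulus V \<Delta>" and c: "0 \<le> (c::real)"
  shows "is_modulus V (\<lambda>\<delta>. c * \<Delta> \<delta>)"
proof (rule is_modulusI)
  fix \<delta> \<epsilon> :: "nat \<Rightarrow> real"
  assume "\<And>i. i \<in> V \<Longrightarrow> 0 \<le> \<delta> i \<and> 0 \<le> \<epsilon> i"
  then have "c * \<Delta> (\<lambda>i. \<delta> i + \<epsilon> i) \<le> c * (\<Delta> \<delta> + \<Delta> \<epsilon>)"
    using c by (intro mult_left_mono is_modulus_subadd[OF \<Delta>]) auto
  then show "c * \<Delta> (\<lambda>i. \<delta> i + \<epsilon> i) \<le> c * \<Delta> \<delta> + c * \<Delta> \<epsilon>"
    by (simp add: distrib_left)
next
  show "continuous_on {\<delta>. \<forall>i\<in>V. 0 \<le> \<delta> i} (\<lambda>\<delta>. c * \<Delta> \<delta>)"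
    by (intro continuous_intros is_modulus_continuous \<Delta>)
qed (use is_modulus_zero[OF \<Delta>] is_modulus_finite[OF \<Delta>] c in
  \<open>auto intro!: mult_left_mono is_modulus_mono[OF \<Delta>]\<close>)

lemma is_modulus_max:
  assumes \<Delta>: "is_modulus V \<Delta>" and \<Delta>': "is_modulus V \<Delta>'"
  shows "is_modulus V (\<lambda>\<delta>. max (\<Delta> \<delta>) (\<Delta>' \<delta>))"
proof (rule is_modulusI)
  fix \<delta> \<epsilon> :: "nat \<Rightarrow> real"
  assume "\<And>i. i \<in> V \<Longrightarrow> 0 \<le> \<delta> i \<and> 0 \<le> \<epsilon> i"
  then have "\<Delta> (\<lambda>i. \<delta> i + \<epsilon> i) \<le> \<Delta> \<delta> + \<Delta> \<epsilon>" "\<Delta>' (\<lambda>i. \<delta> i + \<epsilon> i) \<le> \<Delta>' \<delta> + \<Delta>' \<epsilon>"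
    by (auto intro: is_modulus_subadd[OF \<Delta>] is_modulus_subadd[OF \<Delta>'])
  then show "max (\<Delta> (\<lambda>i. \<delta> i + \<epsilon> i)) (\<Delta>' (\<lambda>i. \<delta> i + \<epsilon> i)) \<le> max (\<Delta> \<delta>) (\<Delta>' \<delta>) + max (\<Delta> \<epsilon>) (\<Delta>' \<epsilon>)"
    by linarith
next
  fix \<delta> \<epsilon> :: "nat \<Rightarrow> real"
  assume d: "\<And>i. i \<in> V \<Longrightarrow> 0 \<le> \<delta> i \<and> \<delta> i \<le> \<epsilon> i"
  show "max (\<Delta> \<delta>) (\<Delta>' \<delta>) \<le> max (\<Delta> \<epsilon>) (\<Delta>' \<epsilon>)"
    by (rule max.mono[OF is_modulus_mono[OF \<Delta>] is_modulus_mono[OF \<Delta>']]) (use d in auto)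
next
  show "continuous_on {\<delta>. \<forall>i\<in>V. 0 \<le> \<delta> i} (\<lambda>\<delta>. max (\<Delta> \<delta>) (\<Delta>' \<delta>))"
    by (intro continuous_intros is_modulus_continuous \<Delta> \<Delta>')
qed (use is_modulus_zero[OF \<Delta>] is_modulus_zero[OF \<Delta>'] is_modulus_finite[OF \<Delta>] in auto)

text \<open>One lemma for all changes of variables: \<open>h i = None\<close> freezes the coordinate
  \<open>i\<close> at 0, as a quantifier does with its bound variable, and
  \<open>h i = Some j\<close> reads it from \<open>j\<close>, as in substitutions and repeated
  arguments. The change of variables is additive, monotone and continuous.\<close>

lemma is_modulus_reindex:
  fixes \<Delta> :: "(nat \<Rightarrow> real) \<Rightarrow> real"
  assumes \<Delta>: "is_modulus V \<Delta>"
    and h: "\<And>i. i \<in> V \<Longrightarrow> h i = None \<or> (\<exists>j\<in>W. h i = Some j)" and W: "finite W"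
  shows "is_modulus W (\<lambda>\<delta>. \<Delta> (\<lambda>i. case h i of None \<Rightarrow> 0 | Some j \<Rightarrow> \<delta> j))"
proof -
  let ?r = "\<lambda>(\<delta>::nat \<Rightarrow> real) i. case h i of None \<Rightarrow> 0 | Some j \<Rightarrow> \<delta> j"
  have nn: "0 \<le> ?r \<delta> i" if "\<forall>i\<in>W. 0 \<le> \<delta> i" "i \<in> V" for \<delta> i
    using h[OF that(2)] that(1) by auto
  have sum: "?r (\<lambda>i. \<delta> i + \<epsilon> i) = (\<lambda>i. ?r \<delta> i + ?r \<epsilon> i)" for \<delta> \<epsilon>
    by (auto split: option.splits)
  have sub: "\<Delta> (\<lambda>i. \<delta> i + \<epsilon> i) \<le> \<Delta> \<delta> + \<Delta> \<epsilon>" if "\<forall>i\<in>V. 0 \<le> \<delta> i \<and> 0 \<le> \<epsilon> i" for \<delta> \<epsilon>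
    using \<Delta> that unfolding is_modulus_def by blast
  have "continuous_on UNIV ?r"
  proof (rule continuous_on_coordinatewise_then_product)
    show "continuous_on UNIV (\<lambda>\<delta>. ?r \<delta> i)" for i by (cases "h i") (auto intro: continuous_intros)
  qed
  then have "continuous_on {\<delta>. \<forall>i\<in>W. 0 \<le> \<delta> i} (\<lambda>\<delta>. \<Delta> (?r \<delta>))"
    using \<Delta> nn unfolding is_modulus_def
    by (intro continuous_on_compose2[of "{\<delta>. \<forall>i\<in>V. 0 \<le> \<delta> i}" \<Delta> _ ?r])
      (auto intro: continuous_on_subset)
  moreover have "\<Delta> (?r \<delta>) \<le> \<Delta> (?r \<epsilon>)" if d: "\<forall>i\<in>W. 0 \<le> \<delta> i \<and> \<delta> i \<le> \<epsilon> i" for \<delta> \<epsilon>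
  proof (rule is_modulus_mono[OF \<Delta>])
    show "0 \<le> ?r \<delta> i \<and> ?r \<delta> i \<le> ?r \<epsilon> i" if "i \<in> V" for i
      using h[OF that] d by auto
  qed
  moreover have "\<Delta> (?r (\<lambda>i. \<delta> i + \<epsilon> i)) \<le> \<Delta> (?r \<delta>) + \<Delta> (?r \<epsilon>)"
    if "\<forall>i\<in>W. 0 \<le> \<delta> i \<and> 0 \<le> \<epsilon> i" for \<delta> \<epsilon>
    unfolding sum using that nn by (intro sub) blast
  moreover have "\<Delta> (?r (\<lambda>_. 0)) = 0"
    by (rule is_modulus_zero[OF \<Delta>]) (simp split: option.split)
  ultimately show ?thesis using W unfolding is_modulus_def by blast
qed

section \<open>Moduli, bounds and values of formulas\<close>

lemma formula_finite_fv: "formula L \<phi> \<Delta> K \<Longrightarrow> finite (fv \<phi>)"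
proof (induction rule: formula.induct)
  case (supq \<phi> \<Delta> K)
  have "Suc ` {n. Suc n \<in> fv \<phi>} \<subseteq> fv \<phi>" by auto
  then show ?case using supq finite_subset finite_imageD[of Suc "{n. Suc n \<in> fv \<phi>}"] by auto
next
  case (infq \<phi> \<Delta> K)
  have "Suc ` {n. Suc n \<in> fv \<phi>} \<subseteq> fv \<phi>" by auto
  then show ?case using infq finite_subset finite_imageD[of Suc "{n. Suc n \<in> fv \<phi>}"] by auto
next
  case (csup f \<Delta> K V)
  then show ?case by (auto intro: finite_subset[of _ V])
next
  case (cinf f \<Delta> K V)
  then show ?case by (auto intro: finite_subset[of _ V])
qed auto

text \<open>The rules of \<open>formula\<close> only write down an expression for \<Delta>; apart
  from \<open>weaken\<close> they do not ask for a modulus. A finite support \<open>V\<close> is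
  carried along, which may be larger than the set of free variables.\<close>

lemma formula_modulus:
  assumes L: "is_signature L" and "formula L \<phi> \<Delta> K"
  shows "\<exists>V. is_modulus V \<Delta>"
  using assms(2)
proof (induction rule: formula.induct)
  case (atomic P xs)
  let ?h = "\<lambda>i. Some (xs ! i)"
  have "is_modulus (set xs) (\<lambda>\<delta>. modulus L P (\<lambda>i. case ?h i of None \<Rightarrow> 0 | Some j \<Rightarrow> \<delta> j))"
    using L atomic by (intro is_modulus_reindex[of "{..<arity L P}"]) (auto simp: is_signature_def)
  then show ?case by auto
next
  case one
  show ?case using is_modulus_const_0 by blast
next
  case (add \<phi> \<Delta> K \<psi> \<Delta>' K')
  then obtain V V' where "is_modulus V \<Delta>" "is_modulus V' \<Delta>'" by blast
  then have "is_modulus (V \<union> V') \<Delta>" "is_modulus (V \<union> V') \<Delta>'"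
    by (meson is_modulus_finite is_modulus_superset finite_UnI Un_upper1 Un_upper2)+
  then show ?case using is_modulus_add by blast
next
  case (maxf \<phi> \<Delta> K \<psi> \<Delta>' K')
  then obtain V V' where "is_modulus V \<Delta>" "is_modulus V' \<Delta>'" by blast
  then have "is_modulus (V \<union> V') \<Delta>" "is_modulus (V \<union> V') \<Delta>'"
    by (meson is_modulus_finite is_modulus_superset finite_UnI Un_upper1 Un_upper2)+
  then show ?case using is_modulus_max by blast
next
  case (scale \<phi> \<Delta> K r)
  then show ?case using is_modulus_scale by (metis abs_ge_zero)
next
  case (supq \<phi> \<Delta> K)
  then obtain V where V: "is_modulus V \<Delta>" by blast
  \<comment> \<open>The bound variable 0 is frozen at 0 and the others shift down. Truncated
    subtraction sends 0 to 0, which at worst enlarges the support.\<close>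
  let ?h = "case_nat None Some"
  have "is_modulus ((\<lambda>i. i - 1) ` V) (\<lambda>\<delta>. \<Delta> (\<lambda>i. case ?h i of None \<Rightarrow> 0 | Some j \<Rightarrow> \<delta> j))"
    using V by (intro is_modulus_reindex[of V])
      (auto simp: is_modulus_def split: nat.splits intro!: bexI[of _ "Suc _"] rev_image_eqI)
  also have "(\<lambda>\<delta> i. case ?h i of None \<Rightarrow> 0 | Some j \<Rightarrow> \<delta> j) = (\<lambda>\<delta>. case_nat 0 \<delta>)"
    by (auto simp: fun_eq_iff split: nat.splits)
  finally show ?case by (metis (no_types, lifting) ext)
next
  case (infq \<phi> \<Delta> K)
  then obtain V where V: "is_modulus V \<Delta>" by blast
  let ?h = "case_nat None Some"
  have "is_modulus ((\<lambda>i. i - 1) ` V) (\<lambda>\<delta>. \<Delta> (\<lambda>i. case ?h i of None \<Rightarrow> 0 | Some j \<Rightarrow> \<delta> j))"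
    using V by (intro is_modulus_reindex[of V])
      (auto simp: is_modulus_def split: nat.splits intro!: bexI[of _ "Suc _"] rev_image_eqI)
  also have "(\<lambda>\<delta> i. case ?h i of None \<Rightarrow> 0 | Some j \<Rightarrow> \<delta> j) = (\<lambda>\<delta>. case_nat 0 \<delta>)"
    by (auto simp: fun_eq_iff split: nat.splits)
  finally show ?case by (metis (no_types, lifting) ext)
qed blast+

lemma formula_compact:
  assumes L: "is_signature L" and "formula L \<phi> \<Delta> K"
  shows "compact K"
  using assms(2)
proof (induction rule: formula.induct)
  case (atomic P xs)
  then show ?case using L by (simp add: is_signature_def)
next
  case (add \<phi> \<Delta> K \<psi> \<Delta>' K')
  then show ?case by (intro compact_sums)
next
  case (scale \<phi> \<Delta> K r)
  then show ?case by (intro compact_continuous_image continuous_intros)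
next
  case (maxf \<phi> \<Delta> K \<psi> \<Delta>' K')
  have "compact ((\<lambda>p. max (fst p) (snd p)) ` (K \<times> K'))"
    using maxf by (intro compact_continuous_image continuous_intros compact_Times)
  moreover have "(\<lambda>p. max (fst p) (snd p)) ` (K \<times> K') = {max x y |x y. x \<in> K \<and> y \<in> K'}"
    by force
  ultimately show ?case by simp
qed auto

lemma compact_Sup_in: "Sup (f ` A) \<in> K" if "compact K" "A \<noteq> {}" "\<And>x. x \<in> A \<Longrightarrow> f x \<in> K" for K :: "real set"
proof -
  have "bdd_above (f ` A)"
    using that compact_imp_bounded bounded_imp_bdd_above by (metis bdd_above_mono image_subsetI)
  then show ?thesis
    using that closed_subset_contains_Sup[of K "f ` A"] compact_imp_closed by blast
qed

lemma compact_Inf_in: "Inf (f ` A) \<in> K" if "compact K" "A \<noteq> {}" "\<And>x. x \<in> A \<Longrightarrow> f x \<in> K" for K :: "real set"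
proof -
  have "bdd_below (f ` A)"
    using that compact_imp_bounded bounded_imp_bdd_below by (metis bdd_below_mono image_subsetI)
  then show ?thesis
    using that closed_subset_contains_Inf[of K "f ` A"] compact_imp_closed by blast
qed

lemma compact_bdd_image:
  fixes K :: "real set"
  assumes "compact K" "\<And>x. x \<in> A \<Longrightarrow> f x \<in> K"
  shows "bdd_above (f ` A)" "bdd_below (f ` A)"
  using assms compact_imp_bounded bounded_imp_bdd_above bounded_imp_bdd_below
  by (metis bdd_above_mono bdd_below_mono image_subsetI)+

lemma SUP_diff_le:
  fixes f g :: "'a \<Rightarrow> real"
  assumes "A \<noteq> {}" "bdd_above (f ` A)" "bdd_above (g ` A)" "\<And>x. x \<in> A \<Longrightarrow> \<bar>f x - g x\<bar> \<le> c"
  shows "\<bar>Sup (f ` A) - Sup (g ` A)\<bar> \<le> c"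
proof -
  have "f x \<le> Sup (g ` A) + c" "g x \<le> Sup (f ` A) + c" if "x \<in> A" for x
    using cSUP_upper[OF that assms(2)] cSUP_upper[OF that assms(3)] assms(4)[OF that] by linarith+
  then have "Sup (f ` A) \<le> Sup (g ` A) + c" "Sup (g ` A) \<le> Sup (f ` A) + c"
    by (auto intro!: cSUP_least assms(1))
  then show ?thesis by linarith
qed

lemma INF_diff_le:
  fixes f g :: "'a \<Rightarrow> real"
  assumes "A \<noteq> {}" "bdd_below (f ` A)" "bdd_below (g ` A)" "\<And>x. x \<in> A \<Longrightarrow> \<bar>f x - g x\<bar> \<le> c"
  shows "\<bar>Inf (f ` A) - Inf (g ` A)\<bar> \<le> c"
proof -
  have "Inf (g ` A) - c \<le> f x" "Inf (f ` A) - c \<le> g x" if "x \<in> A" for x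
    using cINF_lower[OF assms(2) that] cINF_lower[OF assms(3) that] assms(4)[OF that] by linarith+
  then have "Inf (g ` A) - c \<le> Inf (f ` A)" "Inf (f ` A) - c \<le> Inf (g ` A)"
    by (auto intro!: cINF_greatest assms(1))
  then show ?thesis by linarith
qed

lemma range_case_nat: "x \<in> A \<Longrightarrow> range e \<subseteq> A \<Longrightarrow> range (case_nat x e) \<subseteq> A"
  by (simp add: image_subset_iff split: nat.split)

text \<open>Suprema and infima of values in \<open>K\<close> stay there because \<open>K\<close> is
  closed and bounded. The real \<open>Sup\<close> and \<open>Inf\<close> are meaningful only for
  nonempty bounded sets, so the universe must be nonempty.\<close>

lemma eval_in_bound:
  assumes L: "is_signature L" and S: "is_structure L S" and ne: "universe S \<noteq> {}"
  shows "formula L \<phi> \<Delta> K \<Longrightarrow> range e \<subseteq> universe S \<Longrightarrow> eval S \<phi> e \<in> K"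
proof (induction arbitrary: e rule: formula.induct)
  case (atomic P xs)
  moreover have "set (map e xs) \<subseteq> universe S" using atomic by auto
  ultimately show ?case using S by (simp add: is_structure_def)
next
  case (supq \<phi> \<Delta> K)
  have "range (case_nat x e) \<subseteq> universe S" if "x \<in> universe S" for x
    using that supq.prems by (simp_all add: range_case_nat)
  then show ?case
    using supq formula_compact[OF L] ne by (auto intro!: compact_Sup_in)
next
  case (infq \<phi> \<Delta> K)
  have "range (case_nat x e) \<subseteq> universe S" if "x \<in> universe S" for x
    using that infq.prems by (simp_all add: range_case_nat)
  then show ?case
    using infq formula_compact[OF L] ne by (auto intro!: compact_Inf_in)
next
  case (csup f \<Delta> K V)
  show ?case unfolding eval.simps
    by (intro compact_Sup_in formula_compact[OF L csup.hyps(1)] csup.IH csup.prems) simp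
next
  case (cinf f \<Delta> K V)
  show ?case unfolding eval.simps
    by (intro compact_Inf_in formula_compact[OF L cinf.hyps(1)] cinf.IH cinf.prems) simp
qed (simp; blast)+

lemma is_structure_Metric_space: "is_structure L S \<Longrightarrow> Metric_space (universe S) (mdst S)"
  unfolding is_structure_def by blast

lemma structure_mdst_nonneg: "is_structure L S \<Longrightarrow> 0 \<le> mdst S x y"
  by (rule Metric_space.nonneg[OF is_structure_Metric_space])

lemma structure_mdst_self: "is_structure L S \<Longrightarrow> x \<in> universe S \<Longrightarrow> mdst S x x = 0"
  using Metric_space.zero[OF is_structure_Metric_space, of L S x x] by simp

text \<open>A supremum or infimum moves by at most the uniform bound on the movement of its members.
  The bound variable takes the same value on both sides, which is why its coordinate is 0 in the
  rules \<open>supq\<close> and \<open>infq\<close>.\<close>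

lemma eval_modulus:
  assumes L: "is_signature L" and S: "is_structure L S" and ne: "universe S \<noteq> {}"
  shows "formula L \<phi> \<Delta> K \<Longrightarrow> range e \<subseteq> universe S \<Longrightarrow> range e' \<subseteq> universe S
    \<Longrightarrow> \<bar>eval S \<phi> e - eval S \<phi> e'\<bar> \<le> \<Delta> (\<lambda>i. mdst S (e i) (e' i))"
proof (induction arbitrary: e e' rule: formula.induct)
  case (atomic P xs)
  have "\<bar>interp S P (map e xs) - interp S P (map e' xs)\<bar>
      \<le> modulus L P (\<lambda>i. mdst S (map e xs ! i) (map e' xs ! i))"
    using S atomic unfolding is_structure_def by (auto simp: subset_eq)
  also have "\<dots> = modulus L P (\<lambda>i. mdst S (e (xs ! i)) (e' (xs ! i)))"
    using L atomic structure_mdst_nonneg[OF S]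
    by (intro is_modulus_cong[of "{..<arity L P}"]) (auto simp: is_signature_def)
  finally show ?case by simp
next
  case (add \<phi> \<Delta> K \<psi> \<Delta>' K')
  show ?case using add.IH[OF add.prems] by simp
next
  case (scale \<phi> \<Delta> K r)
  show ?case using scale.IH[OF scale.prems]
    by (simp add: abs_mult mult_left_mono flip: right_diff_distrib)
next
  case (maxf \<phi> \<Delta> K \<psi> \<Delta>' K')
  show ?case using maxf.IH[OF maxf.prems] by simp
next
  case (supq \<phi> \<Delta> K)
  have r: "range (case_nat x e) \<subseteq> universe S" "range (case_nat x e') \<subseteq> universe S"
    if "x \<in> universe S" for x
    using that supq.prems by (simp_all add: range_case_nat)
  have eq: "(\<lambda>i. mdst S (case_nat x e i) (case_nat x e' i)) = case_nat 0 (\<lambda>i. mdst S (e i) (e' i))"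
    if "x \<in> universe S" for x
    using structure_mdst_self[OF S that] by (auto simp: fun_eq_iff split: nat.split)
  have step: "\<bar>eval S \<phi> (case_nat x e) - eval S \<phi> (case_nat x e')\<bar> \<le> \<Delta> (case_nat 0 (\<lambda>i. mdst S (e i) (e' i)))"
    if x: "x \<in> universe S" for x
    using supq.IH[OF r[OF x]] unfolding eq[OF x] .
  note b = compact_bdd_image(1)[OF formula_compact[OF L supq.hyps], of "universe S"]
  show ?case unfolding eval.simps
    by (intro SUP_diff_le ne b eval_in_bound[OF L S ne supq.hyps] r step)
next
  case (infq \<phi> \<Delta> K)
  have r: "range (case_nat x e) \<subseteq> universe S" "range (case_nat x e') \<subseteq> universe S"
    if "x \<in> universe S" for x
    using that infq.prems by (simp_all add: range_case_nat)
  have eq: "(\<lambda>i. mdst S (case_nat x e i) (case_nat x e' i)) = case_nat 0 (\<lambda>i. mdst S (e i) (e' i))"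
    if "x \<in> universe S" for x
    using structure_mdst_self[OF S that] by (auto simp: fun_eq_iff split: nat.split)
  have step: "\<bar>eval S \<phi> (case_nat x e) - eval S \<phi> (case_nat x e')\<bar> \<le> \<Delta> (case_nat 0 (\<lambda>i. mdst S (e i) (e' i)))"
    if x: "x \<in> universe S" for x
    using infq.IH[OF r[OF x]] unfolding eq[OF x] .
  note b = compact_bdd_image(2)[OF formula_compact[OF L infq.hyps], of "universe S"]
  show ?case unfolding eval.simps
    by (intro INF_diff_le ne b eval_in_bound[OF L S ne infq.hyps] r step)
next
  case (csup f \<Delta> K V)
  note b = compact_bdd_image(1)[OF formula_compact[OF L csup.hyps(1)], of UNIV]
  show ?case unfolding eval.simps
    by (intro SUP_diff_le b eval_in_bound[OF L S ne csup.hyps(1)] csup.prems csup.IH) auto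
next
  case (cinf f \<Delta> K V)
  note b = compact_bdd_image(2)[OF formula_compact[OF L cinf.hyps(1)], of UNIV]
  show ?case unfolding eval.simps
    by (intro INF_diff_le b eval_in_bound[OF L S ne cinf.hyps(1)] cinf.prems cinf.IH) auto
next
  case (weaken \<phi> \<Delta> K V \<Delta>' K')
  show ?case
    by (rule order_trans[OF weaken.IH[OF weaken.prems] weaken.hyps(3)])
      (rule structure_mdst_nonneg[OF S])
qed simp

section \<open>Quantifiers along a dense sequence, and values determined by the code\<close>

lemma tail_dense_range: "y \<in> tail_dense S \<Longrightarrow> y i \<in> universe S"
  unfolding tail_dense_def by auto

lemma tail_dense_near:
  assumes S: "is_structure L S" and y: "y \<in> tail_dense S" and x: "x \<in> universe S" and r: "r > 0"
  shows "\<exists>k\<ge>n. mdst S x (y k) < r"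
proof -
  interpret Metric_space "universe S" "mdst S" by (rule is_structure_Metric_space[OF S])
  have "x \<in> mtop S closure_of (y ` {n..})" using x y unfolding tail_dense_def by blast
  then obtain z where "z \<in> y ` {n..}" "z \<in> mball x r" using r unfolding metric_closure_of by blast
  then show ?thesis by auto
qed

lemma SUP_INF_eq_dense:
  fixes f :: "'a \<Rightarrow> real" and z :: "nat \<Rightarrow> 'a"
  assumes z: "range z \<subseteq> U" and b: "bdd_above (f ` U)" "bdd_below (f ` U)"
    and near: "\<And>x \<epsilon>. x \<in> U \<Longrightarrow> 0 < \<epsilon> \<Longrightarrow> \<exists>i. \<bar>f x - f (z i)\<bar> \<le> \<epsilon>"
  shows "(SUP x\<in>U. f x) = (SUP i. f (z i))" "(INF x\<in>U. f x) = (INF i. f (z i))"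
proof -
  have sub: "range (\<lambda>i. f (z i)) \<subseteq> f ` U" using z by auto
  have b': "bdd_above (range (\<lambda>i. f (z i)))" "bdd_below (range (\<lambda>i. f (z i)))"
    by (rule bdd_above_mono[OF b(1) sub], rule bdd_below_mono[OF b(2) sub])
  have "f x \<le> (SUP i. f (z i))" "(INF i. f (z i)) \<le> f x" if x: "x \<in> U" for x
  proof -
    show "f x \<le> (SUP i. f (z i))"
    proof (rule field_le_epsilon)
      fix \<epsilon> :: real assume "0 < \<epsilon>"
      then obtain i where "\<bar>f x - f (z i)\<bar> \<le> \<epsilon>" using near x by blast
      then show "f x \<le> (SUP i. f (z i)) + \<epsilon>" using cSUP_upper[OF UNIV_I b'(1), of i] by linarith
    qed
    show "(INF i. f (z i)) \<le> f x"
    proof (rule field_le_epsilon)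
      fix \<epsilon> :: real assume "0 < \<epsilon>"
      then obtain i where "\<bar>f x - f (z i)\<bar> \<le> \<epsilon>" using near x by blast
      then show "(INF i. f (z i)) \<le> f x + \<epsilon>" using cINF_lower[OF b'(2) UNIV_I, of i] by linarith
    qed
  qed
  moreover have "f (z i) \<le> (SUP x\<in>U. f x)" "(INF x\<in>U. f x) \<le> f (z i)" for i
    using z by (auto intro!: cSUP_upper cINF_lower b)
  moreover have "U \<noteq> {}" using z by auto
  ultimately show "(SUP x\<in>U. f x) = (SUP i. f (z i))" "(INF x\<in>U. f x) = (INF i. f (z i))"
    by (auto intro!: antisym cSUP_least cINF_greatest)
qed

lemma small_near_zero:
  fixes f :: "real \<Rightarrow> real"
  assumes f: "continuous_on {0..} f" "f 0 = 0" and "0 < \<epsilon>"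
  shows "\<exists>\<delta>>0. \<forall>t. 0 \<le> t \<and> t < \<delta> \<longrightarrow> \<bar>f t\<bar> < \<epsilon>"
proof -
  obtain \<delta> where "\<delta> > 0" "\<And>t. t \<in> {0..} \<Longrightarrow> dist t 0 < \<delta> \<Longrightarrow> dist (f t) (f 0) < \<epsilon>"
    using f(1) \<open>0 < \<epsilon>\<close> unfolding continuous_on_iff by (metis atLeast_iff order_refl)
  then show ?thesis using f(2) by (intro exI[of _ \<delta>]) (auto simp: dist_real_def)
qed

text \<open>Restricted to the coordinate of the bound variable, the modulus is a continuous function
  of one real \<open>t\<close> that vanishes at 0; density supplies a term of the sequence close
  enough to \<open>x\<close>.\<close>

lemma eval_near:
  assumes L: "is_signature L" and S: "is_structure L S" and z: "z \<in> tail_dense S"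
    and \<phi>: "formula L \<phi> \<Delta> K" and e: "range e \<subseteq> universe S" and x: "x \<in> universe S" and "0 < \<epsilon>"
  shows "\<exists>i. \<bar>eval S \<phi> (case_nat x e) - eval S \<phi> (case_nat (z i) e)\<bar> \<le> \<epsilon>"
proof -
  have ne: "universe S \<noteq> {}" using x by blast
  obtain V where V: "is_modulus V \<Delta>" using formula_modulus[OF L \<phi>] by blast
  let ?c = "\<lambda>t::real. case_nat t (\<lambda>_. 0)"
  have "continuous_on {0..} ?c"
  proof (rule continuous_on_coordinatewise_then_product)
    show "continuous_on {0..} (\<lambda>t. ?c t i)" for i by (cases i) (auto intro: continuous_intros)
  qed
  then have "continuous_on {0..} (\<lambda>t. \<Delta> (?c t))"
    by (rule continuous_on_compose2[OF is_modulus_continuous[OF V]]) (auto split: nat.split)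
  moreover have "\<Delta> (?c 0) = 0" by (rule is_modulus_zero[OF V]) (auto split: nat.split)
  ultimately obtain \<delta> where \<delta>: "\<delta> > 0" "\<And>t. 0 \<le> t \<Longrightarrow> t < \<delta> \<Longrightarrow> \<bar>\<Delta> (?c t)\<bar> < \<epsilon>"
    using small_near_zero[OF _ _ \<open>0 < \<epsilon>\<close>, of "\<lambda>t. \<Delta> (?c t)"] by blast
  obtain k where k: "mdst S x (z k) < \<delta>" using tail_dense_near[OF S z x \<delta>(1)] by blast
  have "\<bar>eval S \<phi> (case_nat x e) - eval S \<phi> (case_nat (z k) e)\<bar>
      \<le> \<Delta> (\<lambda>i. mdst S (case_nat x e i) (case_nat (z k) e i))"
    by (intro eval_modulus[OF L S ne \<phi>] range_case_nat x e tail_dense_range[OF z])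
  also have "(\<lambda>i. mdst S (case_nat x e i) (case_nat (z k) e i)) = ?c (mdst S x (z k))"
  proof
    show "mdst S (case_nat x e i) (case_nat (z k) e i) = ?c (mdst S x (z k)) i" for i
      using e structure_mdst_self[OF S] by (cases i) (auto simp: image_subset_iff)
  qed
  also have "\<Delta> \<dots> \<le> \<epsilon>" using \<delta>(2)[OF structure_mdst_nonneg[OF S] k] by linarith
  finally show ?thesis by blast
qed

lemma eval_quantifier_dense:
  assumes L: "is_signature L" and S: "is_structure L S" and z: "z \<in> tail_dense S"
    and \<phi>: "formula L \<phi> \<Delta> K" and e: "range e \<subseteq> universe S"
  shows "eval S (SupQ \<phi>) e = (SUP i. eval S \<phi> (case_nat (z i) e))"
    and "eval S (InfQ \<phi>) e = (INF i. eval S \<phi> (case_nat (z i) e))"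
proof -
  have zr: "range z \<subseteq> universe S" using tail_dense_range[OF z] by blast
  have ne: "universe S \<noteq> {}" using zr by blast
  have "eval S \<phi> (case_nat x e) \<in> K" if "x \<in> universe S" for x
    by (intro eval_in_bound[OF L S ne \<phi>] range_case_nat that e)
  note b = compact_bdd_image[OF formula_compact[OF L \<phi>] this]
  note * = SUP_INF_eq_dense[OF zr b eval_near[OF L S z \<phi> e]]
  show "eval S (SupQ \<phi>) e = (SUP i. eval S \<phi> (case_nat (z i) e))"
    "eval S (InfQ \<phi>) e = (INF i. eval S \<phi> (case_nat (z i) e))"
    unfolding eval.simps by (rule *; assumption)+
qed

text \<open>Along a dense sequence quantifiers become suprema and infima over indices, so only
  predicate values recorded in the code are consulted. The index map \<open>s\<close> is arbitrary
  because a quantifier extends it by the index of its bound variable.\<close>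

lemma eval_code:
  assumes L: "is_signature L"
    and S: "is_structure L S" "z \<in> tail_dense S" and S': "is_structure L S'" "z' \<in> tail_dense S'"
    and eq: "code_of L S z = code_of L S' z'"
  shows "formula L \<phi> \<Delta> K \<Longrightarrow> eval S \<phi> (\<lambda>i. z (s i)) = eval S' \<phi> (\<lambda>i. z' (s i))"
proof (induction arbitrary: s rule: formula.induct)
  case (atomic P xs)
  have "code_of L S z (P, map s xs) = code_of L S' z' (P, map s xs)" using eq by simp
  then show ?case using atomic by (simp add: code_of_def code_index_def comp_def)
next
  case (supq \<phi> \<Delta> K)
  have r: "range (\<lambda>i. z (s i)) \<subseteq> universe S" "range (\<lambda>i. z' (s i)) \<subseteq> universe S'"
    using tail_dense_range[OF S(2)] tail_dense_range[OF S'(2)] by blast+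
  have c: "case_nat (y i) (\<lambda>i. y (s i)) = (\<lambda>j. y (case_nat i s j))" for i and y :: "nat \<Rightarrow> 'x"
    by (auto simp: fun_eq_iff split: nat.split)
  show ?case
    unfolding eval_quantifier_dense[OF L S supq.hyps r(1)] eval_quantifier_dense[OF L S' supq.hyps r(2)] c
      supq.IH ..
next
  case (infq \<phi> \<Delta> K)
  have r: "range (\<lambda>i. z (s i)) \<subseteq> universe S" "range (\<lambda>i. z' (s i)) \<subseteq> universe S'"
    using tail_dense_range[OF S(2)] tail_dense_range[OF S'(2)] by blast+
  have c: "case_nat (y i) (\<lambda>i. y (s i)) = (\<lambda>j. y (case_nat i s j))" for i and y :: "nat \<Rightarrow> 'x"
    by (auto simp: fun_eq_iff split: nat.split)
  show ?case
    unfolding eval_quantifier_dense[OF L S infq.hyps r(1)] eval_quantifier_dense[OF L S' infq.hyps r(2)] c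
      infq.IH ..
qed simp_all

lemma eval_cong: "(\<And>i. i \<in> fv \<phi> \<Longrightarrow> e i = e' i) \<Longrightarrow> eval S \<phi> e = eval S \<phi> e'"
proof (induction \<phi> arbitrary: e e')
  case (Pred P xs)
  then show ?case by (auto intro: arg_cong[where f = "interp S P"])
next
  case (Add \<phi> \<psi>)
  show ?case using Add.IH[of e e'] Add.prems by simp
next
  case (MaxF \<phi> \<psi>)
  show ?case using MaxF.IH[of e e'] MaxF.prems by simp
next
  case (SupQ \<phi>)
  have "eval S \<phi> (case_nat x e) = eval S \<phi> (case_nat x e')" for x
    using SupQ.prems by (intro SupQ.IH) (auto split: nat.split)
  then show ?case by simp
next
  case (InfQ \<phi>)
  have "eval S \<phi> (case_nat x e) = eval S \<phi> (case_nat x e')" for x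
    using InfQ.prems by (intro InfQ.IH) (auto split: nat.split)
  then show ?case by simp
next
  case (CSup f)
  have "eval S (f n) e = eval S (f n) e'" for n
    using CSup.prems by (intro CSup.IH[of "f n"]) auto
  then show ?case by simp
next
  case (CInf f)
  have "eval S (f n) e = eval S (f n) e'" for n
    using CInf.prems by (intro CInf.IH[of "f n"]) auto
  then show ?case by simp
next
  case (Scale r \<phi>)
  show ?case using Scale.IH[of e e'] Scale.prems by simp
qed simp

section \<open>Generated fragments\<close>

lemma subst_cong: "(\<And>i. i \<in> fv \<phi> \<Longrightarrow> \<sigma> i = \<tau> i) \<Longrightarrow> subst \<sigma> \<phi> = subst \<tau> \<phi>"
proof (induction \<phi> arbitrary: \<sigma> \<tau>)
  case (Add \<phi> \<psi>)
  show ?case using Add.IH[of \<sigma> \<tau>] Add.prems by simp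
next
  case (MaxF \<phi> \<psi>)
  show ?case using MaxF.IH[of \<sigma> \<tau>] MaxF.prems by simp
next
  case (SupQ \<phi>)
  have "subst (case_nat 0 (Suc \<circ> \<sigma>)) \<phi> = subst (case_nat 0 (Suc \<circ> \<tau>)) \<phi>"
    using SupQ.prems by (intro SupQ.IH) (auto split: nat.split)
  then show ?case by simp
next
  case (InfQ \<phi>)
  have "subst (case_nat 0 (Suc \<circ> \<sigma>)) \<phi> = subst (case_nat 0 (Suc \<circ> \<tau>)) \<phi>"
    using InfQ.prems by (intro InfQ.IH) (auto split: nat.split)
  then show ?case by simp
next
  case (CSup f)
  have "subst \<sigma> (f n) = subst \<tau> (f n)" for n
    using CSup.prems by (intro CSup.IH[of "f n"]) auto
  then show ?case by simp
next
  case (CInf f)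
  have "subst \<sigma> (f n) = subst \<tau> (f n)" for n
    using CInf.prems by (intro CInf.IH[of "f n"]) auto
  then show ?case by simp
next
  case (Scale r \<phi>)
  show ?case using Scale.IH[of \<sigma> \<tau>] Scale.prems by simp
qed simp_all

lemma fv_subst: "fv (subst \<sigma> \<phi>) = \<sigma> ` fv \<phi>"
proof -
  have *: "{n. Suc n \<in> case_nat 0 (Suc \<circ> \<sigma>) ` A} = \<sigma> ` {n. Suc n \<in> A}" for \<sigma> :: "nat \<Rightarrow> nat" and A
  proof (intro equalityI subsetI)
    fix n assume "n \<in> {n. Suc n \<in> case_nat 0 (Suc \<circ> \<sigma>) ` A}"
    then obtain k where "k \<in> A" "Suc n = case_nat 0 (Suc \<circ> \<sigma>) k" by auto
    then show "n \<in> \<sigma> ` {n. Suc n \<in> A}" by (cases k) auto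
  next
    fix n assume "n \<in> \<sigma> ` {n. Suc n \<in> A}"
    then obtain k where "n = \<sigma> k" "Suc k \<in> A" by auto
    then show "n \<in> {n. Suc n \<in> case_nat 0 (Suc \<circ> \<sigma>) ` A}" by (auto intro!: rev_image_eqI[of "Suc k"])
  qed
  show ?thesis by (induction \<phi> arbitrary: \<sigma>) (simp_all add: * image_Un image_UN)
qed

lemma is_modulus_subst:
  "is_modulus V \<Delta> \<Longrightarrow> is_modulus (\<sigma> ` V) (\<lambda>\<delta>. \<Delta> (\<lambda>i. \<delta> (\<sigma> i)))" for \<sigma> :: "nat \<Rightarrow> nat"
  using is_modulus_reindex[of V \<Delta> "\<lambda>i. Some (\<sigma> i)" "\<sigma> ` V"] is_modulus_finite by auto

lemma formula_subst:
  assumes L: "is_signature L"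
  shows "formula L \<phi> \<Delta> K \<Longrightarrow> formula L (subst \<sigma> \<phi>) (\<lambda>\<delta>. \<Delta> (\<lambda>i. \<delta> (\<sigma> i))) K"
proof (induction arbitrary: \<sigma> rule: formula.induct)
  case (atomic P xs)
  have m: "is_modulus {..<arity L P} (modulus L P)" and K: "compact (bound L P)"
    using L atomic by (auto simp: is_signature_def)
  \<comment> \<open>\<open>map \<sigma> xs ! i\<close> and \<open>\<sigma> (xs ! i)\<close> may
    differ for \<open>i\<close> beyond the list. Only coordinates below the arity matter to the
    modulus, so \<open>weaken\<close> can exchange the two expressions.\<close>
  have "is_modulus ((\<lambda>i. \<sigma> (xs ! i)) ` {..<arity L P}) (\<lambda>\<delta>. modulus L P (\<lambda>i. \<delta> (\<sigma> (xs ! i))))"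
    by (rule is_modulus_subst[OF m])
  moreover have "formula L (Pred P (map \<sigma> xs)) (\<lambda>\<delta>. modulus L P (\<lambda>i. \<delta> (map \<sigma> xs ! i))) (bound L P)"
    using atomic by (intro formula.atomic) auto
  moreover have "modulus L P (\<lambda>i. \<delta> (map \<sigma> xs ! i)) \<le> modulus L P (\<lambda>i. \<delta> (\<sigma> (xs ! i)))"
    if "\<And>i. 0 \<le> \<delta> i" for \<delta>
    using atomic that by (intro is_modulus_mono[OF m]) auto
  ultimately show ?case using K unfolding subst.simps by (meson formula.weaken order_refl)
next
  case (supq \<phi> \<Delta> K)
  have "formula L (SupQ (subst (case_nat 0 (Suc \<circ> \<sigma>)) \<phi>))
      (\<lambda>\<delta>. \<Delta> (\<lambda>i. case_nat 0 \<delta> (case_nat 0 (Suc \<circ> \<sigma>) i))) K"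
    by (rule formula.supq[OF supq.IH])
  also have "(\<lambda>\<delta>::nat \<Rightarrow> real. \<Delta> (\<lambda>i. case_nat 0 \<delta> (case_nat 0 (Suc \<circ> \<sigma>) i))) = (\<lambda>\<delta>. \<Delta> (case_nat 0 (\<lambda>i. \<delta> (\<sigma> i))))"
    by (intro ext arg_cong[where f = \<Delta>]) (auto split: nat.split)
  finally show ?case by simp
next
  case (infq \<phi> \<Delta> K)
  have "formula L (InfQ (subst (case_nat 0 (Suc \<circ> \<sigma>)) \<phi>))
      (\<lambda>\<delta>. \<Delta> (\<lambda>i. case_nat 0 \<delta> (case_nat 0 (Suc \<circ> \<sigma>) i))) K"
    by (rule formula.infq[OF infq.IH])
  also have "(\<lambda>\<delta>::nat \<Rightarrow> real. \<Delta> (\<lambda>i. case_nat 0 \<delta> (case_nat 0 (Suc \<circ> \<sigma>) i))) = (\<lambda>\<delta>. \<Delta> (case_nat 0 (\<lambda>i. \<delta> (\<sigma> i))))"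
    by (intro ext arg_cong[where f = \<Delta>]) (auto split: nat.split)
  finally show ?case by simp
next
  case (csup f \<Delta> K V)
  then show ?case unfolding subst.simps
    by (intro formula.csup[of _ _ _ _ "\<sigma> ` V"]) (auto simp: fv_subst)
next
  case (cinf f \<Delta> K V)
  then show ?case unfolding subst.simps
    by (intro formula.cinf[of _ _ _ _ "\<sigma> ` V"]) (auto simp: fv_subst)
next
  case (weaken \<phi> \<Delta> K V \<Delta>' K')
  show ?case
    by (rule formula.weaken[OF weaken.IH is_modulus_subst[OF weaken.hyps(2)]])
      (use weaken.hyps in auto)
next
  case (scale \<phi> \<Delta> K r)
  show ?case unfolding subst.simps by (rule formula.scale[OF scale.IH])
qed (auto intro: formula.intros)

lemma subformulas_formulas: "formula L \<phi> \<Delta> K \<Longrightarrow> subformulas \<phi> \<subseteq> formulas L"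
proof (induction rule: formula.induct)
  case (csup f \<Delta> K V)
  have "formula L (CSup f) \<Delta> K"
    by (rule formula.csup[of L f \<Delta> K V]) (rule csup.hyps)+
  then have "CSup f \<in> formulas L" unfolding formulas_def by blast
  then show ?case using csup.IH by auto
next
  case (cinf f \<Delta> K V)
  have "formula L (CInf f) \<Delta> K"
    by (rule formula.cinf[of L f \<Delta> K V]) (rule cinf.hyps)+
  then have "CInf f \<in> formulas L" unfolding formulas_def by blast
  then show ?case using cinf.IH by auto
qed (auto simp: formulas_def intro: formula.intros)

lemma countable_subformulas: "countable (subformulas \<phi>)"
  by (induction \<phi>) auto

text \<open>There are uncountably many substitutions, but only their values at the finitely many
  free variables matter, and a list of numbers records these. A fragment can therefore be closed
  under all substitutions and still be countable.\<close>

lemma countable_range_subst: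
  assumes "finite (fv \<phi>)"
  shows "countable (range (\<lambda>\<sigma>. subst \<sigma> \<phi>))"
proof -
  obtain n where n: "fv \<phi> \<subseteq> {..<n}" using assms finite_nat_iff_bounded by blast
  have "subst \<sigma> \<phi> \<in> range (\<lambda>l. subst (\<lambda>i. l ! i) \<phi>)" for \<sigma>
    using n by (intro range_eqI[of _ _ "map \<sigma> [0..<n]"] subst_cong) auto
  then have "range (\<lambda>\<sigma>. subst \<sigma> \<phi>) \<subseteq> range (\<lambda>l :: nat list. subst (\<lambda>i. l ! i) \<phi>)" by blast
  then show ?thesis by (rule countable_subset) simp
qed

definition fragment_step :: "signature \<Rightarrow> fm set \<Rightarrow> fm set" where
  "fragment_step L X = X \<union> (\<lambda>(P, xs). Pred P xs) ` code_index L \<union> {One}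
     \<union> (\<lambda>(\<phi>, \<psi>). Add \<phi> \<psi>) ` (X \<times> X) \<union> (\<lambda>(\<phi>, \<psi>). MaxF \<phi> \<psi>) ` (X \<times> X)
     \<union> (\<lambda>(r, \<phi>). Scale r \<phi>) ` (UNIV \<times> X) \<union> SupQ ` X \<union> InfQ ` X
     \<union> (\<Union>\<phi>\<in>X. subformulas \<phi>) \<union> (\<Union>\<phi>\<in>X. range (\<lambda>\<sigma>. subst \<sigma> \<phi>))"

lemma fragment_step_countable:
  assumes "X \<subseteq> formulas L" "countable X"
  shows "countable (fragment_step L X)"
proof -
  have "finite (fv \<phi>)" if "\<phi> \<in> X" for \<phi>
    using that assms(1) formula_finite_fv by (auto simp: formulas_def)
  moreover have "countable (code_index L)" by (rule countable_subset[OF subset_UNIV]) simp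
  ultimately show ?thesis
    unfolding fragment_step_def using assms(2)
    by (intro countable_Un countable_UN countable_image countable_SIGMA countable_range_subst
        countable_subformulas countableI_type) auto
qed

lemma fragment_step_formulas:
  assumes L: "is_signature L" and X: "X \<subseteq> formulas L"
  shows "fragment_step L X \<subseteq> formulas L"
proof -
  have "\<exists>\<Delta> K. formula L \<phi> \<Delta> K" if "\<phi> \<in> X" for \<phi> using X that by (auto simp: formulas_def)
  then obtain \<Delta> K where X': "\<And>\<phi>. \<phi> \<in> X \<Longrightarrow> formula L \<phi> (\<Delta> \<phi>) (K \<phi>)" by metis
  have "Pred P xs \<in> formulas L" if "(P, xs) \<in> code_index L" for P xs
    using that by (auto simp: code_index_def formulas_def intro: formula.atomic)
  moreover have "One \<in> formulas L" by (auto simp: formulas_def intro: formula.one)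
  moreover have "Add \<phi> \<psi> \<in> formulas L" "MaxF \<phi> \<psi> \<in> formulas L" if "\<phi> \<in> X" "\<psi> \<in> X" for \<phi> \<psi>
    using X'[OF that(1)] X'[OF that(2)] by (auto simp: formulas_def intro: formula.add formula.maxf)
  moreover have "Scale r \<phi> \<in> formulas L" "SupQ \<phi> \<in> formulas L" "InfQ \<phi> \<in> formulas L"
    "\<psi> \<in> subformulas \<phi> \<Longrightarrow> \<psi> \<in> formulas L" "subst \<sigma> \<phi> \<in> formulas L" if "\<phi> \<in> X" for \<phi> \<psi> r \<sigma>
    using X'[OF that] subformulas_formulas[OF X'[OF that]] formula_subst[OF L X'[OF that]]
    by (auto simp: formulas_def intro: formula.scale formula.supq formula.infq)
  ultimately show ?thesis using X unfolding fragment_step_def by (auto dest: subsetD)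
qed

lemma fragment_exists:
  assumes L: "is_signature L" and X: "X \<subseteq> formulas L" "countable X"
  shows "\<exists>F. fragment L F \<and> X \<subseteq> F"
proof -
  define G where "G n = (fragment_step L ^^ n) X" for n
  have G: "G n \<subseteq> formulas L \<and> countable (G n)" for n
  proof (induction n)
    case (Suc n)
    then show ?case using fragment_step_countable[of "G n" L] fragment_step_formulas[OF L, of "G n"]
      by (simp add: G_def)
  qed (use X in \<open>simp add: G_def\<close>)
  have step: "G (Suc n) = fragment_step L (G n)" for n by (simp add: G_def)
  have "G n \<subseteq> G (Suc n)" for n unfolding step fragment_step_def by blast
  then have mono: "G m \<subseteq> G n" if "m \<le> n" for m n using that by (rule lift_Suc_mono_le)
  \<comment> \<open>Two formulas of the union occur together at some stage. Since \<open>f\<close>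
    may ignore an argument, the unary closure conditions are covered as well.\<close>
  have two: "f \<phi> \<psi> \<in> (\<Union>n. G n)"
    if *: "\<phi> \<in> (\<Union>n. G n)" "\<psi> \<in> (\<Union>n. G n)" "\<And>Y. \<phi> \<in> Y \<Longrightarrow> \<psi> \<in> Y \<Longrightarrow> f \<phi> \<psi> \<in> fragment_step L Y" for f \<phi> \<psi>
  proof -
    obtain m n where "\<phi> \<in> G m" "\<psi> \<in> G n" using *(1,2) by blast
    then have "\<phi> \<in> G (max m n)" "\<psi> \<in> G (max m n)"
      using mono[of m "max m n"] mono[of n "max m n"] by auto
    then have "f \<phi> \<psi> \<in> G (Suc (max m n))" unfolding step by (rule *(3))
    then show ?thesis by blast
  qed
  have "fragment L (\<Union>n. G n)"
    unfolding fragment_def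
  proof (intro conjI ballI allI impI)
    show "(\<Union>n. G n) \<subseteq> formulas L" "countable (\<Union>n. G n)" using G by auto
    show "One \<in> (\<Union>n. G n)" using step[of 0] unfolding fragment_step_def by blast
    show "Pred P xs \<in> (\<Union>n. G n)" if "P \<in> syms L" "length xs = arity L P" for P xs
    proof -
      have "(P, xs) \<in> code_index L" using that by (simp add: code_index_def)
      then have "Pred P xs \<in> G (Suc 0)" unfolding step fragment_step_def by force
      then show ?thesis by blast
    qed
    fix \<phi> assume \<phi>: "\<phi> \<in> (\<Union>n. G n)"
    show "Add \<phi> \<psi> \<in> (\<Union>n. G n)" "MaxF \<phi> \<psi> \<in> (\<Union>n. G n)" if "\<psi> \<in> (\<Union>n. G n)" for \<psi>
      by (rule two[OF \<phi> that], force simp: fragment_step_def)+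
    show "Scale r \<phi> \<in> (\<Union>n. G n)" for r
      by (rule two[OF \<phi> \<phi>], force simp: fragment_step_def)
    show "SupQ \<phi> \<in> (\<Union>n. G n)" by (rule two[OF \<phi> \<phi>], force simp: fragment_step_def)
    show "InfQ \<phi> \<in> (\<Union>n. G n)" by (rule two[OF \<phi> \<phi>], force simp: fragment_step_def)
    show "subst \<sigma> \<phi> \<in> (\<Union>n. G n)" for \<sigma> by (rule two[OF \<phi> \<phi>], force simp: fragment_step_def)
    show "subformulas \<phi> \<subseteq> (\<Union>n. G n)"
    proof
      fix \<psi> assume "\<psi> \<in> subformulas \<phi>"
      then show "\<psi> \<in> (\<Union>n. G n)"
        by (intro two[OF \<phi> \<phi>, of "\<lambda>_ _. \<psi>"]) (force simp: fragment_step_def)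
    qed
  qed
  moreover have "X \<subseteq> (\<Union>n. G n)" using UN_upper[of 0 UNIV G] by (simp add: G_def)
  ultimately show ?thesis by blast
qed

section \<open>Bounded search formulas\<close>

text \<open>The block of quantifiers binds the variables below \<open>m\<close>, and the free
  variable \<open>i\<close> of the whole formula appears inside as \<open>i + m\<close>; hence the
  zeros and the shift in the modulus.\<close>

lemma InfQ_iter_formula:
  "formula L \<phi> \<Delta> K \<Longrightarrow>
    formula L ((InfQ ^^ m) \<phi>) (\<lambda>\<delta>. \<Delta> (\<lambda>j. if j < m then 0 else \<delta> (j - m))) K"
proof (induction m)
  case (Suc m)
  have eq: "(\<lambda>j. if j < m then 0 else case_nat 0 \<delta> (j - m)) = (\<lambda>j. if j < Suc m then 0 else \<delta> (j - Suc m))"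
    for \<delta> :: "nat \<Rightarrow> real"
  proof
    fix j
    show "(if j < m then 0 else case_nat 0 \<delta> (j - m)) = (if j < Suc m then 0 else \<delta> (j - Suc m))"
      by (cases "j - m") (auto simp: diff_Suc)
  qed
  show ?case using formula.infq[OF Suc.IH[OF Suc.prems]] by (simp add: eq)
qed simp

lemma fv_InfQ_iter: "fv ((InfQ ^^ m) \<phi>) = {i. i + m \<in> fv \<phi>}"
  by (induction m) auto

text \<open>An infimum of a nonempty bounded set is below \<open>u\<close> iff some member is, so
  for strict inequalities a block of infima is an exact existential quantifier. For this reason
  forcing is specified by \<open><\<close>.\<close>

lemma eval_InfQ_iter_less:
  assumes L: "is_signature L" and S: "is_structure L S" and ne: "universe S \<noteq> {}"
    and \<phi>: "formula L \<phi> \<Delta> K"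
  shows "range e \<subseteq> universe S \<Longrightarrow> eval S ((InfQ ^^ m) \<phi>) e < u \<longleftrightarrow>
    (\<exists>b. range b \<subseteq> universe S \<and> eval S \<phi> (\<lambda>j. if j < m then b j else e (j - m)) < u)"
proof (induction m arbitrary: e)
  case 0
  then show ?case by auto
next
  case (Suc m)
  let ?\<psi> = "(InfQ ^^ m) \<phi>"
  have r: "range (case_nat x e) \<subseteq> universe S" if "x \<in> universe S" for x
    by (rule range_case_nat[OF that Suc.prems])
  have "eval S ?\<psi> (case_nat x e) \<in> K" if "x \<in> universe S" for x
    by (rule eval_in_bound[OF L S ne InfQ_iter_formula[OF \<phi>] r[OF that]])
  then have "bdd_below ((\<lambda>x. eval S ?\<psi> (case_nat x e)) ` universe S)"
    by (rule compact_bdd_image(2)[OF formula_compact[OF L \<phi>]])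
  then have "eval S ((InfQ ^^ Suc m) \<phi>) e < u \<longleftrightarrow> (\<exists>x\<in>universe S. eval S ?\<psi> (case_nat x e) < u)"
    using ne by (simp add: cINF_less_iff)
  also have "\<dots> \<longleftrightarrow> (\<exists>x\<in>universe S. \<exists>b. range b \<subseteq> universe S \<and>
      eval S \<phi> (\<lambda>j. if j < m then b j else case_nat x e (j - m)) < u)"
    using Suc.IH[OF r] by simp
  also have "\<dots> \<longleftrightarrow> (\<exists>b. range b \<subseteq> universe S \<and>
      eval S \<phi> (\<lambda>j. if j < Suc m then b j else e (j - Suc m)) < u)"
  proof
    assume "\<exists>x\<in>universe S. \<exists>b. range b \<subseteq> universe S \<and>
      eval S \<phi> (\<lambda>j. if j < m then b j else case_nat x e (j - m)) < u"
    then obtain x b where b: "x \<in> universe S" "range b \<subseteq> universe S"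
      "eval S \<phi> (\<lambda>j. if j < m then b j else case_nat x e (j - m)) < u" by blast
    \<comment> \<open>The outermost of the \<open>Suc m\<close> quantifiers binds the variable
      \<open>m\<close> of \<phi>.\<close>
    have "(\<lambda>j. if j < m then b j else case_nat x e (j - m))
        = (\<lambda>j. if j < Suc m then (b(m := x)) j else e (j - Suc m))"
    proof
      fix j
      show "(if j < m then b j else case_nat x e (j - m))
        = (if j < Suc m then (b(m := x)) j else e (j - Suc m))"
        by (cases "j - m") (auto simp: less_Suc_eq diff_Suc)
    qed
    moreover have "range (b(m := x)) \<subseteq> universe S" using b by auto
    ultimately show "\<exists>b. range b \<subseteq> universe S \<and>
      eval S \<phi> (\<lambda>j. if j < Suc m then b j else e (j - Suc m)) < u" using b(3) by metis
  next
    assume "\<exists>b. range b \<subseteq> universe S \<and>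
      eval S \<phi> (\<lambda>j. if j < Suc m then b j else e (j - Suc m)) < u"
    then obtain b where b: "range b \<subseteq> universe S"
      "eval S \<phi> (\<lambda>j. if j < Suc m then b j else e (j - Suc m)) < u" by blast
    have "(\<lambda>j. if j < m then b j else case_nat (b m) e (j - m))
        = (\<lambda>j. if j < Suc m then b j else e (j - Suc m))"
    proof
      fix j
      show "(if j < m then b j else case_nat (b m) e (j - m))
        = (if j < Suc m then b j else e (j - Suc m))"
        by (cases "j - m") (auto simp: less_Suc_eq diff_Suc)
    qed
    then show "\<exists>x\<in>universe S. \<exists>b. range b \<subseteq> universe S \<and>
      eval S \<phi> (\<lambda>j. if j < m then b j else case_nat x e (j - m)) < u"
      using b by (intro bexI[of _ "b m"] exI[of _ b]) (simp_all add: image_subset_iff)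
  qed
  finally show ?case .
qed

text \<open>Meant for use under \<open>m\<close> quantifiers, where \<open>m + i\<close> is the
  outer variable \<open>i\<close> and \<open>i\<close> a bound one: it is the distance between an
  outer and an inner \<open>n\<close>-tuple. The maximum over no coordinates is the constant 0,
  available as \<open>Scale 0 One\<close>.\<close>

primrec dist_fm :: "nat \<Rightarrow> nat \<Rightarrow> fm" where
  "dist_fm m 0 = Scale 0 One"
| "dist_fm m (Suc n) = MaxF (dist_fm m n) (Pred 0 [m + n, n])"

lemma fv_dist_fm: "fv (dist_fm m n) \<subseteq> {..<m + n}"
proof (induction n)
  case (Suc n)
  have "{..<m + n} \<subseteq> {..<m + Suc n}" by auto
  then show ?case using Suc by (simp add: order_trans)
qed simp

lemma eval_dist_fm_less:
  "eval S (dist_fm m n) e < u \<longleftrightarrow> 0 < u \<and> (\<forall>i<n. interp S 0 [e (m + i), e i] < u)"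
  by (induction n) (auto simp: less_Suc_eq)

text \<open>The coordinate 0 stands for an argument of the metric that is held fixed. The sum
  dominates the movement of the maximum of \<open>n\<close> distances to fixed points, and it
  depends only on the signature and the length of the tuple, so it can serve all Borel sets at
  once.\<close>

definition base_modulus :: "signature \<Rightarrow> nat \<Rightarrow> (nat \<Rightarrow> real) \<Rightarrow> real" where
  "base_modulus L n \<delta> = (\<Sum>i<n. modulus L 0 (\<lambda>j. if j = 0 then \<delta> i else 0))"

lemma modulus_metric: "is_signature L \<Longrightarrow> is_modulus {..<2} (modulus L 0)"
  unfolding is_signature_def by auto

lemma is_modulus_base_modulus:
  assumes L: "is_signature L"
  shows "is_modulus {..<n} (base_modulus L n)"
proof (induction n)
  case 0
  show ?case by (simp add: base_modulus_def[abs_def] is_modulus_const_0)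
next
  case (Suc n)
  have "is_modulus {n} (\<lambda>\<delta>. modulus L 0 (\<lambda>j. case (if j = 0 then Some n else None) of None \<Rightarrow> 0 | Some j \<Rightarrow> \<delta> j))"
    by (rule is_modulus_reindex[OF modulus_metric[OF L]]) auto
  moreover have "(\<lambda>j. case (if j = 0 then Some n else None) of None \<Rightarrow> 0 | Some j \<Rightarrow> \<delta> j)
      = (\<lambda>j. if j = (0::nat) then \<delta> n else 0)" for \<delta> :: "nat \<Rightarrow> real"
    by auto
  ultimately have "is_modulus {n} (\<lambda>\<delta>. modulus L 0 (\<lambda>j. if j = 0 then \<delta> n else 0))" by simp
  then have "is_modulus {..<Suc n} (\<lambda>\<delta>. base_modulus L n \<delta> + modulus L 0 (\<lambda>j. if j = 0 then \<delta> n else 0))"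
    by (intro is_modulus_add is_modulus_superset[OF Suc] is_modulus_superset[of "{n}" _ "{..<Suc n}"])
      simp_all
  then show ?case by (simp add: base_modulus_def[abs_def])
qed

text \<open>Quantifying over the variables below \<open>m\<close> sets their coordinates to \<open>0\<close> in the modulus.\<close>

lemma formula_dist_fm:
  assumes L: "is_signature L" and c: "0 \<le> c" "bound L 0 \<subseteq> {..c}" and mn: "n \<le> m"
  shows "\<exists>\<Delta>. formula L (dist_fm m n) \<Delta> {0..c} \<and>
    (\<forall>\<delta>. (\<forall>i. 0 \<le> \<delta> i) \<longrightarrow> \<Delta> (\<lambda>j. if j < m then 0 else \<delta> (j - m)) \<le> base_modulus L n \<delta>)"
  using mn
proof (induction n)
  case 0
  have "formula L (Scale 0 One) (\<lambda>\<delta>. \<bar>of_rat 0\<bar> * 0) ((\<lambda>x. of_rat 0 * x) ` {1})"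
    by (intro formula.scale formula.one)
  then have "formula L (Scale 0 One) (\<lambda>_. 0) {0..c}"
    by (rule formula.weaken[OF _ is_modulus_const_0[of "{}"]]) (use c in auto)
  then show ?case by (auto simp: base_modulus_def)
next
  case (Suc n)
  then obtain \<Delta> where \<Delta>: "formula L (dist_fm m n) \<Delta> {0..c}"
    "\<And>\<delta>. (\<And>i. 0 \<le> \<delta> i) \<Longrightarrow> \<Delta> (\<lambda>j. if j < m then 0 else \<delta> (j - m)) \<le> base_modulus L n \<delta>" by auto
  let ?\<Delta>' = "\<lambda>\<delta>. modulus L 0 (\<lambda>i. \<delta> ([m + n, n] ! i))"
  have P: "formula L (Pred 0 [m + n, n]) ?\<Delta>' (bound L 0)"
    using L by (intro formula.atomic) (auto simp: is_signature_def)
  note F = formula.maxf[OF \<Delta>(1) P]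
  obtain V where V: "is_modulus V (\<lambda>\<delta>. max (\<Delta> \<delta>) (?\<Delta>' \<delta>))" using formula_modulus[OF L F] by blast
  \<comment> \<open>\<open>bound L 0\<close> may contain negative reals; the maximum with a value in
    \<open>{0..c}\<close> removes them.\<close>
  have "{max x y |x y. x \<in> {0..c} \<and> y \<in> bound L 0} \<subseteq> {0..c}" using c by fastforce
  from formula.weaken[OF F V order_refl this]
  have F': "formula L (dist_fm m (Suc n)) (\<lambda>\<delta>. max (\<Delta> \<delta>) (?\<Delta>' \<delta>)) {0..c}" by simp
  have "max (\<Delta> (\<lambda>j. if j < m then 0 else \<delta> (j - m))) (?\<Delta>' (\<lambda>j. if j < m then 0 else \<delta> (j - m)))
      \<le> base_modulus L (Suc n) \<delta>" if \<delta>: "\<forall>i. 0 \<le> \<delta> i" for \<delta>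
  proof -
    have "?\<Delta>' (\<lambda>j. if j < m then 0 else \<delta> (j - m)) = modulus L 0 (\<lambda>j. if j = 0 then \<delta> n else 0)"
      using Suc.prems \<delta> by (intro is_modulus_cong[OF modulus_metric[OF L]]) (auto simp: less_2_cases_iff)
    moreover have "0 \<le> base_modulus L n \<delta>" "0 \<le> modulus L 0 (\<lambda>j. if j = 0 then \<delta> n else 0)"
      using \<delta> by (auto intro!: is_modulus_nonneg[OF is_modulus_base_modulus[OF L]]
          is_modulus_nonneg[OF modulus_metric[OF L]])
    ultimately show ?thesis using \<Delta>(2)[of \<delta>] \<delta> by (simp add: base_modulus_def)
  qed
  then show ?case using F' by blast
qed

text \<open>The invariant of the construction: modulus and bound are prescribed by \<open>L\<close>,
  \<open>c\<close> and \<open>n\<close>, so any sequence of such formulas has an infimum that is a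
  formula and satisfies the invariant again.\<close>

definition controlled :: "signature \<Rightarrow> real \<Rightarrow> nat \<Rightarrow> fm \<Rightarrow> bool" where
  "controlled L c n \<phi> \<longleftrightarrow> formula L \<phi> (base_modulus L n) {0..c} \<and> fv \<phi> \<subseteq> {..<n}"

text \<open>With \<open>N\<close> large, \<open>1 - N * g\<close> is nonpositive where \<open>g > 0\<close> and at least \<open>1\<close> where \<open>g = 0\<close>. The
  factor \<open>N\<close> disappears from the modulus because \<open>g\<close> mentions only quantified variables, so that
  the members of the infimum have a common modulus and bound.\<close>

definition exists_near :: "nat \<Rightarrow> nat \<Rightarrow> fm \<Rightarrow> fm" where
  "exists_near n m g =
     CInf (\<lambda>N. (InfQ ^^ m) (MaxF (dist_fm m n) (Add One (Scale (- of_nat N) g))))"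

lemma exists_near_component:
  assumes L: "is_signature L" and c: "1 \<le> c" "bound L 0 \<subseteq> {..c}" and mn: "n \<le> m"
    and g: "formula L g \<Delta> K" "is_modulus {..<m} \<Delta>" "K \<subseteq> {0..}" "fv g \<subseteq> {..<m}"
  shows "\<exists>\<Delta>. formula L (MaxF (dist_fm m n) (Add One (Scale (- of_nat N) g))) \<Delta> {0..c}"
    and "controlled L c n ((InfQ ^^ m) (MaxF (dist_fm m n) (Add One (Scale (- of_nat N) g))))"
proof -
  let ?A = "Add One (Scale (- of_nat N) g)"
  obtain \<Delta>d where d: "formula L (dist_fm m n) \<Delta>d {0..c}"
    "\<And>\<delta>. (\<And>i. 0 \<le> \<delta> i) \<Longrightarrow> \<Delta>d (\<lambda>j. if j < m then 0 else \<delta> (j - m)) \<le> base_modulus L n \<delta>"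
    using formula_dist_fm[OF L _ c(2) mn] c(1) by auto
  let ?\<Delta>a = "\<lambda>\<delta>. 0 + \<bar>of_rat (- of_nat N)\<bar> * \<Delta> \<delta>"
  let ?\<Delta>m = "\<lambda>\<delta>. max (\<Delta>d \<delta>) (?\<Delta>a \<delta>)"
  note F = formula.maxf[OF d(1) formula.add[OF formula.one formula.scale[OF g(1), of "- of_nat N"]]]
  obtain V where V: "is_modulus V ?\<Delta>m" using formula_modulus[OF L F] by blast
  \<comment> \<open>The values \<open>1 - N * k\<close> may be very negative, but their maximum with
    a distance is not. From above they are bounded by 1, whence \<open>1 \<le> c\<close>.\<close>
  have "max x y \<in> {0..c}"
    if x: "x \<in> {0..c}" and y: "y \<in> {x + y |x y. x \<in> {1} \<and> y \<in> (\<lambda>x. of_rat (- of_nat N) * x) ` K}" for x y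
  proof -
    obtain k where "k \<in> K" "y = 1 + of_rat (- of_nat N) * k" using y by blast
    then have "y \<le> 1" using g(3) by (auto simp: of_rat_minus)
    then show ?thesis using x c(1) by auto
  qed
  then have sub: "{max x y |x y. x \<in> {0..c} \<and>
      y \<in> {x + y |x y. x \<in> {1} \<and> y \<in> (\<lambda>x. of_rat (- of_nat N) * x) ` K}} \<subseteq> {0..c}"
    by blast
  have F': "formula L (MaxF (dist_fm m n) ?A) ?\<Delta>m {0..c}"
    by (rule formula.weaken[OF F V order_refl sub]) simp
  then show "\<exists>\<Delta>. formula L (MaxF (dist_fm m n) ?A) \<Delta> {0..c}" by blast
  have le: "?\<Delta>m (\<lambda>j. if j < m then 0 else \<delta> (j - m)) \<le> base_modulus L n \<delta>" if "\<And>i. 0 \<le> \<delta> i" for \<delta>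
  proof -
    have "\<Delta> (\<lambda>j. if j < m then 0 else \<delta> (j - m)) = 0" by (rule is_modulus_zero[OF g(2)]) simp
    moreover have "0 \<le> base_modulus L n \<delta>"
      using that by (intro is_modulus_nonneg[OF is_modulus_base_modulus[OF L]])
    ultimately show ?thesis using d(2)[OF that] by simp
  qed
  have "formula L ((InfQ ^^ m) (MaxF (dist_fm m n) ?A)) (base_modulus L n) {0..c}"
    by (rule formula.weaken[OF InfQ_iter_formula[OF F'] is_modulus_base_modulus[OF L] le order_refl]) auto
  moreover have "fv ((InfQ ^^ m) (MaxF (dist_fm m n) ?A)) \<subseteq> {..<n}"
    using g(4) fv_dist_fm[of m n] by (auto simp: fv_InfQ_iter dest!: subsetD)
  ultimately show "controlled L c n ((InfQ ^^ m) (MaxF (dist_fm m n) ?A))"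
    unfolding controlled_def by blast
qed

lemma controlled_CInf:
  assumes "\<And>i. controlled L c n (f i)"
  shows "controlled L c n (CInf f)"
  using assms unfolding controlled_def by (auto intro!: formula.cinf[of _ _ _ _ "{..<n}"])

lemma controlled_exists_near:
  assumes "is_signature L" "1 \<le> c" "bound L 0 \<subseteq> {..c}" "n \<le> m"
    and "formula L g \<Delta> K" "is_modulus {..<m} \<Delta>" "K \<subseteq> {0..}" "fv g \<subseteq> {..<m}"
  shows "controlled L c n (exists_near n m g)"
  unfolding exists_near_def by (intro controlled_CInf exists_near_component(2)[OF assms])

lemma eval_CInf_less:
  assumes L: "is_signature L" and S: "is_structure L S" and ne: "universe S \<noteq> {}"
    and \<phi>: "\<And>i. controlled L c n (f i)" and e: "range e \<subseteq> universe S"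
  shows "eval S (CInf f) e < u \<longleftrightarrow> (\<exists>i. eval S (f i) e < u)"
proof -
  have "formula L (f i) (base_modulus L n) {0..c}" for i using \<phi> unfolding controlled_def by blast
  then have "eval S (f i) e \<in> {0..c}" for i by (rule eval_in_bound[OF L S ne _ e])
  then have "bdd_below (range (\<lambda>i. eval S (f i) e))" by (intro bdd_belowI2[of _ 0]) auto
  then show ?thesis by (simp add: cINF_less_iff)
qed

text \<open>The bound \<open>u \<le> 1\<close> makes the value 1 signal failure, which is what
  happens for every \<open>N\<close> where \<open>g\<close> vanishes. Only the first
  \<open>n\<close> of the \<open>m\<close> bound variables are compared with \<open>e\<close>, so
  the tuple sought may be longer than the given one.\<close>

lemma eval_exists_near_less:
  assumes L: "is_signature L" and S: "is_structure L S" and ne: "universe S \<noteq> {}"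
    and c: "1 \<le> c" "bound L 0 \<subseteq> {..c}" and mn: "n \<le> m"
    and g: "formula L g \<Delta> K" "is_modulus {..<m} \<Delta>" "K \<subseteq> {0..}" "fv g \<subseteq> {..<m}"
    and e: "range e \<subseteq> universe S" and u: "0 < u" "u \<le> 1"
  shows "eval S (exists_near n m g) e < u \<longleftrightarrow>
    (\<exists>b. range b \<subseteq> universe S \<and> 0 < eval S g b \<and> (\<forall>i<n. mdst S (b i) (e i) < u))"
proof -
  let ?M = "\<lambda>N. MaxF (dist_fm m n) (Add One (Scale (- of_nat N) g))"
  let ?e = "\<lambda>b j. if j < m then b j else e (j - m)"
  interpret Metric_space "universe S" "mdst S" by (rule is_structure_Metric_space[OF S])
  have "eval S (exists_near n m g) e < u \<longleftrightarrow> (\<exists>N. eval S ((InfQ ^^ m) (?M N)) e < u)"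
    unfolding exists_near_def
    by (rule eval_CInf_less[OF L S ne exists_near_component(2)[OF L c mn g] e])
  also have "\<dots> \<longleftrightarrow> (\<exists>N b. range b \<subseteq> universe S \<and> eval S (?M N) (?e b) < u)"
  proof -
    have "eval S ((InfQ ^^ m) (?M N)) e < u \<longleftrightarrow>
        (\<exists>b. range b \<subseteq> universe S \<and> eval S (?M N) (?e b) < u)" for N
      using exists_near_component(1)[OF L c mn g, of N] eval_InfQ_iter_less[OF L S ne _ e] by blast
    then show ?thesis by blast
  qed
  also have "\<dots> \<longleftrightarrow> (\<exists>b. range b \<subseteq> universe S \<and> (\<exists>N. eval S (?M N) (?e b) < u))" by blast
  also have "\<dots> \<longleftrightarrow>
    (\<exists>b. range b \<subseteq> universe S \<and> 0 < eval S g b \<and> (\<forall>i<n. mdst S (b i) (e i) < u))"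
  proof (intro ex_cong1 conj_cong refl)
    fix b :: "nat \<Rightarrow> 'a" assume b: "range b \<subseteq> universe S"
    have "eval S g (?e b) = eval S g b" using g(4) by (intro eval_cong) auto
    then have "eval S (?M N) (?e b) < u \<longleftrightarrow>
        (\<forall>i<n. interp S 0 [e i, b i] < u) \<and> 1 - real N * eval S g b < u" for N
      using mn u(1) by (auto simp: eval_dist_fm_less of_rat_minus)
    moreover have "interp S 0 [e i, b i] = mdst S (b i) (e i)" for i
      using b e commute[of "b i" "e i"] by (simp add: mdst_def image_subset_iff)
    ultimately have "(\<exists>N. eval S (?M N) (?e b) < u) \<longleftrightarrow>
        (\<forall>i<n. mdst S (b i) (e i) < u) \<and> (\<exists>N. 1 - real N * eval S g b < u)" by simp
    also have "(\<exists>N. 1 - real N * eval S g b < u) \<longleftrightarrow> 0 < eval S g b"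
    proof
      assume "\<exists>N. 1 - real N * eval S g b < u"
      then obtain N where "1 - real N * eval S g b < u" by blast
      then have "0 < real N * eval S g b" using u(2) by linarith
      then show "0 < eval S g b" by (simp add: zero_less_mult_iff)
    next
      assume g0: "0 < eval S g b"
      obtain N where "1 / eval S g b < real N" using reals_Archimedean2 by blast
      then have "1 < real N * eval S g b" using g0 by (simp add: divide_simps)
      then show "\<exists>N. 1 - real N * eval S g b < u" using u(1) by (intro exI[of _ N]) linarith
    qed
    finally show "(\<exists>N. eval S (?M N) (?e b) < u) \<longleftrightarrow>
        0 < eval S g b \<and> (\<forall>i<n. mdst S (b i) (e i) < u)" by blast
  qed
  finally show ?thesis .
qed

section \<open>The space of tail-dense sequences\<close>

text \<open>The centre is a whole sequence of which only the first \<open>n\<close> terms count, so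
  that it can be an assignment for \<open>eval\<close>.\<close>

definition tuple_ball :: "'m mstruct \<Rightarrow> nat \<Rightarrow> (nat \<Rightarrow> 'm) \<Rightarrow> real \<Rightarrow> (nat \<Rightarrow> 'm) set" where
  "tuple_ball S n e u = {y \<in> tail_dense S. \<forall>i<n. mdst S (y i) (e i) < u}"

locale separable_structure =
  fixes L :: signature and S :: "'m mstruct" and z :: "nat \<Rightarrow> 'm"
  assumes L: "is_signature L" and S: "is_structure L S" and z: "z \<in> tail_dense S"
begin

sublocale Metric_space "universe S" "mdst S"
  by (rule is_structure_Metric_space[OF S])

lemma universe_ne: "universe S \<noteq> {}"
  using tail_dense_range[OF z] by blast

lemma topspace_tail_dense [simp]: "topspace (tail_dense_topology S) = tail_dense S"
  unfolding tail_dense_topology_def using tail_dense_range by (auto simp: PiE_def)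

lemma tail_denseI:
  assumes "range y \<subseteq> universe S" "\<And>x r n. x \<in> universe S \<Longrightarrow> 0 < r \<Longrightarrow> \<exists>k\<ge>n. mdst S x (y k) < r"
  shows "y \<in> tail_dense S"
proof -
  have "x \<in> mtopology closure_of (y ` {n..})" if x: "x \<in> universe S" for x n
    unfolding metric_closure_of
  proof (intro CollectI conjI allI impI)
    fix r :: real assume "0 < r"
    then obtain k where "k \<ge> n" "mdst S x (y k) < r" using assms(2)[OF x] by blast
    then show "\<exists>w\<in>y ` {n..}. w \<in> mball x r" using assms(1) x by (intro bexI[of _ "y k"]) auto
  qed (rule x)
  moreover have "mtopology closure_of (y ` {n..}) \<subseteq> universe S" for n
    using closure_of_subset_topspace[of mtopology "y ` {n..}"] by simp
  ultimately show ?thesis unfolding tail_dense_def using assms(1) by blast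
qed

text \<open>Density of the tails does not notice finitely many alterations. This is what tail
  density gains over density: every finite tuple of points can be completed to a member of the
  space.\<close>

lemma tail_dense_modify:
  assumes b: "range b \<subseteq> universe S"
  shows "(\<lambda>i. if i < n then b i else z i) \<in> tail_dense S"
proof (rule tail_denseI)
  show "range (\<lambda>i. if i < n then b i else z i) \<subseteq> universe S"
    using b tail_dense_range[OF z] by auto
  fix x r and k :: nat assume "x \<in> universe S" "0 < (r::real)"
  then obtain i where "i \<ge> max k n" "mdst S x (z i) < r" using tail_dense_near[OF S z] by blast
  then show "\<exists>i\<ge>k. mdst S x (if i < n then b i else z i) < r" by (intro exI[of _ i]) auto
qed

lemma openin_tuple_ball:
  assumes e: "range e \<subseteq> universe S"
  shows "openin (tail_dense_topology S) (tuple_ball S n e u)"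
proof (induction n)
  case 0
  show ?case using openin_topspace[of "tail_dense_topology S"] by (simp add: tuple_ball_def)
next
  case (Suc n)
  let ?P = "product_topology (\<lambda>_::nat. mtopology) UNIV"
  have "openin ?P {y \<in> topspace ?P. y n \<in> mball (e n) u}"
    by (rule openin_continuous_map_preimage[OF continuous_map_product_projection]) auto
  then have "openin (tail_dense_topology S) ({y \<in> topspace ?P. y n \<in> mball (e n) u} \<inter> tail_dense S)"
    unfolding tail_dense_topology_def by (rule openin_subtopology_Int)
  with Suc have "openin (tail_dense_topology S)
      (tuple_ball S n e u \<inter> ({y \<in> topspace ?P. y n \<in> mball (e n) u} \<inter> tail_dense S))"
    by (rule openin_Int)
  moreover have "tuple_ball S n e u \<inter> ({y \<in> topspace ?P. y n \<in> mball (e n) u} \<inter> tail_dense S)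
      = tuple_ball S (Suc n) e u"
    using e tail_dense_range by (auto simp: tuple_ball_def less_Suc_eq commute image_subset_iff)
  ultimately show ?case by simp
qed

lemma tuple_ball_ne:
  assumes e: "range e \<subseteq> universe S" and u: "0 < u"
  shows "tuple_ball S n e u \<noteq> {}"
proof -
  have "mdst S (e i) (e i) < u" for i using e u structure_mdst_self[OF S] by (simp add: image_subset_iff)
  then have "(\<lambda>i. if i < n then e i else z i) \<in> tuple_ball S n e u"
    unfolding tuple_ball_def using tail_dense_modify[OF e] by simp
  then show ?thesis by blast
qed

lemma tuple_ball_subset:
  assumes "n \<le> m" "range b \<subseteq> universe S" "range e \<subseteq> universe S"
    and "\<And>i. i < n \<Longrightarrow> mdst S (b i) (e i) + v \<le> u"
  shows "tuple_ball S m b v \<subseteq> tuple_ball S n e u"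
proof
  fix y assume y: "y \<in> tuple_ball S m b v"
  have "mdst S (y i) (e i) < u" if "i < n" for i
  proof -
    have "mdst S (y i) (e i) \<le> mdst S (y i) (b i) + mdst S (b i) (e i)"
      using y assms tail_dense_range by (intro triangle) (auto simp: tuple_ball_def)
    moreover have "mdst S (y i) (b i) < v" using y that assms(1) by (auto simp: tuple_ball_def)
    ultimately show ?thesis using assms(4)[OF that] by linarith
  qed
  then show "y \<in> tuple_ball S n e u" using y by (auto simp: tuple_ball_def)
qed

text \<open>Basic open sets of the product restrict finitely many coordinates; \<open>m\<close> is
  taken beyond them and \<open>v\<close> below their radii. Lengthening the tuple only shrinks the
  ball, so \<open>n \<le> m\<close> can be demanded, and \<open>v \<le> 1\<close> keeps the radius
  in the range where forcing formulas are specified.\<close>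

lemma open_contains_tuple_ball:
  assumes W: "openin (tail_dense_topology S) W" and y: "y \<in> W"
  obtains m v where "n \<le> m" "0 < v" "v \<le> 1" "tuple_ball S m y v \<subseteq> W"
proof -
  let ?P = "product_topology (\<lambda>_::nat. mtopology) UNIV"
  obtain V where V: "openin ?P V" "W = V \<inter> tail_dense S"
    using W unfolding tail_dense_topology_def openin_subtopology by blast
  then obtain X where X: "y \<in> Pi\<^sub>E UNIV X" "\<And>i. openin mtopology (X i)"
    "finite {i. X i \<noteq> topspace mtopology}" "Pi\<^sub>E UNIV X \<subseteq> V"
    using product_topology_open_contains_basis[OF V(1), of y] y by auto
  have "\<exists>r>0. mball (y i) r \<subseteq> X i" for i
    using X(1) X(2)[of i] unfolding openin_mtopology by blast
  then obtain r where r: "\<And>i. r i > 0" "\<And>i. mball (y i) (r i) \<subseteq> X i" by metis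
  let ?J = "{i. X i \<noteq> topspace mtopology}"
  define v where "v = Min (insert 1 (r ` ?J))"
  obtain m where m: "?J \<subseteq> {..<m}" using X(3) finite_nat_iff_bounded by blast
  have v: "0 < v" "v \<le> 1" "\<And>i. i \<in> ?J \<Longrightarrow> v \<le> r i"
    unfolding v_def using X(3) r(1) by auto
  have "tuple_ball S (max n m) y v \<subseteq> W"
  proof
    fix x assume x: "x \<in> tuple_ball S (max n m) y v"
    have "x i \<in> X i" for i
    proof (cases "i \<in> ?J")
      case True
      have "i < max n m" using True m by auto
      then have "mdst S (x i) (y i) < v" using x by (simp add: tuple_ball_def)
      then have "mdst S (x i) (y i) < r i" using v(3)[OF True] by linarith
      then have "x i \<in> mball (y i) (r i)"
        using x y V tail_dense_range by (auto simp: tuple_ball_def commute)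
      then show ?thesis using r(2) by blast
    next
      case False
      then show ?thesis using x tail_dense_range by (auto simp: tuple_ball_def)
    qed
    then show "x \<in> W" using X(4) V(2) x by (auto simp: tuple_ball_def)
  qed
  then show ?thesis using that[of "max n m" v] v by simp
qed

text \<open>Tail density is a G_delta condition in the product: it suffices that the balls of radius
  \<open>1 / real (Suc q)\<close> around the points \<open>z k\<close> contain terms of arbitrarily
  large index, and this is a countable family of open conditions.\<close>

lemma completely_metrizable_tail_dense: "completely_metrizable_space (tail_dense_topology S)"
proof -
  let ?P = "product_topology (\<lambda>_::nat. mtopology) UNIV"
  define G where "G = (\<lambda>(n::nat, k, q). {y \<in> topspace ?P. \<exists>i\<ge>n. y i \<in> mball (z k) (1 / real (Suc q))})"
  have "completely_metrizable_space mtopology"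
    using S completely_metrizable_space_mtopology unfolding is_structure_def by blast
  then have P: "completely_metrizable_space ?P"
    unfolding completely_metrizable_space_product_topology
    by (intro disjI2 conjI ballI) simp_all
  have op: "openin ?P (G p)" for p
  proof -
    obtain n k q where p: "p = (n, k, q)" by (cases p)
    have "openin ?P {y \<in> topspace ?P. y i \<in> mball (z k) (1 / real (Suc q))}" for i
      by (rule openin_continuous_map_preimage[OF continuous_map_product_projection]) auto
    then have "openin ?P (\<Union>i\<in>{n..}. {y \<in> topspace ?P. y i \<in> mball (z k) (1 / real (Suc q))})"
      by blast
    moreover have "(\<Union>i\<in>{n..}. {y \<in> topspace ?P. y i \<in> mball (z k) (1 / real (Suc q))}) = G p"
      unfolding G_def p by auto
    ultimately show ?thesis by simp
  qed
  have "gdelta_in ?P (\<Inter>(range G))"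
    by (rule gdelta_in_Inter) (use op in \<open>auto intro: open_imp_gdelta_in\<close>)
  also have "\<Inter>(range G) = tail_dense S"
  proof (intro equalityI subsetI)
    fix y assume y: "y \<in> tail_dense S"
    have "y \<in> G p" for p
    proof -
      obtain n k q where p: "p = (n, k, q)" by (cases p)
      obtain i where "i \<ge> n" "mdst S (z k) (y i) < 1 / real (Suc q)"
        using tail_dense_near[OF S y tail_dense_range[OF z, of k], of "1 / real (Suc q)" n] by auto
      then show ?thesis using tail_dense_range[OF y] tail_dense_range[OF z] unfolding G_def p by auto
    qed
    then show "y \<in> \<Inter>(range G)" by blast
  next
    fix y assume "y \<in> \<Inter>(range G)"
    then have y: "y \<in> G p" for p by blast
    have "y \<in> topspace ?P" using y[of "(0, 0, 0)"] unfolding G_def by simp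
    then have ry: "range y \<subseteq> universe S" by auto
    show "y \<in> tail_dense S"
    proof (rule tail_denseI[OF ry])
      fix x r and n :: nat assume x: "x \<in> universe S" "0 < (r::real)"
      obtain k where k: "mdst S x (z k) < r / 2" using tail_dense_near[OF S z x(1), of "r / 2"] x(2) by auto
      obtain q where q: "1 / real (Suc q) < r / 2" using x(2) nat_approx_posE half_gt_zero by metis
      obtain i where i: "i \<ge> n" "mdst S (z k) (y i) < 1 / real (Suc q)"
        using y[of "(n, k, q)"] by (auto simp: G_def)
      have "mdst S x (y i) \<le> mdst S x (z k) + mdst S (z k) (y i)"
        using x(1) ry tail_dense_range[OF z] by (intro triangle) auto
      then show "\<exists>i\<ge>n. mdst S x (y i) < r" using i k q by (intro exI[of _ i]) auto
    qed
  qed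
  finally show ?thesis
    unfolding tail_dense_topology_def by (rule completely_metrizable_space_gdelta_in[OF P])
qed

lemma not_meager_tail_dense:
  "openin (tail_dense_topology S) W \<Longrightarrow> W \<noteq> {} \<Longrightarrow> \<not> meager_in (tail_dense_topology S) W"
  by (rule not_meager_in_open[OF completely_metrizable_tail_dense])

text \<open>The modulus depends on finitely many coordinates, so a small tuple ball controls the
  change of the value.\<close>

lemma openin_eval_less:
  assumes \<phi>: "formula L \<phi> \<Delta> K"
  shows "openin (tail_dense_topology S) {y \<in> tail_dense S. eval S \<phi> y < u}"
proof -
  obtain V where V: "is_modulus V \<Delta>" using formula_modulus[OF L \<phi>] by blast
  obtain m where m: "V \<subseteq> {..<m}" using is_modulus_finite[OF V] finite_nat_iff_bounded by blast
  have "\<exists>T. openin (tail_dense_topology S) T \<and> y \<in> T \<and> T \<subseteq> {y \<in> tail_dense S. eval S \<phi> y < u}"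
    if y: "y \<in> tail_dense S" "eval S \<phi> y < u" for y
  proof -
    \<comment> \<open>On the diagonal the modulus is a function of one real. By monotonicity its
      value at the constant \<open>t\<close> dominates all perturbations of size at most
      \<open>t\<close>.\<close>
    have "continuous_on {0..} (\<lambda>(t::real) (i::nat). t)"
      by (intro continuous_on_coordinatewise_then_product continuous_intros)
    then have "continuous_on {0..} (\<lambda>t. \<Delta> (\<lambda>_. t))"
      by (rule continuous_on_compose2[OF is_modulus_continuous[OF V]]) auto
    moreover have "\<Delta> (\<lambda>_. 0) = 0" by (rule is_modulus_zero[OF V]) simp
    moreover have "0 < u - eval S \<phi> y" using y by simp
    ultimately have "\<exists>\<delta>>0. \<forall>t. 0 \<le> t \<and> t < \<delta> \<longrightarrow> \<bar>\<Delta> (\<lambda>_. t)\<bar> < u - eval S \<phi> y"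
      by (rule small_near_zero)
    then obtain \<delta> where \<delta>: "\<delta> > 0" "\<And>t. 0 \<le> t \<Longrightarrow> t < \<delta> \<Longrightarrow> \<bar>\<Delta> (\<lambda>_. t)\<bar> < u - eval S \<phi> y"
      by blast
    have ry: "range y \<subseteq> universe S" using tail_dense_range[OF y(1)] by blast
    have "eval S \<phi> x < u" if x: "x \<in> tuple_ball S m y (\<delta> / 2)" for x
    proof -
      have rx: "range x \<subseteq> universe S" using x tail_dense_range by (auto simp: tuple_ball_def)
      have "eval S \<phi> x - eval S \<phi> y \<le> \<Delta> (\<lambda>i. mdst S (x i) (y i))"
        using eval_modulus[OF L S universe_ne \<phi> rx ry] by linarith
      also have "\<dots> \<le> \<Delta> (\<lambda>_. \<delta> / 2)"
        using x m by (intro is_modulus_mono[OF V]) (auto simp: tuple_ball_def less_imp_le)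
      also have "\<dots> < u - eval S \<phi> y" using \<delta>(2)[of "\<delta> / 2"] \<delta>(1) by simp
      finally show ?thesis by simp
    qed
    then have "tuple_ball S m y (\<delta> / 2) \<subseteq> {y \<in> tail_dense S. eval S \<phi> y < u}"
      by (auto simp: tuple_ball_def)
    moreover have "y \<in> tuple_ball S m y (\<delta> / 2)"
      using y(1) \<delta>(1) structure_mdst_self[OF S] tail_dense_range[OF y(1)] by (simp add: tuple_ball_def)
    ultimately show ?thesis using openin_tuple_ball[OF ry] by blast
  qed
  then show ?thesis by (subst openin_subopen) blast
qed

end

section \<open>Borel sets of codes\<close>

definition code_interval :: "signature \<Rightarrow> nat \<times> nat list \<Rightarrow> rat \<Rightarrow> rat \<Rightarrow> code set" where
  "code_interval L p q r = {c \<in> Mod L. of_rat q < c p \<and> c p < of_rat r}"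

lemma topspace_Mod_topology [simp]: "topspace (Mod_topology L) = Mod L"
  unfolding Mod_topology_def Mod_def code_of_def by (auto simp: restrict_PiE_iff)

text \<open>An open set is the union of the rational boxes that it contains, and there are countably
  many boxes. Induction over Borel sets thus starts from conditions on a single predicate
  value.\<close>

lemma borel_Mod:
  "borel_sets_of (Mod_topology L)
    \<subseteq> sigma_sets (Mod L) {code_interval L p q r | p q r. p \<in> code_index L}"
proof -
  let ?G = "{code_interval L p q r | p q r. p \<in> code_index L}"
  interpret sigma_algebra "Mod L" "sigma_sets (Mod L) ?G"
    by (rule sigma_algebra_sigma_sets) (auto simp: code_interval_def)
  \<comment> \<open>The leading \<open>Mod L\<close> makes the empty list describe the whole
    space.\<close>
  define box where "box l = Mod L \<inter> (\<Inter>(p, q, r)\<in>set l. code_interval L p q r)" for l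
  have box: "box l \<in> sigma_sets (Mod L) ?G" if "fst ` set l \<subseteq> code_index L" for l
    using that
  proof (induction l)
    case Nil
    then show ?case by (simp add: box_def sigma_sets_top)
  next
    case (Cons x l)
    obtain p q r where x: "x = (p, q, r)" by (cases x)
    have "p \<in> code_index L" using Cons.prems x by simp
    then have "code_interval L p q r \<in> sigma_sets (Mod L) ?G"
      by (intro sigma_sets.Basic CollectI exI conjI) (rule refl)
    moreover have "box (x # l) = code_interval L p q r \<inter> box l"
      unfolding box_def x by (auto simp: code_interval_def)
    moreover have "box l \<in> sigma_sets (Mod L) ?G" using Cons by simp
    ultimately show ?case using Int[of "code_interval L p q r" "box l"] by simp
  qed
  have "U \<in> sigma_sets (Mod L) ?G" if U: "openin (Mod_topology L) U" for U
  proof -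
    let ?P = "product_topology (\<lambda>_. euclideanreal) (code_index L)"
    obtain V where V: "openin ?P V" "U = V \<inter> Mod L"
      using U unfolding Mod_topology_def openin_subtopology by blast
    let ?B = "{box l | l. fst ` set l \<subseteq> code_index L \<and> box l \<subseteq> U}"
    have "\<exists>T\<in>?B. c \<in> T" if c: "c \<in> U" for c
    proof -
      have cM: "c \<in> Mod L" and cV: "c \<in> V" using c V by auto
      obtain X where X: "c \<in> Pi\<^sub>E (code_index L) X" "\<And>i. openin euclideanreal (X i)"
        "finite {i. X i \<noteq> topspace euclideanreal}" "Pi\<^sub>E (code_index L) X \<subseteq> V"
        using product_topology_open_contains_basis[OF V(1) cV] by auto
      have "\<exists>q r. of_rat q < c p \<and> c p < of_rat r \<and> {of_rat q<..<of_rat r} \<subseteq> X p"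
        if p: "p \<in> code_index L" for p
      proof -
        have "open (X p)" "c p \<in> X p" using X(1) X(2)[of p] p by auto
        then obtain \<epsilon> where \<epsilon>: "\<epsilon> > 0" "ball (c p) \<epsilon> \<subseteq> X p" using openE by blast
        obtain q where q: "c p - \<epsilon> < of_rat q" "of_rat q < c p"
          using of_rat_dense[of "c p - \<epsilon>" "c p"] \<epsilon>(1) by auto
        obtain r where r: "c p < of_rat r" "of_rat r < c p + \<epsilon>"
          using of_rat_dense[of "c p" "c p + \<epsilon>"] \<epsilon>(1) by auto
        have "{of_rat q<..<of_rat r} \<subseteq> ball (c p) \<epsilon>"
          using q r by (auto simp: dist_real_def)
        then show ?thesis using q r \<epsilon> by blast
      qed
      then obtain q r where qr: "\<And>p. p \<in> code_index L \<Longrightarrow>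
          of_rat (q p) < c p \<and> c p < of_rat (r p) \<and> {of_rat (q p)<..<of_rat (r p)} \<subseteq> X p"
        by metis
      obtain ps where ps: "set ps = {i. X i \<noteq> topspace euclideanreal} \<inter> code_index L"
        using X(3) finite_list by (metis finite_Int)
      let ?l = "map (\<lambda>p. (p, q p, r p)) ps"
      have "c \<in> box ?l" using qr ps cM by (auto simp: box_def code_interval_def)
      moreover have "box ?l \<subseteq> U"
      proof
        fix d assume d: "d \<in> box ?l"
        have "d \<in> Mod L" using d by (simp add: box_def)
        have "d p \<in> X p" if p: "p \<in> code_index L" for p
        proof (cases "p \<in> set ps")
          case True
          then have "of_rat (q p) < d p \<and> d p < of_rat (r p)"
            using d by (auto simp: box_def code_interval_def)
          then show ?thesis using qr[OF p] by auto
        next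
          case False
          then show ?thesis using ps p by auto
        qed
        moreover have "d \<in> extensional (code_index L)"
          using \<open>d \<in> Mod L\<close> unfolding Mod_def code_of_def by auto
        ultimately have "d \<in> V" using X(4) by (auto simp: PiE_def)
        then show "d \<in> U" using V(2) \<open>d \<in> Mod L\<close> by blast
      qed
      moreover have "fst ` set ?l \<subseteq> code_index L" using ps by auto
      ultimately show ?thesis by blast
    qed
    then have "U \<subseteq> \<Union>?B" by (meson UnionI subsetI)
    moreover have "\<Union>?B \<subseteq> U" by (rule Union_least) auto
    ultimately have "U = \<Union>?B" by (rule equalityI)
    moreover have "\<Union>?B \<in> sigma_sets (Mod L) ?G"
    proof (rule countable_Union)
      show "countable ?B"
        by (rule countable_subset[of _ "range box"]) auto
      show "?B \<subseteq> sigma_sets (Mod L) ?G"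
      proof
        fix T assume "T \<in> ?B"
        then obtain l where "T = box l" "fst ` set l \<subseteq> code_index L" by auto
        then show "T \<in> sigma_sets (Mod L) ?G" using box by simp
      qed
    qed
    ultimately show ?thesis by simp
  qed
  then show ?thesis
    unfolding borel_sets_of_def topspace_Mod_topology by (intro sigma_sets_mono) auto
qed

section \<open>Forcing formulas\<close>

definition seqs_in :: "signature \<Rightarrow> 'm mstruct \<Rightarrow> code set \<Rightarrow> (nat \<Rightarrow> 'm) set" where
  "seqs_in L S A = {y \<in> tail_dense S. code_of L S y \<in> A}"

text \<open>With \<open>v\<close> the predicate value, this is the positive part of
  \<open>min (v - q) (r - v)\<close>, the minimum being written as a negated maximum. It is
  nonnegative, as \<open>exists_near\<close> expects of its argument.\<close>

definition interval_fm :: "nat \<Rightarrow> nat list \<Rightarrow> rat \<Rightarrow> rat \<Rightarrow> fm" where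
  "interval_fm P js q r = MaxF (Scale 0 One) (Scale (-1)
     (MaxF (Add (Scale q One) (Scale (-1) (Pred P js))) (Add (Pred P js) (Scale (-r) One))))"

lemma eval_interval_fm:
  "eval S (interval_fm P js q r) e > 0 \<longleftrightarrow>
     of_rat q < interp S P (map e js) \<and> interp S P (map e js) < of_rat r"
  by (auto simp: interval_fm_def of_rat_minus)

lemma formula_interval_fm:
  assumes "is_signature L" "(P, js) \<in> code_index L"
  obtains \<Delta> K m where "formula L (interval_fm P js q r) \<Delta> K" "is_modulus {..<m} \<Delta>"
    "K \<subseteq> {0..}" "fv (interval_fm P js q r) \<subseteq> {..<m}"
proof -
  have "formula L (Pred P js) (\<lambda>\<delta>. modulus L P (\<lambda>i. \<delta> (js ! i))) (bound L P)"
    using assms by (intro formula.atomic) (auto simp: code_index_def)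
  from formula.scale[OF formula.maxf[OF
      formula.add[OF formula.scale[OF formula.one, of L q] formula.scale[OF this, of "-1"]]
      formula.add[OF this formula.scale[OF formula.one, of L "-r"]]], of "-1"]
  obtain \<Delta>1 K1 where 1: "formula L (Scale (-1)
     (MaxF (Add (Scale q One) (Scale (-1) (Pred P js))) (Add (Pred P js) (Scale (-r) One)))) \<Delta>1 K1"
    by blast
  note F = formula.maxf[OF formula.scale[OF formula.one, of L 0] 1, folded interval_fm_def]
  obtain V where V: "is_modulus V (\<lambda>\<delta>. max (\<bar>of_rat 0\<bar> * 0) (\<Delta>1 \<delta>))"
    using formula_modulus[OF assms(1) F] by blast
  obtain m where m: "V \<union> fv (interval_fm P js q r) \<subseteq> {..<m}"
    using is_modulus_finite[OF V] formula_finite_fv[OF F] finite_nat_iff_bounded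
    by (metis finite_Un)
  show ?thesis
    by (rule that[OF F is_modulus_superset[OF V, of "{..<m}"]]) (use m in auto)
qed

lemma pointed_imp_separable:
  "is_signature L \<Longrightarrow> (S, z) \<in> pointed_structures L \<Longrightarrow> separable_structure L S z"
  unfolding separable_structure_def pointed_structures_def by auto

context
  fixes L :: signature and c :: real
  assumes L: "is_signature L" and c: "1 \<le> c" "bound L 0 \<subseteq> {..c}"
begin

text \<open>Restricting the specification to \<open>0 < u \<le> 1\<close> leaves room for
  truncation. There is one formula per length \<open>n\<close>, since an assignment does not show
  how many of its values form the tuple, and \<open>e\<close> takes arbitrary values in the universe
  because the complement step evaluates \<open>g\<close> under quantifiers.\<close>

definition forces :: "(nat \<Rightarrow> fm) \<Rightarrow> code set \<Rightarrow> bool" where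
  "forces g A \<longleftrightarrow> (\<forall>n. controlled L c n (g n)) \<and>
     (\<forall>S z n e u. (S, z) \<in> pointed_structures L \<longrightarrow> range e \<subseteq> universe S \<longrightarrow> 0 < u \<longrightarrow> u \<le> 1 \<longrightarrow>
        (eval S (g n) e < u \<longleftrightarrow>
         \<not> meager_in (tail_dense_topology S) (seqs_in L S A \<inter> tuple_ball S n e u)))"

lemma forcesI:
  assumes "\<And>n. controlled L c n (g n)"
    and "\<And>S z n e u. (S, z) \<in> pointed_structures L \<Longrightarrow> range e \<subseteq> universe S \<Longrightarrow> 0 < u \<Longrightarrow> u \<le> 1 \<Longrightarrow>
        eval S (g n) e < u \<longleftrightarrow>
         \<not> meager_in (tail_dense_topology S) (seqs_in L S A \<inter> tuple_ball S n e u)"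
  shows "forces g A"
  using assms unfolding forces_def by blast

text \<open>The set is open, so by Baire category it is nonmeager in a ball exactly when it meets
  the ball. That is a question about finitely many coordinates: a sequence \<open>b\<close> found by
  the search is continued by \<open>z\<close> to a tail-dense one with the same value of the
  interval formula.\<close>

lemma forces_interval:
  assumes p: "(P, js) \<in> code_index L"
  shows "\<exists>g. forces g (code_interval L (P, js) q r)"
proof -
  let ?h = "interval_fm P js q r"
  obtain \<Delta> K m where h: "formula L ?h \<Delta> K" "is_modulus {..<m} \<Delta>" "K \<subseteq> {0..}" "fv ?h \<subseteq> {..<m}"
    using formula_interval_fm[OF L p] by metis
  have h': "formula L ?h \<Delta> K" "is_modulus {..<max n m} \<Delta>" "K \<subseteq> {0..}" "fv ?h \<subseteq> {..<max n m}" for n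
    using h(1,3,4) is_modulus_superset[OF h(2), of "{..<max n m}"] by auto
  \<comment> \<open>The quantifier block has to cover both the tuple and the variables of
    \<open>?h\<close>.\<close>
  let ?g = "\<lambda>n. exists_near n (max n m) ?h"
  have ctrl: "controlled L c n (?g n)" for n
    by (rule controlled_exists_near[OF L c _ h']) simp
  have "eval S (?g n) e < u \<longleftrightarrow> \<not> meager_in (tail_dense_topology S)
      (seqs_in L S (code_interval L (P, js) q r) \<inter> tuple_ball S n e u)"
    if Sz: "(S, z) \<in> pointed_structures L" and e: "range e \<subseteq> universe S" and u: "0 < u" "u \<le> 1"
    for S z n e u
  proof -
    interpret separable_structure L S z by (rule pointed_imp_separable[OF L Sz])
    let ?O = "{y \<in> tail_dense S. 0 < eval S ?h y}"
    have "{y \<in> tail_dense S. eval S (Scale (-1) ?h) y < 0} = ?O" by (simp add: of_rat_minus)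
    then have "openin (tail_dense_topology S) ?O"
      using openin_eval_less[OF formula.scale[OF h(1), of "-1"], of 0] by simp
    then have "openin (tail_dense_topology S) (?O \<inter> tuple_ball S n e u)"
      using openin_tuple_ball[OF e] by blast
    moreover have "seqs_in L S (code_interval L (P, js) q r) = ?O"
    proof -
      have "code_of L S y \<in> Mod L" if "y \<in> tail_dense S" for y
        using that Sz unfolding Mod_def pointed_structures_def by blast
      then show ?thesis
        using p by (auto simp: seqs_in_def code_interval_def eval_interval_fm code_of_def)
    qed
    moreover have "eval S (?g n) e < u \<longleftrightarrow> ?O \<inter> tuple_ball S n e u \<noteq> {}"
    proof -
      have "eval S (?g n) e < u \<longleftrightarrow>
          (\<exists>b. range b \<subseteq> universe S \<and> 0 < eval S ?h b \<and> (\<forall>i<n. mdst S (b i) (e i) < u))"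
        by (rule eval_exists_near_less[OF L S universe_ne c _ h' e u]) simp
      also have "\<dots> \<longleftrightarrow> ?O \<inter> tuple_ball S n e u \<noteq> {}"
      proof
        assume "\<exists>b. range b \<subseteq> universe S \<and> 0 < eval S ?h b \<and> (\<forall>i<n. mdst S (b i) (e i) < u)"
        then obtain b where b: "range b \<subseteq> universe S" "0 < eval S ?h b" "\<forall>i<n. mdst S (b i) (e i) < u"
          by blast
        let ?y = "\<lambda>i. if i < max n m then b i else z i"
        have "eval S ?h ?y = eval S ?h b" using h'(4)[of n] by (intro eval_cong) auto
        then have "?y \<in> ?O \<inter> tuple_ball S n e u"
          using b tail_dense_modify[OF b(1)] by (auto simp: tuple_ball_def)
        then show "?O \<inter> tuple_ball S n e u \<noteq> {}" by blast
      next
        assume "?O \<inter> tuple_ball S n e u \<noteq> {}"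
        then obtain y where "y \<in> ?O" "y \<in> tuple_ball S n e u" by blast
        then show "\<exists>b. range b \<subseteq> universe S \<and> 0 < eval S ?h b \<and> (\<forall>i<n. mdst S (b i) (e i) < u)"
          using tail_dense_range by (intro exI[of _ y]) (auto simp: tuple_ball_def)
      qed
      finally show ?thesis .
    qed
    ultimately show ?thesis using not_meager_tail_dense meager_in_empty by metis
  qed
  then have "forces ?g (code_interval L (P, js) q r)" by (rule forcesI[OF ctrl])
  then show ?thesis by blast
qed

text \<open>The empty set is meager in every ball, and the constant 1 lies below no
  \<open>u \<le> 1\<close>.\<close>

lemma forces_empty: "forces (\<lambda>_. One) {}"
proof -
  have "controlled L c n One" for n
    unfolding controlled_def
    using c(1) is_modulus_nonneg[OF is_modulus_base_modulus[OF L]]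
    by (auto intro!: formula.weaken[OF formula.one is_modulus_base_modulus[OF L]])
  then show ?thesis unfolding forces_def by (simp add: seqs_in_def meager_in_empty)
qed

lemma forces_UN:
  assumes "\<And>i::nat. forces (g i) (A i)"
  shows "forces (\<lambda>n. CInf (\<lambda>i. g i n)) (\<Union>i. A i)"
proof -
  have ctrl: "controlled L c n (g i n)" for i n using assms unfolding forces_def by blast
  have step: "eval S (CInf (\<lambda>i. g i n)) e < u \<longleftrightarrow> \<not> meager_in (tail_dense_topology S)
      (seqs_in L S (\<Union>i. A i) \<inter> tuple_ball S n e u)"
    if Sz: "(S, z) \<in> pointed_structures L" and e: "range e \<subseteq> universe S" and u: "0 < u" "u \<le> 1"
    for S z n e u
  proof -
    interpret separable_structure L S z by (rule pointed_imp_separable[OF L Sz])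
    let ?M = "\<lambda>i. seqs_in L S (A i) \<inter> tuple_ball S n e u"
    have "eval S (CInf (\<lambda>i. g i n)) e < u \<longleftrightarrow> (\<exists>i. eval S (g i n) e < u)"
      by (rule eval_CInf_less[OF L S universe_ne ctrl e])
    also have "\<dots> \<longleftrightarrow> (\<exists>i. \<not> meager_in (tail_dense_topology S) (?M i))"
      using assms that unfolding forces_def by blast
    also have "\<dots> \<longleftrightarrow> \<not> meager_in (tail_dense_topology S) (\<Union>i. ?M i)"
      using meager_in_UN[of "tail_dense_topology S" ?M] meager_in_subset[of "tail_dense_topology S" "\<Union>i. ?M i"]
      by blast
    also have "(\<Union>i. ?M i) = seqs_in L S (\<Union>i. A i) \<inter> tuple_ball S n e u"
      by (auto simp: seqs_in_def)
    finally show ?thesis .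
  qed
  show ?thesis by (rule forcesI[OF controlled_CInf[OF ctrl] step])
qed

lemma seqs_in_Diff:
  "(S, z) \<in> pointed_structures L \<Longrightarrow> seqs_in L S (Mod L - A) = tail_dense S - seqs_in L S A"
  unfolding seqs_in_def Mod_def pointed_structures_def by blast

text \<open>A smaller ball may restrict more coordinates than the given one, hence the infimum over
  all lengths \<open>n + i\<close>. Passing from the formula to nonmeagerness uses only that
  nonempty open sets are nonmeager; the converse rests on the Baire property.\<close>

lemma forces_Diff:
  assumes g: "forces g A"
    and A: "\<And>S z. (S, z) \<in> pointed_structures L \<Longrightarrow> baire_property (tail_dense_topology S) (seqs_in L S A)"
  shows "forces (\<lambda>n. CInf (\<lambda>i. exists_near n (n + i) (g (n + i)))) (Mod L - A)"
proof -
  have g': "formula L (g m) (base_modulus L m) {0..c}" "is_modulus {..<m} (base_modulus L m)"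
    "{0..c} \<subseteq> {0..}" "fv (g m) \<subseteq> {..<m}" for m
    using g is_modulus_base_modulus[OF L] unfolding forces_def controlled_def by auto
  have ctrl: "controlled L c n (exists_near n (n + i) (g (n + i)))" for n i
    by (rule controlled_exists_near[OF L c _ g']) simp
  have step: "eval S (CInf (\<lambda>i. exists_near n (n + i) (g (n + i)))) e < u \<longleftrightarrow>
      \<not> meager_in (tail_dense_topology S) (seqs_in L S (Mod L - A) \<inter> tuple_ball S n e u)"
    if Sz: "(S, z) \<in> pointed_structures L" and e: "range e \<subseteq> universe S" and u: "0 < u" "u \<le> 1"
    for S z n e u
  proof -
    interpret separable_structure L S z by (rule pointed_imp_separable[OF L Sz])
    let ?X = "tail_dense_topology S" and ?A = "seqs_in L S A"
    have gA: "eval S (g m) b < v \<longleftrightarrow> \<not> meager_in ?X (?A \<inter> tuple_ball S m b v)"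
      if "range b \<subseteq> universe S" "0 < v" "v \<le> 1" for m b v
      using g Sz that unfolding forces_def by blast
    have "eval S (CInf (\<lambda>i. exists_near n (n + i) (g (n + i)))) e < u \<longleftrightarrow>
        (\<exists>i. eval S (exists_near n (n + i) (g (n + i))) e < u)"
      by (rule eval_CInf_less[OF L S universe_ne ctrl e])
    also have "\<dots> \<longleftrightarrow> (\<exists>i b. range b \<subseteq> universe S \<and> 0 < eval S (g (n + i)) b \<and>
        (\<forall>j<n. mdst S (b j) (e j) < u))"
      by (subst eval_exists_near_less[OF L S universe_ne c _ g' e u]) simp_all
    also have "\<dots> \<longleftrightarrow> \<not> meager_in ?X (seqs_in L S (Mod L - A) \<inter> tuple_ball S n e u)"
    proof
      assume "\<exists>i b. range b \<subseteq> universe S \<and> 0 < eval S (g (n + i)) b \<and> (\<forall>j<n. mdst S (b j) (e j) < u)"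
      then obtain i b where b: "range b \<subseteq> universe S" "0 < eval S (g (n + i)) b"
        "\<And>j. j < n \<Longrightarrow> mdst S (b j) (e j) < u" by blast
      \<comment> \<open>Three demands: \<open>v \<le> 1\<close> for the specification of
        \<open>g\<close> to apply, \<open>v\<close> at most the value of \<open>g\<close> so that
        \<open>A\<close> is meager in the ball around \<open>b\<close>, and \<open>v\<close> small
        enough for that ball to stay in the given one.\<close>
      define v where "v = Min (insert 1 (insert (eval S (g (n + i)) b) ((\<lambda>j. u - mdst S (b j) (e j)) ` {..<n})))"
      have "0 < v" unfolding v_def using b(2,3) by auto
      moreover have "v \<le> 1" "v \<le> eval S (g (n + i)) b" "\<And>j. j < n \<Longrightarrow> v \<le> u - mdst S (b j) (e j)"
        unfolding v_def by (rule Min_le; simp)+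
      ultimately have v: "0 < v" "v \<le> 1" "v \<le> eval S (g (n + i)) b"
        "\<And>j. j < n \<Longrightarrow> v \<le> u - mdst S (b j) (e j)" .
      let ?B = "tuple_ball S (n + i) b v"
      have m: "meager_in ?X (?A \<inter> ?B)" using gA[OF b(1) v(1,2), of "n + i"] v(3) by auto
      have sub: "?B \<subseteq> tuple_ball S n e u"
        using v(4) by (intro tuple_ball_subset b(1) e) (auto simp: algebra_simps)
      show "\<not> meager_in ?X (seqs_in L S (Mod L - A) \<inter> tuple_ball S n e u)"
      proof
        assume "meager_in ?X (seqs_in L S (Mod L - A) \<inter> tuple_ball S n e u)"
        then have "meager_in ?X ((?A \<inter> ?B) \<union> (seqs_in L S (Mod L - A) \<inter> tuple_ball S n e u))"
          using m by (intro meager_in_Un)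
        then have "meager_in ?X ?B"
          by (rule meager_in_subset)
            (use sub in \<open>auto simp: seqs_in_Diff[OF Sz] tuple_ball_def\<close>)
        then show False
          using not_meager_tail_dense[OF openin_tuple_ball[OF b(1)] tuple_ball_ne[OF b(1) v(1)]] by blast
      qed
    next
      assume nm: "\<not> meager_in ?X (seqs_in L S (Mod L - A) \<inter> tuple_ball S n e u)"
      have "baire_property ?X (seqs_in L S (Mod L - A))"
        using baire_property_Diff[OF A[OF Sz]] by (simp add: seqs_in_Diff[OF Sz])
      then obtain W where W: "openin ?X W" "W \<noteq> {}" "W \<subseteq> tuple_ball S n e u"
        "meager_in ?X (W - seqs_in L S (Mod L - A))"
        using baire_property_nonmeager[OF _ openin_tuple_ball[OF e] nm] by blast
      obtain y where y: "y \<in> W" using W(2) by blast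
      obtain m v where mv: "n \<le> m" "0 < v" "v \<le> 1" "tuple_ball S m y v \<subseteq> W"
        using open_contains_tuple_ball[OF W(1) y, of n] by blast
      have "y \<in> tail_dense S" using y W(3) by (auto simp: tuple_ball_def)
      then have ry: "range y \<subseteq> universe S" using tail_dense_range by blast
      have "?A \<inter> tuple_ball S m y v \<subseteq> W - seqs_in L S (Mod L - A)"
        using mv(4) by (auto simp: seqs_in_Diff[OF Sz])
      then have "meager_in ?X (?A \<inter> tuple_ball S m y v)" by (rule meager_in_subset[OF W(4)])
      then have "v \<le> eval S (g m) y" using gA[OF ry mv(2,3), of m] by auto
      moreover have "\<forall>j<n. mdst S (y j) (e j) < u" using y W(3) by (auto simp: tuple_ball_def)
      moreover have "n + (m - n) = m" using mv(1) by simp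
      ultimately show "\<exists>i b. range b \<subseteq> universe S \<and> 0 < eval S (g (n + i)) b \<and>
          (\<forall>j<n. mdst S (b j) (e j) < u)"
        using ry mv(2) by (intro exI[of _ "m - n"] exI[of _ y]) auto
    qed
    finally show ?thesis .
  qed
  show ?thesis by (rule forcesI[OF controlled_CInf[OF ctrl] step])
qed

text \<open>The induction carries both claims together because the complement step for forcing uses
  the Baire property of the set being complemented.\<close>

lemma borel_forces:
  assumes "A \<in> borel_sets_of (Mod_topology L)"
  shows "(\<exists>g. forces g A) \<and>
    (\<forall>S z. (S, z) \<in> pointed_structures L \<longrightarrow> baire_property (tail_dense_topology S) (seqs_in L S A))"
proof -
  have "A \<in> sigma_sets (Mod L) {code_interval L p q r | p q r. p \<in> code_index L}"
    using borel_Mod assms by blast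
  then show ?thesis
  proof (induction rule: sigma_sets.induct)
    case (Basic A)
    then obtain P js q r where A: "A = code_interval L (P, js) q r" "(P, js) \<in> code_index L" by auto
    have "baire_property (tail_dense_topology S) (seqs_in L S A)"
      if Sz: "(S, z) \<in> pointed_structures L" for S z
    proof -
      interpret separable_structure L S z by (rule pointed_imp_separable[OF L Sz])
      obtain \<Delta> K where h: "formula L (interval_fm P js q r) \<Delta> K"
        using formula_interval_fm[OF L A(2)] by metis
      have "code_of L S y \<in> Mod L" if "y \<in> tail_dense S" for y
        using that Sz unfolding Mod_def pointed_structures_def by blast
      then have "{y \<in> tail_dense S. eval S (Scale (-1) (interval_fm P js q r)) y < 0} = seqs_in L S A"
        using A by (auto simp: seqs_in_def code_interval_def eval_interval_fm code_of_def of_rat_minus)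
      then show ?thesis
        using openin_eval_less[OF formula.scale[OF h, of "-1"], of 0] baire_property_open by metis
    qed
    then show ?case using forces_interval[OF A(2)] A(1) by blast
  next
    case Empty
    have "seqs_in L S {} = {}" for S :: "point mstruct" by (simp add: seqs_in_def)
    then show ?case using forces_empty baire_property_open[OF openin_empty] by metis
  next
    case (Compl A)
    have "baire_property (tail_dense_topology S) (seqs_in L S (Mod L - A))"
      if Sz: "(S, z) \<in> pointed_structures L" for S z
    proof -
      interpret separable_structure L S z by (rule pointed_imp_separable[OF L Sz])
      have "baire_property (tail_dense_topology S) (seqs_in L S A)" using Compl.IH Sz by blast
      then show ?thesis using baire_property_Diff by (fastforce simp: seqs_in_Diff[OF Sz])
    qed
    moreover obtain g where "forces g A" using Compl.IH by blast
    ultimately show ?case using forces_Diff[of g A] Compl.IH by blast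
  next
    case (Union A)
    have "\<forall>i. \<exists>g. forces g (A i)" using Union.IH by blast
    then obtain g where "\<And>i. forces (g i) (A i)" by metis
    then have "\<exists>g. forces g (\<Union>i. A i)" using forces_UN by blast
    moreover have "baire_property (tail_dense_topology S) (seqs_in L S (\<Union>i. A i))"
      if Sz: "(S, z) \<in> pointed_structures L" for S z
    proof -
      have "seqs_in L S (\<Union>i. A i) = (\<Union>i. seqs_in L S (A i))" by (auto simp: seqs_in_def)
      moreover have "baire_property (tail_dense_topology S) (seqs_in L S (A i))" for i
        using Union.IH Sz by blast
      ultimately show ?thesis using baire_property_UN[of _ "\<lambda>i. seqs_in L S (A i)"] by simp
    qed
    ultimately show ?case by blast
  qed
qed

end

section \<open>The fragment topology\<close>

definition basic_open :: "signature \<Rightarrow> fm \<Rightarrow> nat list \<Rightarrow> rat \<Rightarrow> code set" where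
  "basic_open L \<phi> a r = {code_of L S y | S y. (S, y) \<in> pointed_structures L
     \<and> eval S \<phi> (\<lambda>i. y (a ! i)) < of_rat r}"

lemma fragment_topology_basic_open:
  "fragment_topology L F =
     topology_generated_by {basic_open L \<phi> a r | \<phi> a r. \<phi> \<in> F \<and> fv \<phi> \<subseteq> {..<length a}}"
  unfolding fragment_topology_def basic_open_def ..

lemma code_in_Mod: "(S, z) \<in> pointed_structures L \<Longrightarrow> code_of L S z \<in> Mod L"
  unfolding Mod_def by blast

lemma basic_open_subset: "basic_open L \<phi> a r \<subseteq> Mod L"
  unfolding basic_open_def Mod_def by blast

text \<open>Pointed structures with the same code give the formula the same value, so any
  representative decides membership.\<close>

lemma in_basic_open:
  assumes L: "is_signature L" and \<phi>: "\<phi> \<in> formulas L" and Sz: "(S, z) \<in> pointed_structures L"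
  shows "code_of L S z \<in> basic_open L \<phi> a r \<longleftrightarrow> eval S \<phi> (\<lambda>i. z (a ! i)) < of_rat r"
proof
  assume "code_of L S z \<in> basic_open L \<phi> a r"
  then obtain S' y where y: "code_of L S z = code_of L S' y" "(S', y) \<in> pointed_structures L"
    "eval S' \<phi> (\<lambda>i. y (a ! i)) < of_rat r"
    unfolding basic_open_def by blast
  obtain \<Delta> K where "formula L \<phi> \<Delta> K" using \<phi> by (auto simp: formulas_def)
  then have "eval S \<phi> (\<lambda>i. z (a ! i)) = eval S' \<phi> (\<lambda>i. y (a ! i))"
    using Sz y(1,2) by (intro eval_code[OF L]) (auto simp: pointed_structures_def)
  then show "eval S \<phi> (\<lambda>i. z (a ! i)) < of_rat r" using y(3) by simp
qed (use Sz in \<open>auto simp: basic_open_def\<close>)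

lemma Mod_set_eqI:
  assumes "A \<subseteq> Mod L" "B \<subseteq> Mod L"
    and "\<And>S z. (S, z) \<in> pointed_structures L \<Longrightarrow> code_of L S z \<in> A \<longleftrightarrow> code_of L S z \<in> B"
  shows "A = B"
proof -
  have "x \<in> A \<longleftrightarrow> x \<in> B" if "x \<in> Mod L" for x using assms(3) that unfolding Mod_def by blast
  then show ?thesis using assms(1,2) by blast
qed

lemma meager_in_countable_UN:
  assumes "countable I" "\<And>i. i \<in> I \<Longrightarrow> meager_in X (A i)"
  shows "meager_in X (\<Union>i\<in>I. A i)"
proof (cases "I = {}")
  case False
  then have "(\<Union>i\<in>I. A i) = (\<Union>n. A (from_nat_into I n))"
    using assms(1) by (metis image_image range_from_nat_into)
  then show ?thesis using assms(2) from_nat_into[OF False] by (simp add: meager_in_UN)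
qed (simp add: meager_in_empty)

context
  fixes L :: signature and F :: "fm set"
  assumes L: "is_signature L" and F: "fragment L F"
begin

lemma fragment_formulas: "\<phi> \<in> F \<Longrightarrow> \<phi> \<in> formulas L"
  using F unfolding fragment_def by blast

lemma topspace_fragment_topology: "topspace (fragment_topology L F) = Mod L"
proof
  show "topspace (fragment_topology L F) \<subseteq> Mod L"
    unfolding fragment_topology_basic_open topology_generated_by_topspace
    using basic_open_subset by blast
  have "One \<in> F" using F unfolding fragment_def by blast
  \<comment> \<open>The constant 1 is below 2 everywhere, so this single subbasic set is all of
    \<open>Mod L\<close>.\<close>
  then have "basic_open L One [] 2 \<subseteq> topspace (fragment_topology L F)"
    unfolding fragment_topology_basic_open topology_generated_by_topspace by fastforce
  moreover have "basic_open L One [] 2 = Mod L"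
    using in_basic_open[OF L fragment_formulas[OF \<open>One \<in> F\<close>]] basic_open_subset
    by (intro Mod_set_eqI[of _ L]) (auto simp: code_in_Mod)
  ultimately show "Mod L \<subseteq> topspace (fragment_topology L F)" by simp
qed

lemma openin_basic_open:
  "\<phi> \<in> F \<Longrightarrow> fv \<phi> \<subseteq> {..<length a} \<Longrightarrow> openin (fragment_topology L F) (basic_open L \<phi> a r)"
  unfolding fragment_topology_basic_open by (rule topology_generated_by_Basis) blast

text \<open>A value is below \<open>r\<close> iff it is at most \<open>r - 1 / real (Suc n)\<close>
  for some \<open>n\<close>. Such a weak inequality is a closed condition because the negated
  formula is also in the fragment and defines the open complement.\<close>

lemma fragment_topology_fsigma:
  assumes "openin (fragment_topology L F) U"
  shows "\<exists>C :: nat \<Rightarrow> _. (\<forall>n. closedin (fragment_topology L F) (C n)) \<and> U = (\<Union>n. C n)"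
  using assms unfolding fragment_topology_basic_open
proof (rule topology_generated_by_fsigma[rotated 2], fold fragment_topology_basic_open)
  have "countable F" using F unfolding fragment_def by blast
  moreover have "{basic_open L \<phi> a r | \<phi> a r. \<phi> \<in> F \<and> fv \<phi> \<subseteq> {..<length a}}
      \<subseteq> (\<lambda>(\<phi>, a, r). basic_open L \<phi> a r) ` (F \<times> UNIV)"
  proof
    fix V assume "V \<in> {basic_open L \<phi> a r | \<phi> a r. \<phi> \<in> F \<and> fv \<phi> \<subseteq> {..<length a}}"
    then obtain \<phi> a r where "V = basic_open L \<phi> a r" "\<phi> \<in> F" by blast
    then show "V \<in> (\<lambda>(\<phi>, a, r). basic_open L \<phi> a r) ` (F \<times> UNIV)"
      by (intro image_eqI[of _ _ "(\<phi>, a, r)"]) simp_all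
  qed
  ultimately show "countable {basic_open L \<phi> a r | \<phi> a r. \<phi> \<in> F \<and> fv \<phi> \<subseteq> {..<length a}}"
    by (meson countable_SIGMA countable_image countable_subset countableI_type)
next
  fix V assume "V \<in> {basic_open L \<phi> a r | \<phi> a r. \<phi> \<in> F \<and> fv \<phi> \<subseteq> {..<length a}}"
  then obtain \<phi> a r where V: "V = basic_open L \<phi> a r" "\<phi> \<in> F" "fv \<phi> \<subseteq> {..<length a}" by blast
  have \<phi>': "Scale (-1) \<phi> \<in> F" using F V(2) unfolding fragment_def by blast
  define C where "C n = Mod L - basic_open L (Scale (-1) \<phi>) a (1 / of_nat (Suc n) - r)" for n :: nat
  have "closedin (fragment_topology L F) (C n)" for n
    unfolding C_def topspace_fragment_topology[symmetric]
    by (intro closedin_diff closedin_topspace openin_basic_open[OF \<phi>']) (simp add: V(3))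
  moreover have "V = (\<Union>n. C n)"
  proof (rule Mod_set_eqI)
    fix S z assume Sz: "(S, z) \<in> pointed_structures L"
    let ?v = "eval S \<phi> (\<lambda>i. z (a ! i))"
    have C: "code_of L S z \<in> C n \<longleftrightarrow> ?v + 1 / real (Suc n) \<le> of_rat r" for n
      unfolding C_def using in_basic_open[OF L fragment_formulas[OF \<phi>'] Sz] code_in_Mod[OF Sz]
      by (auto simp: of_rat_minus of_rat_diff of_rat_divide of_rat_add algebra_simps not_less)
    have "?v < of_rat r \<longleftrightarrow> (\<exists>n. ?v + 1 / real (Suc n) \<le> of_rat r)"
    proof
      assume "?v < of_rat r"
      then obtain n where "1 / real (Suc n) < of_rat r - ?v" using nat_approx_posE diff_gt_0_iff_gt by metis
      then show "\<exists>n. ?v + 1 / real (Suc n) \<le> of_rat r" by (intro exI[of _ n]) linarith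
    next
      assume "\<exists>n. ?v + 1 / real (Suc n) \<le> of_rat r"
      then obtain n where "?v + 1 / real (Suc n) \<le> of_rat r" by blast
      moreover have "0 < 1 / real (Suc n)" by simp
      ultimately show "?v < of_rat r" by linarith
    qed
    then show "code_of L S z \<in> V \<longleftrightarrow> code_of L S z \<in> (\<Union>n. C n)"
      using in_basic_open[OF L fragment_formulas[OF V(2)] Sz] C unfolding V(1) by simp
  qed (use basic_open_subset V(1) in \<open>auto simp: C_def\<close>)
  ultimately show "\<exists>C :: nat \<Rightarrow> _. (\<forall>n. closedin (fragment_topology L F) (C n)) \<and> V = (\<Union>n. C n)"
    by blast
qed

text \<open>By the triangle inequality the condition puts the ball around \<open>b\<close> of radius
  \<open>1 / real (Suc j)\<close> inside the ball around \<open>a\<close> of radius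
  \<open>1 / real k\<close>. Its failure for one \<open>i\<close> is subbasic open, by the negated
  metric formula. The length condition does not involve the code.\<close>

lemma closedin_index_dist:
  "closedin (fragment_topology L F) {c \<in> Mod L. n \<le> length b \<and>
     (\<forall>i<n. c (0, [b ! i, a ! i]) + 1 / real (Suc j) \<le> 1 / real k)}"
  (is "closedin _ ?E")
proof (cases "n \<le> length b")
  case False
  then show ?thesis by simp
next
  case True
  let ?P = "Pred 0 [0, 1]"
  have P: "?P \<in> F" "Scale (-1) ?P \<in> F"
    using F L unfolding fragment_def is_signature_def by auto
  let ?O = "\<lambda>i. basic_open L (Scale (-1) ?P) [b ! i, a ! i] (1 / of_nat (Suc j) - 1 / of_nat k)"
  have O: "c \<in> ?O i \<longleftrightarrow> \<not> c (0, [b ! i, a ! i]) + 1 / real (Suc j) \<le> 1 / real k"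
    if c: "c \<in> Mod L" for c i
  proof -
    obtain S z where Sz: "c = code_of L S z" "(S, z) \<in> pointed_structures L"
      using c unfolding Mod_def by blast
    have "c (0, [b ! i, a ! i]) = interp S 0 [z (b ! i), z (a ! i)]"
      using L unfolding Sz(1) by (simp add: code_of_def code_index_def is_signature_def)
    then show ?thesis
      unfolding Sz(1) in_basic_open[OF L fragment_formulas[OF P(2)] Sz(2)]
      by (auto simp: of_rat_minus of_rat_diff of_rat_divide of_rat_add algebra_simps not_less)
  qed
  have "Mod L - ?E = (\<Union>i\<in>{..<n}. ?O i)"
  proof (intro equalityI subsetI)
    fix c assume "c \<in> Mod L - ?E"
    then show "c \<in> (\<Union>i\<in>{..<n}. ?O i)" using O[of c] True by auto
  next
    fix c assume "c \<in> (\<Union>i\<in>{..<n}. ?O i)"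
    then obtain i where i: "i < n" "c \<in> ?O i" by blast
    then have "c \<in> Mod L" using basic_open_subset by blast
    then show "c \<in> Mod L - ?E" using O[of c i] i by auto
  qed
  moreover have "openin (fragment_topology L F) (\<Union>i\<in>{..<n}. ?O i)"
  proof (rule openin_Union)
    fix T assume "T \<in> ?O ` {..<n}"
    then obtain i where "T = ?O i" by blast
    moreover have "openin (fragment_topology L F) (?O i)"
      by (rule openin_basic_open[OF P(2)]) simp
    ultimately show "openin (fragment_topology L F) T" by simp
  qed
  ultimately show ?thesis
    unfolding closedin_def topspace_fragment_topology by auto
qed

end

context separable_structure
begin

text \<open>The centre \<open>y\<close> is moved to distinguished elements, so that balls inside
  \<open>W\<close> can be sought among countably many. Containment is delivered in the form of
  distance inequalities, which the code can express.\<close>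

lemma open_contains_index_ball:
  assumes W: "openin (tail_dense_topology S) W" "y \<in> W"
    and sub: "W \<subseteq> tuple_ball S (length a) (\<lambda>i. z (a ! i)) u"
  obtains b j where "length a \<le> length b"
    "\<And>i. i < length a \<Longrightarrow> mdst S (z (b ! i)) (z (a ! i)) + 1 / real (Suc j) \<le> u"
    "tuple_ball S (length b) (\<lambda>i. z (b ! i)) (1 / real (Suc j)) \<subseteq> W"
proof -
  obtain m v where mv: "length a \<le> m" "0 < v" "tuple_ball S m y v \<subseteq> W"
    using open_contains_tuple_ball[OF W, of "length a"] by metis
  have y: "y \<in> tail_dense S" "\<And>i. i < length a \<Longrightarrow> mdst S (y i) (z (a ! i)) < u"
    using W(2) sub by (auto simp: tuple_ball_def)
  define \<epsilon> where "\<epsilon> = Min (insert v ((\<lambda>i. u - mdst S (y i) (z (a ! i))) ` {..<length a}))"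
  have "0 < \<epsilon>" unfolding \<epsilon>_def using mv(2) y(2) by auto
  moreover have \<epsilon>: "\<epsilon> \<le> v" "\<And>i. i < length a \<Longrightarrow> \<epsilon> \<le> u - mdst S (y i) (z (a ! i))"
    unfolding \<epsilon>_def by (rule Min_le; simp)+
  \<comment> \<open>The length \<open>1 / real (Suc j)\<close> is spent twice, once for moving the
    centre and once as the new radius; hence half of \<open>\<epsilon>\<close>.\<close>
  ultimately obtain j where j: "1 / real (Suc j) < \<epsilon> / 2" using nat_approx_posE half_gt_zero by metis
  have "\<exists>k. mdst S (y i) (z k) < 1 / real (Suc j)" for i
    using tail_dense_near[OF S z tail_dense_range[OF y(1), of i], of "1 / real (Suc j)"] by auto
  then obtain k where k: "\<And>i. mdst S (y i) (z (k i)) < 1 / real (Suc j)" by metis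
  let ?b = "map k [0..<m]"
  have zr: "range (\<lambda>i. z (s i)) \<subseteq> universe S" for s :: "nat \<Rightarrow> nat" using tail_dense_range[OF z] by blast
  have yr: "range y \<subseteq> universe S" using tail_dense_range[OF y(1)] by blast
  have "tuple_ball S (length ?b) (\<lambda>i. z (?b ! i)) (1 / real (Suc j)) \<subseteq> tuple_ball S m y v"
  proof (rule tuple_ball_subset)
    fix i assume "i < m"
    then show "mdst S (z (?b ! i)) (y i) + 1 / real (Suc j) \<le> v"
      using k[of i] j \<epsilon>(1) commute[of "y i"] by simp
  qed (use zr yr in auto)
  moreover have "mdst S (z (?b ! i)) (z (a ! i)) + 1 / real (Suc j) \<le> u" if i: "i < length a" for i
  proof -
    have "mdst S (z (k i)) (z (a ! i)) \<le> mdst S (z (k i)) (y i) + mdst S (y i) (z (a ! i))"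
      using tail_dense_range[OF z] tail_dense_range[OF y(1)] by (intro triangle) auto
    then show ?thesis using k[of i] j \<epsilon>(2)[OF i] commute[of "y i" "z (k i)"] i mv(1) by simp
  qed
  ultimately show ?thesis using that[of ?b j] mv by auto
qed

end

section \<open>Vaught transforms\<close>

abbreviation index_ball :: "'m mstruct \<Rightarrow> (nat \<Rightarrow> 'm) \<Rightarrow> nat list \<Rightarrow> real \<Rightarrow> (nat \<Rightarrow> 'm) set" where
  "index_ball S z a u \<equiv> tuple_ball S (length a) (\<lambda>i. z (a ! i)) u"

lemma seq_dist_less: "0 < u \<Longrightarrow> seq_dist S y (map z a) < u \<longleftrightarrow> (\<forall>i<length a. mdst S (y i) (z (a ! i)) < u)"
  unfolding seq_dist_def by (subst Max_less_iff) auto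

lemma vaught_at_eq:
  assumes L: "is_signature L" and u: "0 < u"
  shows "vaught_at L A a u = {code_of L S z | S z. (S, z) \<in> pointed_structures L \<and>
     meager_in (tail_dense_topology S) ((tail_dense S - seqs_in L S A) \<inter> index_ball S z a u)}"
proof -
  have "comeager_in (subtopology (tail_dense_topology S) {y \<in> tail_dense S. seq_dist S y (map z a) < u})
      {y \<in> {y \<in> tail_dense S. seq_dist S y (map z a) < u}. code_of L S y \<in> A} \<longleftrightarrow>
    meager_in (tail_dense_topology S) ((tail_dense S - seqs_in L S A) \<inter> index_ball S z a u)"
    if Sz: "(S, z) \<in> pointed_structures L" for S z
  proof -
    interpret separable_structure L S z by (rule pointed_imp_separable[OF L Sz])
    have U: "{y \<in> tail_dense S. seq_dist S y (map z a) < u} = index_ball S z a u"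
      by (simp add: tuple_ball_def seq_dist_less[OF u])
    have "range (\<lambda>i. z (a ! i)) \<subseteq> universe S" using tail_dense_range[OF z] by blast
    then have "openin (tail_dense_topology S) (index_ball S z a u)" by (rule openin_tuple_ball)
    moreover have "topspace (subtopology (tail_dense_topology S) (index_ball S z a u))
        - {y \<in> index_ball S z a u. code_of L S y \<in> A}
      = (tail_dense S - seqs_in L S A) \<inter> index_ball S z a u"
      by (auto simp: seqs_in_def)
    ultimately show ?thesis
      unfolding U comeager_in_def by (simp add: meager_in_open_subtopology)
  qed
  then show ?thesis unfolding vaught_at_def Let_def by blast
qed

text \<open>The distance to the empty tuple is 0, so its ball of radius 1 is the whole space; the
  unrestricted transform is the case \<open>k = 1\<close> of the local one.\<close>

lemma vaught_eq_vaught_at: "vaught L A = vaught_at L A [] 1"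
proof -
  have "subtopology (tail_dense_topology S) {y \<in> tail_dense S. seq_dist S y (map z []) < 1}
      = tail_dense_topology S" for S :: "point mstruct" and z
    by (simp add: seq_dist_def tail_dense_topology_def subtopology_subtopology)
  then show ?thesis unfolding vaught_def vaught_at_def Let_def by (simp add: seq_dist_def)
qed

text \<open>Additive classes are paired with nonmeagerness and multiplicative ones with
  comeagerness, so that complementation exchanges the claims. All \<open>a\<close> and
  \<open>k\<close> are treated at once because a union refers to its members on other balls. The set
  \<open>B\<close> is described on every pointed structure, which makes membership independent of
  the representative.\<close>

lemma Sigma0_Pi0_transform:
  assumes L: "is_signature L" and F: "fragment L F"
    and t: "topspace t = Mod L" "\<And>U. openin t U \<Longrightarrow> U \<in> borel_sets_of (Mod_topology L)"
    and c: "1 \<le> c" "bound L 0 \<subseteq> {..c}"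
    and \<B>: "countable \<B>" "\<And>U x. openin t U \<Longrightarrow> x \<in> U \<Longrightarrow> \<exists>V\<in>\<B>. x \<in> V \<and> V \<subseteq> U"
    and g: "\<And>V. V \<in> \<B> \<Longrightarrow> forces L c (g V) V" "\<And>V n. V \<in> \<B> \<Longrightarrow> g V n \<in> F"
  shows "Sigma0 t \<alpha> A \<Longrightarrow> \<forall>a k. 0 < k \<longrightarrow> (\<exists>B. Sigma0 (fragment_topology L F) \<alpha> B \<and>
       (\<forall>S z. (S, z) \<in> pointed_structures L \<longrightarrow> (code_of L S z \<in> B \<longleftrightarrow>
         \<not> meager_in (tail_dense_topology S) (seqs_in L S A \<inter> index_ball S z a (1 / real k)))))"
    and "Pi0 t \<alpha> A \<Longrightarrow> \<forall>a k. 0 < k \<longrightarrow> (\<exists>B. Pi0 (fragment_topology L F) \<alpha> B \<and>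
       (\<forall>S z. (S, z) \<in> pointed_structures L \<longrightarrow> (code_of L S z \<in> B \<longleftrightarrow>
         meager_in (tail_dense_topology S) ((tail_dense S - seqs_in L S A) \<inter> index_ball S z a (1 / real k)))))"
proof (induction rule: Sigma0_Pi0.inducts)
  case (Sigma0_one A)
  show ?case
  proof (intro allI impI)
    fix a :: "nat list" and k :: nat assume k: "0 < k"
    let ?n = "length a" and ?\<V> = "{V \<in> \<B>. V \<subseteq> A}"
    \<comment> \<open>The threshold is rational, as \<open>basic_open\<close> demands, and for
      \<open>k > 0\<close> at most 1, as \<open>forces\<close> demands.\<close>
    let ?O = "\<lambda>V. basic_open L (g V ?n) a (1 / of_nat k)"
    have ctrl: "controlled L c ?n (g V ?n)" if "V \<in> \<B>" for V
      using g(1)[OF that] unfolding forces_def[OF L c] by blast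
    have "openin (fragment_topology L F) (\<Union>V\<in>?\<V>. ?O V)"
    proof (intro openin_Union ballI)
      fix T assume "T \<in> ?O ` ?\<V>"
      then show "openin (fragment_topology L F) T"
        using openin_basic_open[OF L F g(2)] ctrl unfolding controlled_def by auto
    qed
    then have "Sigma0 (fragment_topology L F) 1 (\<Union>V\<in>?\<V>. ?O V)" by (rule Sigma0_Pi0.Sigma0_one)
    moreover have "code_of L S z \<in> (\<Union>V\<in>?\<V>. ?O V) \<longleftrightarrow>
        \<not> meager_in (tail_dense_topology S) (seqs_in L S A \<inter> index_ball S z a (1 / real k))"
      if Sz: "(S, z) \<in> pointed_structures L" for S z
    proof -
      interpret separable_structure L S z by (rule pointed_imp_separable[OF L Sz])
      let ?X = "tail_dense_topology S" and ?I = "index_ball S z a (1 / real k)"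
      have zr: "range (\<lambda>i. z (a ! i)) \<subseteq> universe S" using tail_dense_range[OF z] by blast
      have "code_of L S z \<in> ?O V \<longleftrightarrow> \<not> meager_in ?X (seqs_in L S V \<inter> ?I)" if "V \<in> ?\<V>" for V
      proof -
        have "code_of L S z \<in> ?O V \<longleftrightarrow> eval S (g V ?n) (\<lambda>i. z (a ! i)) < 1 / real k"
          using in_basic_open[OF L fragment_formulas[OF L F g(2)] Sz] that by (simp add: of_rat_divide)
        also have "\<dots> \<longleftrightarrow> \<not> meager_in ?X (seqs_in L S V \<inter> ?I)"
        proof -
          have "forces L c (g V) V" using that g(1) by blast
          moreover have "0 < 1 / real k" "1 / real k \<le> 1" using k by auto
          ultimately show ?thesis using Sz zr unfolding forces_def[OF L c] by blast
        qed
        finally show ?thesis .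
      qed
      then have "code_of L S z \<in> (\<Union>V\<in>?\<V>. ?O V) \<longleftrightarrow> (\<exists>V\<in>?\<V>. \<not> meager_in ?X (seqs_in L S V \<inter> ?I))"
        by blast
      also have "\<dots> \<longleftrightarrow> \<not> meager_in ?X (\<Union>V\<in>?\<V>. seqs_in L S V \<inter> ?I)"
      proof -
        \<comment> \<open>Countability of the base enters here: an arbitrary union of meager sets
          need not be meager.\<close>
        have "countable ?\<V>" using \<B>(1) by (rule countable_subset[rotated]) blast
        then have "(\<forall>V\<in>?\<V>. meager_in ?X (seqs_in L S V \<inter> ?I)) \<Longrightarrow>
            meager_in ?X (\<Union>V\<in>?\<V>. seqs_in L S V \<inter> ?I)"
          by (intro meager_in_countable_UN) auto
        moreover have "meager_in ?X (\<Union>V\<in>?\<V>. seqs_in L S V \<inter> ?I) \<Longrightarrow>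
            V \<in> ?\<V> \<Longrightarrow> meager_in ?X (seqs_in L S V \<inter> ?I)" for V
          by (erule meager_in_subset) blast
        ultimately show ?thesis by blast
      qed
      also have "(\<Union>V\<in>?\<V>. seqs_in L S V \<inter> ?I) = seqs_in L S A \<inter> ?I"
      proof -
        have A: "\<Union>?\<V> = A" using second_countable_union_basis[OF \<B>(2) Sigma0_one] by simp
        have "seqs_in L S (\<Union>?\<V>) \<inter> ?I = (\<Union>V\<in>?\<V>. seqs_in L S V \<inter> ?I)" by (auto simp: seqs_in_def)
        then show ?thesis unfolding A by simp
      qed
      finally show ?thesis .
    qed
    ultimately show "\<exists>B. Sigma0 (fragment_topology L F) 1 B \<and>
       (\<forall>S z. (S, z) \<in> pointed_structures L \<longrightarrow> (code_of L S z \<in> B \<longleftrightarrow>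
         \<not> meager_in (tail_dense_topology S) (seqs_in L S A \<inter> index_ball S z a (1 / real k))))"
      by blast
  qed
next
  case (Sigma0_step \<alpha> \<beta> B)
  have "\<exists>C. Pi0 (fragment_topology L F) (\<beta> n) C \<and>
       (\<forall>S z. (S, z) \<in> pointed_structures L \<longrightarrow> (code_of L S z \<in> C \<longleftrightarrow>
         meager_in (tail_dense_topology S) ((tail_dense S - seqs_in L S (B n)) \<inter> index_ball S z b (1 / real (Suc j)))))"
    for n b j
    using Sigma0_step.IH[of n] by (meson zero_less_Suc)
  then obtain C where C: "\<And>n b j. Pi0 (fragment_topology L F) (\<beta> n) (C n b j)"
    "\<And>n b j S z. (S, z) \<in> pointed_structures L \<Longrightarrow> code_of L S z \<in> C n b j \<longleftrightarrow>
         meager_in (tail_dense_topology S) ((tail_dense S - seqs_in L S (B n)) \<inter> index_ball S z b (1 / real (Suc j)))"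
    by metis
  \<comment> \<open>The Baire property was shown for Borel sets of the standard topology. The
    hierarchy over \<open>t\<close> stays among them because open sets of \<open>t\<close> are
    Borel.\<close>
  have bor: "B n \<in> borel_sets_of (Mod_topology L)" for n
  proof -
    have "B n \<in> borel_sets_of t" using Sigma0_step.IH[of n] Pi0_borel by blast
    moreover have "borel_sets_of t \<subseteq> borel_sets_of (Mod_topology L)"
      unfolding borel_sets_of_def t(1) topspace_Mod_topology
      using t(2) by (intro sigma_sets_mono) (auto simp: borel_sets_of_def)
    ultimately show ?thesis by blast
  qed
  show ?case
  proof (intro allI impI)
    fix a :: "nat list" and k :: nat assume k: "0 < k"
    let ?E = "\<lambda>b j. {c \<in> Mod L. length a \<le> length b \<and>
       (\<forall>i<length a. c (0, [b ! i, a ! i]) + 1 / real (Suc j) \<le> 1 / real k)}"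
    \<comment> \<open>A triple is a witness: the member \<open>B n\<close>, the tuple
      \<open>b\<close> of indices, and the radius given by \<open>j\<close>. Intersecting with the
      closed set \<open>?E b j\<close> keeps the level \<open>\<beta> n\<close>, and the triples are
      countable, so \<open>from_nat\<close> enumerates them.\<close>
    define R where "R = (\<lambda>(n, b, j). C n b j \<inter> ?E b j)"
    have "1 \<le> \<beta> (fst p) \<and> \<beta> (fst p) < \<alpha> \<and> Pi0 (fragment_topology L F) (\<beta> (fst p)) (R p)" for p
    proof -
      obtain n b j where p: "p = (n, b, j)" by (cases p)
      have "Pi0 (fragment_topology L F) (\<beta> n) (C n b j \<inter> ?E b j)"
        by (rule Pi0_Int_closedin[OF fragment_topology_fsigma[OF L F] C(1) closedin_index_dist[OF L F]])
      then show ?thesis using Sigma0_step.IH[of n] unfolding R_def p by simp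
    qed
    then have "Sigma0 (fragment_topology L F) \<alpha> (\<Union>m. R (from_nat m))"
      by (intro Sigma0_Pi0.Sigma0_step[OF Sigma0_step.hyps, of "\<lambda>m. \<beta> (fst (from_nat m :: nat \<times> nat list \<times> nat))"]) blast
    moreover have "code_of L S z \<in> (\<Union>m. R (from_nat m)) \<longleftrightarrow>
        \<not> meager_in (tail_dense_topology S) (seqs_in L S (\<Union>n. B n) \<inter> index_ball S z a (1 / real k))"
      if Sz: "(S, z) \<in> pointed_structures L" for S z
    proof -
      interpret separable_structure L S z by (rule pointed_imp_separable[OF L Sz])
      let ?X = "tail_dense_topology S" and ?I = "index_ball S z a (1 / real k)"
      have zr: "range (\<lambda>i. z (s i)) \<subseteq> universe S" for s :: "nat \<Rightarrow> nat" using tail_dense_range[OF z] by blast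
      have "code_of L S z (0, [i, j]) = mdst S (z i) (z j)" for i j
        using L tail_dense_range[OF z] by (simp add: code_of_def code_index_def is_signature_def mdst_def)
      then have R: "code_of L S z \<in> R (n, b, j) \<longleftrightarrow> length a \<le> length b \<and>
          (\<forall>i<length a. mdst S (z (b ! i)) (z (a ! i)) + 1 / real (Suc j) \<le> 1 / real k) \<and>
          meager_in ?X ((tail_dense S - seqs_in L S (B n)) \<inter> index_ball S z b (1 / real (Suc j)))" for n b j
        unfolding R_def using C(2)[OF Sz] code_in_Mod[OF Sz] by auto
      have "code_of L S z \<in> (\<Union>m. R (from_nat m)) \<longleftrightarrow> (\<exists>p. code_of L S z \<in> R p)"
        by (metis UNIV_I UN_iff from_nat_to_nat)
      also have "\<dots> \<longleftrightarrow> (\<exists>n b j. code_of L S z \<in> R (n, b, j))" by (metis prod_cases3)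
      also have "\<dots> \<longleftrightarrow> \<not> meager_in ?X (seqs_in L S (\<Union>n. B n) \<inter> ?I)"
      proof
        assume "\<exists>n b j. code_of L S z \<in> R (n, b, j)"
        then obtain n b j where r: "length a \<le> length b"
          "\<And>i. i < length a \<Longrightarrow> mdst S (z (b ! i)) (z (a ! i)) + 1 / real (Suc j) \<le> 1 / real k"
          "meager_in ?X ((tail_dense S - seqs_in L S (B n)) \<inter> index_ball S z b (1 / real (Suc j)))"
          using R by blast
        let ?J = "index_ball S z b (1 / real (Suc j))"
        have sub: "?J \<subseteq> ?I" by (rule tuple_ball_subset[OF r(1) zr zr r(2)])
        show "\<not> meager_in ?X (seqs_in L S (\<Union>n. B n) \<inter> ?I)"
        proof
          assume "meager_in ?X (seqs_in L S (\<Union>n. B n) \<inter> ?I)"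
          from meager_in_Un[OF this r(3)] have "meager_in ?X ?J"
            by (rule meager_in_subset) (use sub in \<open>auto simp: seqs_in_def tuple_ball_def\<close>)
          moreover have "?J \<noteq> {}" by (rule tuple_ball_ne[OF zr]) simp
          ultimately show False using not_meager_tail_dense[OF openin_tuple_ball[OF zr]] by blast
        qed
      next
        assume "\<not> meager_in ?X (seqs_in L S (\<Union>n. B n) \<inter> ?I)"
        moreover have "seqs_in L S (\<Union>n. B n) \<inter> ?I = (\<Union>n. seqs_in L S (B n) \<inter> ?I)"
          by (auto simp: seqs_in_def)
        ultimately obtain n where n: "\<not> meager_in ?X (seqs_in L S (B n) \<inter> ?I)"
          using meager_in_UN[of ?X "\<lambda>n. seqs_in L S (B n) \<inter> ?I"] by metis
        have "baire_property ?X (seqs_in L S (B n))"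
          using borel_forces[OF L c bor] Sz by blast
        then obtain W where W: "openin ?X W" "W \<noteq> {}" "W \<subseteq> ?I" "meager_in ?X (W - seqs_in L S (B n))"
          using baire_property_nonmeager[OF _ openin_tuple_ball[OF zr] n] by blast
        then obtain y where "y \<in> W" by blast
        obtain b j where bj: "length a \<le> length b"
          "\<And>i. i < length a \<Longrightarrow> mdst S (z (b ! i)) (z (a ! i)) + 1 / real (Suc j) \<le> 1 / real k"
          "index_ball S z b (1 / real (Suc j)) \<subseteq> W"
          using open_contains_index_ball[OF W(1) \<open>y \<in> W\<close> W(3)] by blast
        have "meager_in ?X ((tail_dense S - seqs_in L S (B n)) \<inter> index_ball S z b (1 / real (Suc j)))"
          by (rule meager_in_subset[OF W(4)]) (use bj(3) in blast)
        then show "\<exists>n b j. code_of L S z \<in> R (n, b, j)" using R bj by blast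
      qed
      finally show ?thesis .
    qed
    ultimately show "\<exists>C. Sigma0 (fragment_topology L F) \<alpha> C \<and>
       (\<forall>S z. (S, z) \<in> pointed_structures L \<longrightarrow> (code_of L S z \<in> C \<longleftrightarrow>
         \<not> meager_in (tail_dense_topology S) (seqs_in L S (\<Union>n. B n) \<inter> index_ball S z a (1 / real k))))"
      by blast
  qed
next
  case (Pi0 \<alpha> A)
  show ?case
  proof (intro allI impI)
    fix a :: "nat list" and k :: nat assume k: "0 < k"
    obtain B where B: "Sigma0 (fragment_topology L F) \<alpha> B"
      "\<And>S z. (S, z) \<in> pointed_structures L \<Longrightarrow> code_of L S z \<in> B \<longleftrightarrow>
         \<not> meager_in (tail_dense_topology S) (seqs_in L S A \<inter> index_ball S z a (1 / real k))"
      using Pi0.IH k by blast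
    have "Pi0 (fragment_topology L F) \<alpha> (Mod L - B)"
      using Sigma0_Pi0.Pi0[OF B(1)] by (simp add: topspace_fragment_topology[OF L F])
    moreover have "code_of L S z \<in> Mod L - B \<longleftrightarrow> meager_in (tail_dense_topology S)
        ((tail_dense S - seqs_in L S (topspace t - A)) \<inter> index_ball S z a (1 / real k))"
      if Sz: "(S, z) \<in> pointed_structures L" for S z
    proof -
      have "tail_dense S - (tail_dense S - seqs_in L S A) = seqs_in L S A"
        by (auto simp: seqs_in_def)
      then show ?thesis
        using B(2)[OF Sz] code_in_Mod[OF Sz] by (simp add: t(1) seqs_in_Diff[OF L c Sz])
    qed
    ultimately show "\<exists>C. Pi0 (fragment_topology L F) \<alpha> C \<and>
       (\<forall>S z. (S, z) \<in> pointed_structures L \<longrightarrow> (code_of L S z \<in> C \<longleftrightarrow> meager_in (tail_dense_topology S)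
        ((tail_dense S - seqs_in L S (topspace t - A)) \<inter> index_ball S z a (1 / real k))))"
      by blast
  qed
qed

theorem theorem4p8:
  fixes L :: signature and t :: "code topology" and \<alpha> :: omega1
  assumes "is_signature L"
    and "topspace t = Mod L"
    and "polish_topology t"
    and "\<And>U. openin t U \<Longrightarrow> U \<in> borel_sets_of (Mod_topology L)"
    and "1 \<le> \<alpha>"
  shows "\<exists>F. fragment L F \<and>
    (\<forall>A. Pi0 t \<alpha> A \<longrightarrow>
       Pi0 (fragment_topology L F) \<alpha> (vaught L A) \<and>
       (\<forall>(a :: nat list) (k :: nat). 0 < k \<longrightarrow>
          Pi0 (fragment_topology L F) \<alpha> (vaught_at L A a (1 / real k))))"
proof -
  have L: "is_signature L" by (rule assms(1))
  have "bounded (bound L 0)"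
    using L compact_imp_bounded unfolding is_signature_def by blast
  then obtain c0 where c0: "\<And>x. x \<in> bound L 0 \<Longrightarrow> \<bar>x\<bar> \<le> c0" by (auto simp: bounded_iff)
  \<comment> \<open>\<open>c\<close> has to bound both the metric and the constant 1 used in
    \<open>exists_near\<close>.\<close>
  define c where "c = max 1 c0"
  have c: "1 \<le> c" "bound L 0 \<subseteq> {..c}" using c0 unfolding c_def by fastforce+
  obtain \<B> where \<B>: "countable \<B>" "\<And>V. V \<in> \<B> \<Longrightarrow> openin t V"
    "\<And>U x. openin t U \<Longrightarrow> x \<in> U \<Longrightarrow> \<exists>V\<in>\<B>. x \<in> V \<and> V \<subseteq> U"
    using polish_topology_second_countable[OF assms(3)] unfolding second_countable_def by metis
  have "\<exists>g. forces L c g V" if "V \<in> \<B>" for V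
    using borel_forces[OF L c assms(4)[OF \<B>(2)[OF that]]] by blast
  then obtain g where g: "\<And>V. V \<in> \<B> \<Longrightarrow> forces L c (g V) V" by metis
  \<comment> \<open>All lengths \<open>n\<close> are included, since the tuples of the conclusion
    have arbitrary length.\<close>
  define \<Phi> where "\<Phi> = (\<lambda>(V, n). g V n) ` (\<B> \<times> UNIV)"
  have "\<Phi> \<subseteq> formulas L"
    using g unfolding \<Phi>_def forces_def[OF L c] controlled_def formulas_def by fastforce
  moreover have "countable \<Phi>" unfolding \<Phi>_def using \<B>(1) by simp
  ultimately obtain F where F: "fragment L F" "\<Phi> \<subseteq> F" using fragment_exists[OF L] by blast
  have gF: "g V n \<in> F" if "V \<in> \<B>" for V n using F(2) that unfolding \<Phi>_def by blast
  have main: "Pi0 (fragment_topology L F) \<alpha> (vaught_at L A a (1 / real k))"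
    if A: "Pi0 t \<alpha> A" and k: "0 < k" for A a k
  proof -
    obtain B where B: "Pi0 (fragment_topology L F) \<alpha> B"
      "\<And>S z. (S, z) \<in> pointed_structures L \<Longrightarrow> code_of L S z \<in> B \<longleftrightarrow> meager_in (tail_dense_topology S)
        ((tail_dense S - seqs_in L S A) \<inter> index_ball S z a (1 / real k))"
      using Sigma0_Pi0_transform(2)[OF L F(1) assms(2,4) c \<B>(1,3) g gF A] k by blast
    have "B \<subseteq> Mod L" using Pi0_subset[OF B(1)] by (simp add: topspace_fragment_topology[OF L F(1)])
    \<comment> \<open>\<open>B\<close> is rewritten through its representatives, the form in which
      \<open>vaught_at\<close> is given.\<close>
    then have "B = {code_of L S z | S z. (S, z) \<in> pointed_structures L \<and> code_of L S z \<in> B}"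
      unfolding Mod_def by blast
    also have "\<dots> = vaught_at L A a (1 / real k)"
      using k B(2) by (subst vaught_at_eq[OF L]) (simp, blast)
    finally show ?thesis using B(1) by simp
  qed
  moreover have "Pi0 (fragment_topology L F) \<alpha> (vaught L A)" if "Pi0 t \<alpha> A" for A
    using main[OF that, of 1 "[]"] by (simp add: vaught_eq_vaught_at)
  ultimately show ?thesis using F(1) by blast
qed

end
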